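(* Let $(\mathcal{M},\tau_{\mathcal{M}})$ and $(\mathcal{N},\tau_{\mathcal{N}})$ be finite von Neumann algebras with normal faithful tracial states, let $(\mathcal{M}_n)_n$ and $(\mathcal{N}_m)_m$ be filtrations of $\mathcal{M}$ and $\mathcal{N}$ respectively, and let $\mathbf{E}_n\otimes\mathbf{E}_m:\mathcal{M}\bar\otimes\mathcal{N}\to\mathcal{M}_n\bar\otimes\mathcal{N}_m$ be the tensor products of the associated conditional expectations. Let $\Psi:[0,\infty)\to[0,\infty]$ be a locally finite Young function. If the noncommutative strong maximal operator associated to $(\mathbf{E}_n\otimes\mathbf{E}_m)_{n,m}$ has (maximal) weak type $(\Psi,\Psi)$, then $\Psi\notin o\big(s\,(1+\log_+s)^2\big)$.
   Context: A Young function is a non-decreasing convex function $\Psi:[0,\infty)\to[0,\infty]$ with $\Psi(0)=0$ and $\lim_{t\to\infty}\Psi(t)=\infty$; it is locally finite if it is finite on bounded sets. $\log_+s=\max\{\log s,0\}$, and $\Psi\in o\big(s(1+\log_+s)^2\big)$ means $\lim_{s\to\infty}\frac{\Psi(s)}{s(1+\log_+s)^2}=0$. A filtration of a finite von Neumann algebra $\mathcal{M}$ is an ascending sequence $\mathcal{M}_n\subset\mathcal{M}_{n+1}\subset\cdots\subset\mathcal{M}$ of unital von Neumann subalgebras whose union is weak-$*$ dense in $\mathcal{M}$. The maps $\mathbf{E}_n:\mathcal{M}\to\mathcal{M}_n$ and $\mathbf{E}_m:\mathcal{N}\to\mathcal{N}_m$ are the (trace-preserving) conditional expectations onto the members of the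 two filtrations. $\mathcal{M}\bar\otimes\mathcal{N}$ is the von Neumann (spatial) tensor product, with trace $\tau=\tau_{\mathcal{M}}\otimes\tau_{\mathcal{N}}$. The strong maximal operator associated to $(\mathbf{E}_n\otimes\mathbf{E}_m)_{n,m}$ is of (maximal) weak type $(\Psi,\Psi)$ if there is $C\ge0$ such that for every positive $x\in\mathcal{M}\bar\otimes\mathcal{N}$ and every $\lambda>0$ there is a projection $e_\lambda\in\mathcal{M}\bar\otimes\mathcal{N}$ with (i) $\|e_\lambda\,(\mathbf{E}_n\otimes\mathbf{E}_m)(x)\,e_\lambda\|_\infty\le\lambda$ for all $n,m$, and (ii) $\tau(1-e_\lambda)\le\tau\big(\Psi(C|x|/\lambda)\big)$.
   Formalization: For fixed algebras and filtrations the claim fails (both algebras the complex numbers, Ψ(s)=s); it is stated instead assuming weak type (Ψ,Ψ) for all finite von Neumann algebras and all filtrations, with the constant allowed to depend on them. *)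

theory Defs
  imports "HOL-Analysis.Analysis"
begin

section \<open>The complex Hilbert space of square-summable families\<close>

text \<open>
  Every complex Hilbert space is isometric to \<open>\<ell>\<^sup>2(I)\<close> for some index set \<open>I\<close>, and the Hilbert space
  tensor product of \<open>\<ell>\<^sup>2(I)\<close> and \<open>\<ell>\<^sup>2(J)\<close> is \<open>\<ell>\<^sup>2(I \<times> J)\<close>. The inner product of the class
  \<open>real_inner\<close> is the real part of the complex one; both induce the same norm.
\<close>

typedef 'a ell2 = "{f :: 'a \<Rightarrow> complex. (\<lambda>i. (cmod (f i))\<^sup>2) summable_on UNIV}"
  morphisms ell2_nth Abs_ell2
  by (rule exI[of _ "\<lambda>_. 0"]) simp

setup_lifting type_definition_ell2

lemma ell2_summable: "(\<lambda>i. (cmod (ell2_nth x i))\<^sup>2) summable_on UNIV"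
  using ell2_nth[of x] by simp

lemma ell2_summable_add:
  assumes "(\<lambda>i. (cmod (f i))\<^sup>2) summable_on UNIV" "(\<lambda>i. (cmod (g i))\<^sup>2) summable_on UNIV"
  shows "(\<lambda>i. (cmod (f i + g i))\<^sup>2) summable_on UNIV"
proof (rule summable_on_comparison_test)
  show "(\<lambda>i. 2 * ((cmod (f i))\<^sup>2 + (cmod (g i))\<^sup>2)) summable_on UNIV"
    by (intro summable_on_cmult_right summable_on_add assms)
  show "(cmod (f i + g i))\<^sup>2 \<le> 2 * ((cmod (f i))\<^sup>2 + (cmod (g i))\<^sup>2)" for i
  proof -
    have "(cmod (f i + g i))\<^sup>2 \<le> (cmod (f i) + cmod (g i))\<^sup>2"
      by (intro power_mono norm_triangle_ineq) auto
    also have "\<dots> \<le> 2 * ((cmod (f i))\<^sup>2 + (cmod (g i))\<^sup>2)"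
      using zero_le_power2[of "cmod (f i) - cmod (g i)"] by (simp add: power2_eq_square algebra_simps)
    finally show ?thesis .
  qed
qed auto

lemma ell2_summable_scale:
  assumes "(\<lambda>i. (cmod (f i))\<^sup>2) summable_on UNIV"
  shows "(\<lambda>i. (cmod (c * f i))\<^sup>2) summable_on UNIV"
  by (simp add: norm_mult power_mult_distrib summable_on_cmult_right assms)

lemma ell2_summable_cinner: "(\<lambda>i. cnj (ell2_nth x i) * ell2_nth y i) summable_on UNIV"
proof -
  have "(\<lambda>i. norm (cnj (ell2_nth x i) * ell2_nth y i)) summable_on UNIV"
  proof (rule summable_on_comparison_test)
    show "(\<lambda>i. (cmod (ell2_nth x i))\<^sup>2 + (cmod (ell2_nth y i))\<^sup>2) summable_on UNIV"
      by (intro summable_on_add ell2_summable)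
    show "cmod (cnj (ell2_nth x i) * ell2_nth y i) \<le> (cmod (ell2_nth x i))\<^sup>2 + (cmod (ell2_nth y i))\<^sup>2" for i
      using zero_le_power2[of "cmod (ell2_nth x i) - cmod (ell2_nth y i)"]
        mult_nonneg_nonneg[OF norm_ge_zero[of "ell2_nth x i"] norm_ge_zero[of "ell2_nth y i"]]
      by (simp add: norm_mult power2_diff del: mult_nonneg_nonneg)
  qed auto
  then show ?thesis
    by (rule abs_summable_summable)
qed

definition cinner :: "'a ell2 \<Rightarrow> 'a ell2 \<Rightarrow> complex" where
  "cinner x y = (\<Sum>\<^sub>\<infinity>i. cnj (ell2_nth x i) * ell2_nth y i)"

instantiation ell2 :: (type) real_vector
begin

lift_definition zero_ell2 :: "'a ell2" is "\<lambda>_. 0" by simp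

lift_definition plus_ell2 :: "'a ell2 \<Rightarrow> 'a ell2 \<Rightarrow> 'a ell2" is "\<lambda>x y i. x i + y i"
  using ell2_summable_add by auto

lift_definition uminus_ell2 :: "'a ell2 \<Rightarrow> 'a ell2" is "\<lambda>x i. - x i" by simp

lift_definition minus_ell2 :: "'a ell2 \<Rightarrow> 'a ell2 \<Rightarrow> 'a ell2" is "\<lambda>x y i. x i - y i"
  subgoal for x y using ell2_summable_add[of x "\<lambda>i. - y i"] by simp
  done

lift_definition scaleR_ell2 :: "real \<Rightarrow> 'a ell2 \<Rightarrow> 'a ell2" is "\<lambda>r x i. r *\<^sub>R x i"
  unfolding scaleR_conv_of_real using ell2_summable_scale by auto

instance
proof
  fix x y z :: "'a ell2" and r s :: real
  show "x + y + z = x + (y + z)" by transfer (simp add: add.assoc)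
  show "x + y = y + x" by transfer (simp add: add.commute)
  show "0 + x = x" by transfer simp
  show "- x + x = 0" by transfer simp
  show "x - y = x + - y" by transfer simp
  show "r *\<^sub>R (x + y) = r *\<^sub>R x + r *\<^sub>R y" by transfer (simp add: scaleR_add_right)
  show "(r + s) *\<^sub>R x = r *\<^sub>R x + s *\<^sub>R x" by transfer (simp add: scaleR_add_left)
  show "r *\<^sub>R s *\<^sub>R x = (r * s) *\<^sub>R x" by transfer simp
  show "1 *\<^sub>R x = x" by transfer simp
qed

end

lemma cinner_commute: "cinner x y = cnj (cinner y x)"
  unfolding cinner_def by (subst infsum_cnj[symmetric]) (simp add: mult.commute)

lemma cinner_add_left: "cinner (x + y) z = cinner x z + cinner y z"
  unfolding cinner_def plus_ell2.rep_eq complex_cnj_add distrib_right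
  by (rule infsum_add) (rule ell2_summable_cinner)+

lemma cinner_add_right: "cinner x (y + z) = cinner x y + cinner x z"
  by (metis cinner_add_left cinner_commute complex_cnj_add)

lemma cinner_self_infsum: "Re (cinner x x) = (\<Sum>\<^sub>\<infinity>i. (cmod (ell2_nth x i))\<^sup>2)"
  unfolding cinner_def
  by (subst infsum_Re[symmetric, OF ell2_summable_cinner])
     (intro infsum_cong, simp add: cmod_power2, simp add: power2_eq_square)

instantiation ell2 :: (type) real_inner
begin

definition inner_ell2 :: "'a ell2 \<Rightarrow> 'a ell2 \<Rightarrow> real" where
  "inner_ell2 x y = Re (cinner x y)"

definition norm_ell2 :: "'a ell2 \<Rightarrow> real" where
  "norm_ell2 x = sqrt (inner x x)"

definition sgn_ell2 :: "'a ell2 \<Rightarrow> 'a ell2" where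
  "sgn_ell2 x = x /\<^sub>R norm x"

definition dist_ell2 :: "'a ell2 \<Rightarrow> 'a ell2 \<Rightarrow> real" where
  "dist_ell2 x y = norm (x - y)"

definition uniformity_ell2 :: "('a ell2 \<times> 'a ell2) filter" where
  "uniformity_ell2 = (INF e\<in>{0<..}. principal {(x, y). dist x y < e})"

definition open_ell2 :: "'a ell2 set \<Rightarrow> bool" where
  "open_ell2 U \<longleftrightarrow> (\<forall>x\<in>U. \<forall>\<^sub>F (x', y) in uniformity. x' = x \<longrightarrow> y \<in> U)"

instance
proof
  fix x y z :: "'a ell2" and r s :: real
  show "sgn x = x /\<^sub>R norm x" by (simp add: sgn_ell2_def)
  show "dist x y = norm (x - y)" by (simp add: dist_ell2_def)
  show "uniformity = (INF e\<in>{0<..}. principal {(x :: 'a ell2, y). dist x y < e})"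
    by (simp add: uniformity_ell2_def)
  show "open U = (\<forall>x\<in>U. \<forall>\<^sub>F (x', y) in uniformity. x' = x \<longrightarrow> y \<in> U)" for U :: "'a ell2 set"
    by (simp add: open_ell2_def)
  show "inner x y = inner y x"
    by (simp add: inner_ell2_def cinner_commute[of x y])
  show "inner (x + y) z = inner x z + inner y z"
    by (simp add: inner_ell2_def cinner_add_left)
  have "cinner (r *\<^sub>R x) y = of_real r * cinner x y"
    unfolding cinner_def scaleR_ell2.rep_eq complex_cnj_scaleR mult_scaleR_left
    by (simp add: scaleR_conv_of_real mult.assoc infsum_cmult_right ell2_summable_cinner)
  then show "inner (r *\<^sub>R x) y = r * inner x y" by (simp add: inner_ell2_def)
  note eq = cinner_self_infsum[of x, folded inner_ell2_def]
  show "0 \<le> inner x x" unfolding eq by (rule infsum_nonneg) simp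
  have zero: "inner 0 (0 :: 'a ell2) = 0"
    by (simp add: inner_ell2_def cinner_def zero_ell2.rep_eq)
  show "inner x x = 0 \<longleftrightarrow> x = 0"
  proof
    assume "inner x x = 0"
    then have "(cmod (ell2_nth x i))\<^sup>2 = 0" for i
      using nonneg_infsum_le_0D[of "\<lambda>i. (cmod (ell2_nth x i))\<^sup>2" UNIV i] ell2_summable[of x]
      unfolding eq by simp
    then show "x = 0" by (simp add: ell2_nth_inject[symmetric] zero_ell2.rep_eq fun_eq_iff)
  qed (simp only: zero)
  show "norm x = sqrt (inner x x)" by (simp add: norm_ell2_def)
qed

end

lift_definition scaleC_ell2 :: "complex \<Rightarrow> 'a ell2 \<Rightarrow> 'a ell2" (infixr \<open>*\<^sub>C\<close> 75)
  is "\<lambda>c x i. c * x i"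
  using ell2_summable_scale by auto

lemma norm_ell2_square: "(norm x)\<^sup>2 = (\<Sum>\<^sub>\<infinity>i. (cmod (ell2_nth x i))\<^sup>2)"
  by (simp add: power2_norm_eq_inner inner_ell2_def cinner_self_infsum)

lemma sum_le_norm_ell2: "finite F \<Longrightarrow> (\<Sum>i\<in>F. (cmod (ell2_nth x i))\<^sup>2) \<le> (norm x)\<^sup>2"
  unfolding norm_ell2_square by (rule finite_sum_le_infsum[OF ell2_summable]) auto

lemma norm_nth_ell2_le: "cmod (ell2_nth x i) \<le> norm x"
  by (rule power2_le_imp_le) (use sum_le_norm_ell2[of "{i}" x] in auto)

lemma norm_ell2_leI:
  assumes "0 \<le> r" "\<And>F. finite F \<Longrightarrow> (\<Sum>i\<in>F. (cmod (ell2_nth x i))\<^sup>2) \<le> r\<^sup>2"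
  shows "norm x \<le> r"
proof (rule power2_le_imp_le)
  show "(norm x)\<^sup>2 \<le> r\<^sup>2"
    unfolding norm_ell2_square
    by (rule infsum_le_finite_sums[OF ell2_summable]) (use assms in auto)
qed (rule assms)

lemma ell2_eqI: "(\<And>i. ell2_nth x i = ell2_nth y i) \<Longrightarrow> x = y"
  by (simp add: ell2_nth_inject[symmetric] fun_eq_iff)

lemma summable_ell2I:
  assumes "\<And>F. finite F \<Longrightarrow> (\<Sum>i\<in>F. (cmod (f i))\<^sup>2) \<le> r"
  shows "(\<lambda>i. (cmod (f i))\<^sup>2) summable_on UNIV"
  by (rule nonneg_bounded_partial_sums_imp_summable_on[where C = r])
     (use assms in \<open>auto intro: eventually_finite_subsets_at_top_weakI\<close>)

instance ell2 :: (type) banach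
proof
  fix X :: "nat \<Rightarrow> 'a ell2"
  assume X: "Cauchy X"
  have "Cauchy (\<lambda>n. ell2_nth (X n) i)" for i
    unfolding Cauchy_def
  proof safe
    fix e :: real assume "e > 0"
    with X obtain M where M: "\<And>m n. m \<ge> M \<Longrightarrow> n \<ge> M \<Longrightarrow> dist (X m) (X n) < e"
      unfolding Cauchy_def by blast
    show "\<exists>M. \<forall>m\<ge>M. \<forall>n\<ge>M. dist (ell2_nth (X m) i) (ell2_nth (X n) i) < e"
    proof (intro exI allI impI)
      fix m n assume "m \<ge> M" "n \<ge> M"
      then show "dist (ell2_nth (X m) i) (ell2_nth (X n) i) < e"
        using M[of m n] norm_nth_ell2_le[of "X m - X n" i]
        by (simp add: dist_norm minus_ell2.rep_eq)
    qed
  qed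
  then have "\<exists>l. (\<lambda>n. ell2_nth (X n) i) \<longlonglongrightarrow> l" for i
    using Cauchy_convergent unfolding convergent_def by blast
  then have "\<forall>i. \<exists>l. (\<lambda>n. ell2_nth (X n) i) \<longlonglongrightarrow> l"
    by (rule allI)
  from choice[OF this] obtain l where "\<forall>i. (\<lambda>n. ell2_nth (X n) i) \<longlonglongrightarrow> l i" ..
  then have l: "(\<lambda>n. ell2_nth (X n) i) \<longlonglongrightarrow> l i" for i
    by (rule spec)
  have bound: "(\<Sum>i\<in>F. (cmod (ell2_nth (X n) i - l i))\<^sup>2) \<le> e\<^sup>2"
    if "finite F" "\<And>m. m \<ge> M \<Longrightarrow> norm (X n - X m) \<le> e" for F n e M
  proof (rule tendsto_upperbound)
    show "(\<lambda>m. \<Sum>i\<in>F. (cmod (ell2_nth (X n) i - ell2_nth (X m) i))\<^sup>2)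
      \<longlonglongrightarrow> (\<Sum>i\<in>F. (cmod (ell2_nth (X n) i - l i))\<^sup>2)"
      by (intro tendsto_intros l)
    show "\<forall>\<^sub>F m in sequentially. (\<Sum>i\<in>F. (cmod (ell2_nth (X n) i - ell2_nth (X m) i))\<^sup>2) \<le> e\<^sup>2"
    proof (rule eventually_sequentiallyI)
      fix m assume m: "m \<ge> M"
      have "(\<Sum>i\<in>F. (cmod (ell2_nth (X n - X m) i))\<^sup>2) \<le> (norm (X n - X m))\<^sup>2"
        by (rule sum_le_norm_ell2) fact
      also have "\<dots> \<le> e\<^sup>2"
        by (intro power_mono that m) auto
      finally show "(\<Sum>i\<in>F. (cmod (ell2_nth (X n) i - ell2_nth (X m) i))\<^sup>2) \<le> e\<^sup>2"
        by (simp add: minus_ell2.rep_eq)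
    qed
  qed auto
  have Cauchy_norm: "\<exists>M. \<forall>m\<ge>M. \<forall>n\<ge>M. norm (X n - X m) \<le> e" if "e > 0" for e
  proof -
    from X that obtain M where "\<And>m n. m \<ge> M \<Longrightarrow> n \<ge> M \<Longrightarrow> norm (X m - X n) < e"
      unfolding Cauchy_def dist_norm by blast
    then have "\<forall>m\<ge>M. \<forall>n\<ge>M. norm (X n - X m) \<le> e"
      by (simp add: less_imp_le)
    then show ?thesis ..
  qed
  obtain M where "\<forall>m\<ge>M. \<forall>n\<ge>M. norm (X n - X m) \<le> 1"
    using Cauchy_norm[of 1] by auto
  then have M: "norm (X M - X m) \<le> 1" if "m \<ge> M" for m
    using that by blast
  have "(\<lambda>i. (cmod (ell2_nth (X M) i - l i))\<^sup>2) summable_on UNIV"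
    by (rule summable_ell2I, rule bound[OF _ M])
  then have "(\<lambda>i. (cmod (l i - ell2_nth (X M) i))\<^sup>2) summable_on UNIV"
    by (simp only: norm_minus_commute)
  from ell2_summable_add[OF this ell2_summable[of "X M"]]
  have "(\<lambda>i. (cmod (l i))\<^sup>2) summable_on UNIV"
    by simp
  then have nth: "ell2_nth (Abs_ell2 l) = l"
    by (simp add: Abs_ell2_inverse)
  have "X \<longlonglongrightarrow> Abs_ell2 l"
    unfolding LIMSEQ_iff
  proof safe
    fix e :: real assume e: "e > 0"
    obtain M where M: "\<forall>m\<ge>M. \<forall>n\<ge>M. norm (X n - X m) \<le> e / 2"
      using Cauchy_norm[of "e / 2"] e by auto
    have *: "norm (X n - Abs_ell2 l) \<le> e / 2" if "n \<ge> M" for n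
    proof (rule norm_ell2_leI)
      fix F :: "'a set" assume F: "finite F"
      have "norm (X n - X m) \<le> e / 2" if "m \<ge> M" for m
        using M that \<open>n \<ge> M\<close> by blast
      from bound[OF F this]
      show "(\<Sum>i\<in>F. (cmod (ell2_nth (X n - Abs_ell2 l) i))\<^sup>2) \<le> (e / 2)\<^sup>2"
        unfolding minus_ell2.rep_eq nth .
    qed (use e in simp)
    have "norm (X n - Abs_ell2 l) < e" if "n \<ge> M" for n
      using *[OF that] e by linarith
    then show "\<exists>M. \<forall>n\<ge>M. norm (X n - Abs_ell2 l) < e"
      by (intro exI[of _ M]) simp
  qed
  then show "convergent X"
    by (auto simp: convergent_def)
qed

lift_definition tensor_ell2 :: "'a ell2 \<Rightarrow> 'b ell2 \<Rightarrow> ('a \<times> 'b) ell2" (infixr \<open>\<otimes>\<^sub>h\<close> 70)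
  is "\<lambda>x y (i, j). x i * y j"
proof goal_cases
  case xy: (1 x y)
  have "(\<lambda>p. (cmod (x (fst p)))\<^sup>2 * (cmod (y (snd p)))\<^sup>2) summable_on (UNIV \<times> UNIV)"
  proof (rule summable_on_SigmaI)
    show "((\<lambda>j. (cmod (x (fst (i, j))))\<^sup>2 * (cmod (y (snd (i, j))))\<^sup>2) has_sum
        (cmod (x i))\<^sup>2 * (\<Sum>\<^sub>\<infinity>j. (cmod (y j))\<^sup>2)) UNIV" for i
      using xy by (auto intro!: has_sum_cmult_right has_sum_infsum)
    show "(\<lambda>i. (cmod (x i))\<^sup>2 * (\<Sum>\<^sub>\<infinity>j. (cmod (y j))\<^sup>2)) summable_on UNIV"
      using xy by (auto intro!: summable_on_cmult_left)
  qed auto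
  then show ?case
    by (simp add: case_prod_unfold norm_mult power_mult_distrib)
qed

lemma norm_scaleC_ell2: "norm (c *\<^sub>C x) = cmod c * norm x"
proof (rule power2_eq_imp_eq)
  show "(norm (c *\<^sub>C x))\<^sup>2 = (cmod c * norm x)\<^sup>2"
    unfolding power_mult_distrib norm_ell2_square scaleC_ell2.rep_eq norm_mult
    by (simp add: infsum_cmult_right ell2_summable)
qed auto

lemma scaleC_add_right: "c *\<^sub>C (x + y) = c *\<^sub>C x + c *\<^sub>C (y :: 'a ell2)"
  by transfer (simp add: distrib_left)

lemma scaleC_scaleC: "c *\<^sub>C d *\<^sub>C x = (c * d) *\<^sub>C (x :: 'a ell2)"
  by transfer (simp add: mult.assoc)

lemma scaleC_of_real: "complex_of_real r *\<^sub>C x = r *\<^sub>R (x :: 'a ell2)"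
  by transfer (simp add: scaleR_conv_of_real)

lemma scaleC_scaleR: "c *\<^sub>C r *\<^sub>R x = r *\<^sub>R c *\<^sub>C (x :: 'a ell2)"
  by transfer simp

lemma bounded_linear_scaleC: "bounded_linear (\<lambda>x :: 'a ell2. c *\<^sub>C x)"
  by (rule bounded_linear_intro[where K = "cmod c"])
     (auto simp: scaleC_add_right scaleC_scaleR norm_scaleC_ell2 mult.commute)

lemma cinner_scaleC_left: "cinner (c *\<^sub>C x) y = cnj c * cinner x y"
  by (simp add: cinner_def scaleC_ell2.rep_eq infsum_cmult_right ell2_summable_cinner mult.assoc)

lemma cinner_scaleC_right: "cinner x (c *\<^sub>C y) = c * cinner x y"
  by (metis cinner_commute cinner_scaleC_left complex_cnj_cnj complex_cnj_mult)

lemma norm_cinner_le: "cmod (cinner x y) \<le> norm x * norm y"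
proof (cases "cinner x y = 0")
  case False
  define c where "c = cnj (cinner x y) / cmod (cinner x y)"
  have "cmod c = 1"
    using False by (simp add: c_def norm_divide)
  have "c * cinner x y = complex_of_real (cmod (cinner x y))"
    using False unfolding c_def
    by (simp add: mult.commute[of "cnj _"] complex_norm_square[symmetric] power2_eq_square)
  then have "cmod (cinner x y) = Re (c * cinner x y)"
    by simp
  also have "\<dots> = inner x (c *\<^sub>C y)"
    by (simp add: inner_ell2_def cinner_scaleC_right)
  also have "\<dots> \<le> norm x * norm (c *\<^sub>C y)"
    by (rule norm_cauchy_schwarz)
  finally show ?thesis
    using \<open>cmod c = 1\<close> by (simp add: norm_scaleC_ell2)
qed simp

lemma bounded_linear_cinner_right: "bounded_linear (\<lambda>y. cinner x y)"
proof (rule bounded_linear_intro[where K = "norm x"])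
  show "cinner x (r *\<^sub>R y) = r *\<^sub>R cinner x y" for r y
    using cinner_scaleC_right[of x "of_real r" y] by (simp add: scaleC_of_real scaleR_conv_of_real)
qed (use norm_cinner_le[of x] in \<open>auto simp: cinner_add_right mult.commute\<close>)

lift_definition ket :: "'a \<Rightarrow> 'a ell2" is "\<lambda>k i. if i = k then 1 else 0"
proof goal_cases
  case (1 k)
  have "(\<lambda>i. (cmod (if i = k then 1 else 0))\<^sup>2) summable_on UNIV \<longleftrightarrow>
      (\<lambda>i. (cmod (if i = k then 1 else 0))\<^sup>2) summable_on {k}"
    by (rule summable_on_cong_neutral) auto
  then show ?case
    by simp
qed

lemma cinner_ket_left: "cinner (ket k) x = ell2_nth x k"
proof -
  have "cinner (ket k) x = (\<Sum>\<^sub>\<infinity>i\<in>{k}. cnj (ell2_nth (ket k) i) * ell2_nth x i)"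
    unfolding cinner_def by (rule infsum_cong_neutral) (auto simp: ket.rep_eq)
  then show ?thesis by (simp add: ket.rep_eq)
qed

lemma nth_sum_ell2: "ell2_nth (sum f F) i = (\<Sum>k\<in>F. ell2_nth (f k) i)"
  by (induction F rule: infinite_finite_induct) (auto simp: zero_ell2.rep_eq plus_ell2.rep_eq)

lemma nth_sum_ket:
  "finite F \<Longrightarrow> ell2_nth (\<Sum>k\<in>F. c k *\<^sub>C ket k) i = (if i \<in> F then c i else 0)"
  by (simp add: nth_sum_ell2 scaleC_ell2.rep_eq ket.rep_eq if_distrib cong: if_cong)

lemma norm_sum_ket: "finite F \<Longrightarrow> (norm (\<Sum>k\<in>F. c k *\<^sub>C ket k))\<^sup>2 = (\<Sum>k\<in>F. (cmod (c k))\<^sup>2)"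
proof -
  assume F: "finite F"
  have "(norm (\<Sum>k\<in>F. c k *\<^sub>C ket k))\<^sup>2 = (\<Sum>\<^sub>\<infinity>k\<in>F. (cmod (c k))\<^sup>2)"
    unfolding norm_ell2_square nth_sum_ket[OF F]
    by (rule infsum_cong_neutral) auto
  with F show ?thesis by simp
qed

lemma ell2_has_sum: "((\<lambda>k. ell2_nth x k *\<^sub>C ket k) has_sum x) UNIV"
proof -
  have diff: "(norm (x - (\<Sum>k\<in>F. ell2_nth x k *\<^sub>C ket k)))\<^sup>2 = (norm x)\<^sup>2 - (\<Sum>k\<in>F. (cmod (ell2_nth x k))\<^sup>2)"
    if F: "finite F" for F
  proof -
    let ?y = "\<Sum>k\<in>F. ell2_nth x k *\<^sub>C ket k"
    have "inner (x - ?y) ?y = 0"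
    proof -
      have "cinner (x - ?y) ?y = 0"
        unfolding cinner_def by (rule infsum_0) (simp add: minus_ell2.rep_eq nth_sum_ket[OF F])
      then show ?thesis by (simp add: inner_ell2_def)
    qed
    then have "(norm x)\<^sup>2 = (norm (x - ?y))\<^sup>2 + (norm ?y)\<^sup>2"
      using norm_add_Pythagorean[of "x - ?y" ?y] by (simp add: orthogonal_def)
    then show ?thesis
      by (simp add: norm_sum_ket[OF F])
  qed
  have "((\<lambda>k. (cmod (ell2_nth x k))\<^sup>2) has_sum (norm x)\<^sup>2) UNIV"
    unfolding norm_ell2_square by (rule has_sum_infsum[OF ell2_summable])
  then have "((\<lambda>F. (norm x)\<^sup>2 - (\<Sum>k\<in>F. (cmod (ell2_nth x k))\<^sup>2)) \<longlongrightarrow> (norm x)\<^sup>2 - (norm x)\<^sup>2)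
      (finite_subsets_at_top UNIV)"
    unfolding has_sum_def by (intro tendsto_intros)
  then have "((\<lambda>F. sqrt ((norm x)\<^sup>2 - (\<Sum>k\<in>F. (cmod (ell2_nth x k))\<^sup>2))) \<longlongrightarrow> sqrt 0)
      (finite_subsets_at_top UNIV)"
    by (intro tendsto_real_sqrt) simp
  then have "((\<lambda>F. norm (x - (\<Sum>k\<in>F. ell2_nth x k *\<^sub>C ket k))) \<longlongrightarrow> 0) (finite_subsets_at_top UNIV)"
    unfolding real_sqrt_zero
    by (rule Lim_transform_eventually)
       (auto intro!: eventually_finite_subsets_at_top_weakI simp: diff[symmetric])
  then show ?thesis
    unfolding has_sum_def tendsto_iff dist_norm
    by (simp add: norm_minus_commute)
qed

lemma bounded_linear_eq_ket:
  assumes "bounded_linear f" "bounded_linear g" "\<And>c k. f (c *\<^sub>C ket k) = g (c *\<^sub>C ket k)"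
  shows "f x = g x"
proof -
  have "((\<lambda>k. f (ell2_nth x k *\<^sub>C ket k)) has_sum f x) UNIV"
    "((\<lambda>k. g (ell2_nth x k *\<^sub>C ket k)) has_sum g x) UNIV"
    using has_sum_bounded_linear[OF assms(1) ell2_has_sum] has_sum_bounded_linear[OF assms(2) ell2_has_sum]
    by (auto simp: o_def)
  then show ?thesis
    unfolding assms(3) by (rule has_sum_unique)
qed


section \<open>Bounded operators\<close>

type_synonym 'a op = "'a ell2 \<Rightarrow>\<^sub>L 'a ell2"

text \<open>Library operators of type \<^typ>\<open>'a op\<close> are only real-linear; \<open>bounded_ops\<close> is \<open>B(H)\<close>.\<close>

definition bounded_ops :: "'a op set" where
  "bounded_ops = {T :: 'a op. \<forall>c x. T (c *\<^sub>C x) = c *\<^sub>C T x}"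

definition scaleC_op :: "complex \<Rightarrow> 'a op \<Rightarrow> 'a op" where
  "scaleC_op c T = Blinfun (\<lambda>x. c *\<^sub>C T x)"

lemma scaleC_op_apply: "scaleC_op c T x = c *\<^sub>C T x"
  unfolding scaleC_op_def
  by (subst bounded_linear_Blinfun_apply)
     (auto intro: bounded_linear_compose[OF bounded_linear_scaleC blinfun.bounded_linear_right])

definition adj :: "'a op \<Rightarrow> 'a op" where
  "adj T = (THE S :: 'a op. \<forall>x y. cinner (S x) y = cinner x (T y))"

lemma cinner_left_eqI: "(\<And>y. cinner x y = cinner x' y) \<Longrightarrow> x = x'"
  by (rule ell2_eqI) (metis cinner_commute cinner_ket_left)

lemma cinner_adj:
  assumes "T \<in> bounded_ops"
  shows "cinner (adj T x) y = cinner x (T y)"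
proof -
  have T: "T (c *\<^sub>C z) = c *\<^sub>C T z" for c z
    using assms by (simp add: bounded_ops_def)
  define s where "s z i = cinner (T (ket i)) z" for z i
  have s_bound: "(\<Sum>i\<in>F. (cmod (s z i))\<^sup>2) \<le> (norm T * norm z)\<^sup>2" if F: "finite F" for F z
  proof -
    define S where "S = (\<Sum>i\<in>F. (cmod (s z i))\<^sup>2)"
    define v where "v = (\<Sum>i\<in>F. s z i *\<^sub>C ket i)"
    have S0: "S \<ge> 0" by (simp add: S_def sum_nonneg)
    have v: "(norm v)\<^sup>2 = S" unfolding v_def S_def by (rule norm_sum_ket[OF F])
    have "cinner (T v) z = (\<Sum>i\<in>F. cnj (s z i) * s z i)"
    proof -
      have add: "cinner (\<Sum>i\<in>F. h i) z = (\<Sum>i\<in>F. cinner (h i) z)" for h :: "'a \<Rightarrow> 'a ell2"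
        using F by (induction F)
          (simp_all add: cinner_add_left, simp add: cinner_def zero_ell2.rep_eq)
      show ?thesis
        unfolding v_def blinfun.sum_right T add cinner_scaleC_left by (simp add: s_def)
    qed
    also have "\<dots> = of_real S"
      by (simp add: S_def complex_norm_square mult.commute del: of_real_power)
    finally have "S = cmod (cinner (T v) z)"
      using S0 by simp
    also have "\<dots> \<le> norm (T v) * norm z" by (rule norm_cinner_le)
    also have "\<dots> \<le> (norm T * norm v) * norm z"
      by (intro mult_right_mono norm_blinfun) auto
    finally have "(norm v)\<^sup>2 \<le> (norm T * norm z) * norm v"
      by (simp add: v mult.commute mult.left_commute)
    then have "norm v \<le> norm T * norm z"
      by (cases "norm v = 0")
         (simp, auto simp add: power2_eq_square mult_le_cancel_right)
    then show ?thesis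
      unfolding S_def[symmetric] v[symmetric] by (intro power_mono) auto
  qed
  have s_in: "(\<lambda>i. (cmod (s z i))\<^sup>2) summable_on UNIV" for z
    by (rule summable_ell2I[OF s_bound])
  then have nth: "ell2_nth (Abs_ell2 (s z)) i = s z i" for z i
    by (simp add: Abs_ell2_inverse)
  have "bounded_linear (\<lambda>z. Abs_ell2 (s z))"
  proof (rule bounded_linear_intro[where K = "norm T"])
    show "Abs_ell2 (s (z + w)) = Abs_ell2 (s z) + Abs_ell2 (s w)" for z w
      by (rule ell2_eqI) (simp add: nth plus_ell2.rep_eq s_def cinner_add_right)
    show "Abs_ell2 (s (r *\<^sub>R z)) = r *\<^sub>R Abs_ell2 (s z)" for r z
      by (rule ell2_eqI)
         (simp add: nth scaleR_ell2.rep_eq s_def linear_simps(5)[OF bounded_linear_cinner_right])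
    show "norm (Abs_ell2 (s z)) \<le> norm z * norm T" for z
      by (rule norm_ell2_leI) (auto simp: nth mult.commute[of "norm z"] intro: s_bound)
  qed
  then have app: "Blinfun (\<lambda>z. Abs_ell2 (s z)) z = Abs_ell2 (s z)" for z
    by (simp add: bounded_linear_Blinfun_apply)
  have ex: "cinner (Abs_ell2 (s z)) w = cinner z (T w)" for z w
  proof (rule bounded_linear_eq_ket[of _ _ w])
    show "bounded_linear (cinner (Abs_ell2 (s z)))" by (rule bounded_linear_cinner_right)
    show "bounded_linear (\<lambda>w. cinner z (T w))"
      using bounded_linear_compose[OF bounded_linear_cinner_right blinfun.bounded_linear_right[of T]]
      by (simp add: o_def)
    show "cinner (Abs_ell2 (s z)) (c *\<^sub>C ket k) = cinner z (T (c *\<^sub>C ket k))" for c k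
      using cinner_ket_left[of k "Abs_ell2 (s z)"] cinner_commute[of "ket k"] cinner_commute[of z]
      by (simp add: T cinner_scaleC_right nth s_def) (metis complex_cnj_cnj)
  qed
  have "\<forall>x y. cinner (adj T x) y = cinner x (T y)"
    unfolding adj_def
  proof (rule theI2)
    show "\<forall>x y. cinner (Blinfun (\<lambda>z. Abs_ell2 (s z)) x) y = cinner x (T y)"
      by (simp add: app ex)
    show "S = Blinfun (\<lambda>z. Abs_ell2 (s z))" if "\<forall>x y. cinner (S x) y = cinner x (T y)" for S :: "'a op"
      by (rule blinfun_eqI, rule cinner_left_eqI) (simp add: app ex that)
  qed
  then show ?thesis by blast
qed

text \<open>The unique bounded operator with \<open>(S \<otimes> T)(x \<otimes> y) = S x \<otimes> T y\<close>, see lemma \<open>tensor_op\<close> below.\<close>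

definition tensor_op :: "'a op \<Rightarrow> 'b op \<Rightarrow> ('a \<times> 'b) op" (infixr \<open>\<otimes>\<^sub>o\<close> 70) where
  "S \<otimes>\<^sub>o T = (THE R :: ('a \<times> 'b) op. R \<in> bounded_ops \<and> (\<forall>x y. R (x \<otimes>\<^sub>h y) = S x \<otimes>\<^sub>h T y))"

lemma fibrewise_op_exists:
  fixes T :: "'a op" and g :: "'p \<Rightarrow> 'a \<times> 'b" and h :: "'a \<times> 'b \<Rightarrow> 'p"
  assumes T: "T \<in> bounded_ops" and gh: "\<And>q. g (h q) = q" and hg: "\<And>p. h (g p) = p"
  obtains A :: "'p op" where "A \<in> bounded_ops"
    "\<And>\<zeta> p v. (\<And>i. ell2_nth v i = ell2_nth \<zeta> (h (i, snd (g p)))) \<Longrightarrow> ell2_nth (A \<zeta>) p = ell2_nth (T v) (fst (g p))"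
proof -
  have T': "T (c *\<^sub>C z) = c *\<^sub>C T z" for c z
    using T by (simp add: bounded_ops_def)
  have inj_h: "inj h" by (metis gh injI)
  have inj_g: "inj g" by (metis hg injI)
  define fib where "fib \<zeta> j = Abs_ell2 (\<lambda>i. ell2_nth \<zeta> (h (i, j)))" for \<zeta> :: "'p ell2" and j
  have le: "(\<Sum>j\<in>J. \<Sum>i\<in>I. (cmod (ell2_nth \<zeta> (h (i, j))))\<^sup>2) \<le> (norm \<zeta>)\<^sup>2"
    if IJ: "finite I" "finite J" for \<zeta> I J
  proof -
    have "(\<Sum>j\<in>J. \<Sum>i\<in>I. (cmod (ell2_nth \<zeta> (h (i, j))))\<^sup>2) = (\<Sum>q\<in>I \<times> J. (cmod (ell2_nth \<zeta> (h q)))\<^sup>2)"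
      by (subst sum.swap) (simp add: sum.cartesian_product)
    also have "\<dots> = (\<Sum>p\<in>h ` (I \<times> J). (cmod (ell2_nth \<zeta> p))\<^sup>2)"
      by (subst sum.reindex) (auto intro: inj_on_subset[OF inj_h])
    also have "\<dots> \<le> (norm \<zeta>)\<^sup>2"
      by (rule sum_le_norm_ell2) (use IJ in auto)
    finally show ?thesis .
  qed
  have "(\<lambda>i. (cmod (ell2_nth \<zeta> (h (i, j))))\<^sup>2) summable_on UNIV" for \<zeta> j
    by (rule summable_ell2I[where r = "(norm \<zeta>)\<^sup>2"]) (use le[of _ "{j}" \<zeta>] in auto)
  then have nth_fib: "ell2_nth (fib \<zeta> j) i = ell2_nth \<zeta> (h (i, j))" for \<zeta> j i
    by (simp add: fib_def Abs_ell2_inverse)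
  have fib_le: "(\<Sum>j\<in>J. (norm (fib \<zeta> j))\<^sup>2) \<le> (norm \<zeta>)\<^sup>2" if J: "finite J" for \<zeta> J
  proof -
    have "((\<lambda>i. \<Sum>j\<in>J. (cmod (ell2_nth (fib \<zeta> j) i))\<^sup>2) has_sum (\<Sum>j\<in>J. (norm (fib \<zeta> j))\<^sup>2)) UNIV"
      using J
    proof (induction J)
      case (insert j J)
      then show ?case
        using has_sum_add[OF has_sum_infsum[OF ell2_summable[of "fib \<zeta> j"]] insert.IH]
        by (simp add: norm_ell2_square)
    qed simp
    then show ?thesis
    proof (rule has_sum_le_finite_sums)
      fix I :: "'a set" assume "finite I"
      then show "(\<Sum>i\<in>I. \<Sum>j\<in>J. (cmod (ell2_nth (fib \<zeta> j) i))\<^sup>2) \<le> (norm \<zeta>)\<^sup>2"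
        using le[of I J \<zeta>] J by (subst sum.swap) (simp add: nth_fib)
    qed
  qed
  define a where "a \<zeta> p = ell2_nth (T (fib \<zeta> (snd (g p)))) (fst (g p))" for \<zeta> p
  have a_le: "(\<Sum>p\<in>F. (cmod (a \<zeta> p))\<^sup>2) \<le> (norm T * norm \<zeta>)\<^sup>2" if F: "finite F" for F \<zeta>
  proof -
    let ?I = "fst ` g ` F" and ?J = "snd ` g ` F"
    let ?b = "\<lambda>q. (cmod (ell2_nth (T (fib \<zeta> (snd q))) (fst q)))\<^sup>2"
    have "(\<Sum>p\<in>F. (cmod (a \<zeta> p))\<^sup>2) = (\<Sum>q\<in>g ` F. ?b q)"
      unfolding a_def by (subst sum.reindex) (auto intro: inj_on_subset[OF inj_g])
    also have "\<dots> \<le> (\<Sum>q\<in>?I \<times> ?J. ?b q)"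
    proof (rule sum_mono2)
      show "finite (?I \<times> ?J)" using F by simp
      show "g ` F \<subseteq> ?I \<times> ?J"
        by (rule subsetI) (simp only: mem_Times_iff, blast)
    qed simp
    also have "\<dots> = (\<Sum>j\<in>?J. \<Sum>i\<in>?I. (cmod (ell2_nth (T (fib \<zeta> j)) i))\<^sup>2)"
      by (subst sum.swap) (simp add: sum.cartesian_product case_prod_unfold)
    also have "\<dots> \<le> (\<Sum>j\<in>?J. (norm (T (fib \<zeta> j)))\<^sup>2)"
      by (intro sum_mono sum_le_norm_ell2) (use F in auto)
    also have "\<dots> \<le> (\<Sum>j\<in>?J. (norm T)\<^sup>2 * (norm (fib \<zeta> j))\<^sup>2)"
      unfolding power_mult_distrib[symmetric] by (intro sum_mono power_mono norm_blinfun) auto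
    also have "\<dots> = (norm T)\<^sup>2 * (\<Sum>j\<in>?J. (norm (fib \<zeta> j))\<^sup>2)"
      by (simp add: sum_distrib_left)
    also have "\<dots> \<le> (norm T)\<^sup>2 * (norm \<zeta>)\<^sup>2"
      by (intro mult_left_mono fib_le) (use F in auto)
    finally show ?thesis by (simp add: power_mult_distrib)
  qed
  have "(\<lambda>p. (cmod (a \<zeta> p))\<^sup>2) summable_on UNIV" for \<zeta>
    by (rule summable_ell2I[OF a_le])
  then have nth: "ell2_nth (Abs_ell2 (a \<zeta>)) p = a \<zeta> p" for \<zeta> p
    by (simp add: Abs_ell2_inverse)
  have fib_add: "fib (\<zeta> + \<xi>) j = fib \<zeta> j + fib \<xi> j" for \<zeta> \<xi> j
    by (rule ell2_eqI) (simp add: nth_fib plus_ell2.rep_eq)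
  have fib_scaleR: "fib (r *\<^sub>R \<zeta>) j = r *\<^sub>R fib \<zeta> j" for r \<zeta> j
    by (rule ell2_eqI) (simp add: nth_fib scaleR_ell2.rep_eq)
  have fib_scaleC: "fib (c *\<^sub>C \<zeta>) j = c *\<^sub>C fib \<zeta> j" for c \<zeta> j
    by (rule ell2_eqI) (simp add: nth_fib scaleC_ell2.rep_eq)
  have "bounded_linear (\<lambda>\<zeta>. Abs_ell2 (a \<zeta>))"
  proof (rule bounded_linear_intro[where K = "norm T"])
    show "Abs_ell2 (a (\<zeta> + \<xi>)) = Abs_ell2 (a \<zeta>) + Abs_ell2 (a \<xi>)" for \<zeta> \<xi>
      by (rule ell2_eqI) (simp add: nth plus_ell2.rep_eq a_def fib_add blinfun.add_right)
    show "Abs_ell2 (a (r *\<^sub>R \<zeta>)) = r *\<^sub>R Abs_ell2 (a \<zeta>)" for r \<zeta>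
      by (rule ell2_eqI) (simp add: nth scaleR_ell2.rep_eq a_def fib_scaleR blinfun.scaleR_right)
    show "norm (Abs_ell2 (a \<zeta>)) \<le> norm \<zeta> * norm T" for \<zeta>
      by (rule norm_ell2_leI) (auto simp: nth mult.commute[of "norm \<zeta>"] intro: a_le)
  qed
  then have app: "Blinfun (\<lambda>\<zeta>. Abs_ell2 (a \<zeta>)) \<zeta> = Abs_ell2 (a \<zeta>)" for \<zeta>
    by (simp add: bounded_linear_Blinfun_apply)
  show thesis
  proof (rule that[of "Blinfun (\<lambda>\<zeta>. Abs_ell2 (a \<zeta>))"])
    have "Abs_ell2 (a (c *\<^sub>C \<zeta>)) = c *\<^sub>C Abs_ell2 (a \<zeta>)" for c \<zeta>
      by (rule ell2_eqI) (simp add: nth scaleC_ell2.rep_eq a_def fib_scaleC T')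
    then show "Blinfun (\<lambda>\<zeta>. Abs_ell2 (a \<zeta>)) \<in> bounded_ops"
      by (simp add: bounded_ops_def app)
    fix \<zeta> p v assume "\<And>i. ell2_nth v i = ell2_nth \<zeta> (h (i, snd (g p)))"
    then have "v = fib \<zeta> (snd (g p))"
      by (intro ell2_eqI) (simp add: nth_fib)
    then show "ell2_nth (Blinfun (\<lambda>\<zeta>. Abs_ell2 (a \<zeta>)) \<zeta>) p = ell2_nth (T v) (fst (g p))"
      by (simp add: app nth a_def)
  qed
qed

lemma tensor_op:
  fixes S :: "'a op" and T :: "'b op"
  assumes S: "S \<in> bounded_ops" and T: "T \<in> bounded_ops"
  shows "S \<otimes>\<^sub>o T \<in> bounded_ops" "(S \<otimes>\<^sub>o T) (x \<otimes>\<^sub>h y) = S x \<otimes>\<^sub>h T y"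
proof -
  have S': "S (c *\<^sub>C z) = c *\<^sub>C S z" and T': "T (c *\<^sub>C w) = c *\<^sub>C T w" for c z w
    using S T by (auto simp: bounded_ops_def)
  obtain A :: "('a \<times> 'b) op" where A: "A \<in> bounded_ops"
    "\<And>\<zeta> p v. (\<And>i. ell2_nth v i = ell2_nth \<zeta> (id (i, snd (id p)))) \<Longrightarrow> ell2_nth (A \<zeta>) p = ell2_nth (S v) (fst (id p))"
    by (rule fibrewise_op_exists[OF S, of id id]) auto
  obtain B :: "('a \<times> 'b) op" where B: "B \<in> bounded_ops"
    "\<And>\<zeta> p v. (\<And>i. ell2_nth v i = ell2_nth \<zeta> (prod.swap (i, snd (prod.swap p)))) \<Longrightarrow>
      ell2_nth (B \<zeta>) p = ell2_nth (T v) (fst (prod.swap p))"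
    by (rule fibrewise_op_exists[OF T, of prod.swap prod.swap]) auto
  have A': "A (x \<otimes>\<^sub>h y) = S x \<otimes>\<^sub>h y" for x y
  proof (rule ell2_eqI)
    fix p :: "'a \<times> 'b"
    have "ell2_nth (A (x \<otimes>\<^sub>h y)) p = ell2_nth (S (ell2_nth y (snd p) *\<^sub>C x)) (fst p)"
      by (subst A(2)[of "ell2_nth y (snd p) *\<^sub>C x"]) (auto simp: scaleC_ell2.rep_eq tensor_ell2.rep_eq)
    then show "ell2_nth (A (x \<otimes>\<^sub>h y)) p = ell2_nth (S x \<otimes>\<^sub>h y) p"
      by (simp add: S' scaleC_ell2.rep_eq tensor_ell2.rep_eq case_prod_unfold)
  qed
  have B': "B (x \<otimes>\<^sub>h y) = x \<otimes>\<^sub>h T y" for x y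
  proof (rule ell2_eqI)
    fix p :: "'a \<times> 'b"
    have "ell2_nth (B (x \<otimes>\<^sub>h y)) p = ell2_nth (T (ell2_nth x (fst p) *\<^sub>C y)) (snd p)"
      by (subst B(2)[of "ell2_nth x (fst p) *\<^sub>C y"]) (auto simp: scaleC_ell2.rep_eq tensor_ell2.rep_eq)
    then show "ell2_nth (B (x \<otimes>\<^sub>h y)) p = ell2_nth (x \<otimes>\<^sub>h T y) p"
      by (simp add: T' scaleC_ell2.rep_eq tensor_ell2.rep_eq case_prod_unfold)
  qed
  have ket: "ket q = ket (fst q) \<otimes>\<^sub>h ket (snd q)" for q :: "'a \<times> 'b"
    by (rule ell2_eqI) (auto simp: ket.rep_eq tensor_ell2.rep_eq)
  have AB: "A o\<^sub>L B \<in> bounded_ops \<and> (\<forall>x y. (A o\<^sub>L B) (x \<otimes>\<^sub>h y) = S x \<otimes>\<^sub>h T y)"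
    using A(1) B(1) by (simp add: bounded_ops_def A' B')
  have eq: "S \<otimes>\<^sub>o T = A o\<^sub>L B"
    unfolding tensor_op_def
  proof (rule the_equality)
    show "A o\<^sub>L B \<in> bounded_ops \<and> (\<forall>x y. (A o\<^sub>L B) (x \<otimes>\<^sub>h y) = S x \<otimes>\<^sub>h T y)"
      by (rule AB)
  next
    fix R :: "('a \<times> 'b) op"
    assume R: "R \<in> bounded_ops \<and> (\<forall>x y. R (x \<otimes>\<^sub>h y) = S x \<otimes>\<^sub>h T y)"
    show "R = A o\<^sub>L B"
    proof (rule blinfun_eqI, rule bounded_linear_eq_ket[of "blinfun_apply R" "blinfun_apply (A o\<^sub>L B)"])
      have "R (c *\<^sub>C (ket (fst q) \<otimes>\<^sub>h ket (snd q))) = (A o\<^sub>L B) (c *\<^sub>C (ket (fst q) \<otimes>\<^sub>h ket (snd q)))" for c q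
        using R AB by (simp add: bounded_ops_def del: blinfun_apply_blinfun_compose)
      then show "R (c *\<^sub>C ket q) = (A o\<^sub>L B) (c *\<^sub>C ket q)" for c q
        unfolding ket[of q] .
    qed (fact blinfun.bounded_linear_right)+
  qed
  show "S \<otimes>\<^sub>o T \<in> bounded_ops"
    unfolding eq by (rule conjunct1[OF AB])
  show "(S \<otimes>\<^sub>o T) (x \<otimes>\<^sub>h y) = S x \<otimes>\<^sub>h T y"
    unfolding eq using AB by blast
qed

definition positive_op :: "'a op \<Rightarrow> bool" where
  "positive_op T \<longleftrightarrow> T \<in> bounded_ops \<and> (\<forall>x. cinner x (T x) \<in> \<real>\<^sub>\<ge>\<^sub>0)"

definition projection_op :: "'a op \<Rightarrow> bool" where
  "projection_op T \<longleftrightarrow> T \<in> bounded_ops \<and> adj T = T \<and> T o\<^sub>L T = T"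

definition modulus_op :: "'a op \<Rightarrow> 'a op \<Rightarrow> bool" where
  "modulus_op T A \<longleftrightarrow> positive_op A \<and> A o\<^sub>L A = adj T o\<^sub>L T"

text \<open>
  The measure \<open>B \<mapsto> \<phi> (P B)\<close> on the Borel sets of the line, for a positive functional \<open>\<phi>\<close>
  and a projection-valued measure \<open>P\<close>.
\<close>

definition scalar_measure :: "('a op \<Rightarrow> complex) \<Rightarrow> (real set \<Rightarrow> 'a op) \<Rightarrow> real measure" where
  "scalar_measure \<phi> P = measure_of UNIV (sets borel) (\<lambda>B. ennreal (Re (\<phi> (P B))))"

text \<open>\<open>P\<close> is the spectral measure of the self-adjoint operator \<open>A\<close>, i.e. \<open>A = \<integral> t dP(t)\<close>.\<close>

definition spectral_measure :: "'a op \<Rightarrow> (real set \<Rightarrow> 'a op) \<Rightarrow> bool" where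
  "spectral_measure A P \<longleftrightarrow>
     (\<forall>B\<in>sets borel. projection_op (P B)) \<and>
     P UNIV = id_blinfun \<and>
     (\<forall>B\<in>sets borel. \<forall>C\<in>sets borel. P (B \<inter> C) = P B o\<^sub>L P C) \<and>
     (\<forall>B :: nat \<Rightarrow> real set. range B \<subseteq> sets borel \<longrightarrow> disjoint_family B \<longrightarrow>
        (\<forall>x. (\<lambda>n. P (B n) x) sums P (\<Union>n. B n) x)) \<and>
     (\<forall>x. integrable (scalar_measure (\<lambda>T. cinner x (T x)) P) (\<lambda>t. t) \<and>
        cinner x (A x) = of_real (\<integral>t. t \<partial>scalar_measure (\<lambda>T. cinner x (T x)) P))"

definition weak_star_functional :: "('a op \<Rightarrow> complex) \<Rightarrow> bool" where
  "weak_star_functional \<phi> \<longleftrightarrow>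
     (\<exists>x y :: nat \<Rightarrow> 'a ell2. summable (\<lambda>n. (norm (x n))\<^sup>2) \<and> summable (\<lambda>n. (norm (y n))\<^sup>2) \<and>
        \<phi> = (\<lambda>T. \<Sum>n. cinner (x n) (T (y n))))"

text \<open>
  The weak-* (ultraweak) topology of \<open>B(H)\<close>; a von Neumann algebra on \<open>H\<close> carries the
  subspace topology.
\<close>

definition weak_star :: "'a op topology" where
  "weak_star = topology_generated_by
     {{T \<in> bounded_ops. \<phi> T \<in> U} | \<phi> U. weak_star_functional \<phi> \<and> open U}"


section \<open>Von Neumann algebras\<close>

definition commutant :: "'a op set \<Rightarrow> 'a op set" where
  "commutant M = {T \<in> bounded_ops. \<forall>S\<in>M. T o\<^sub>L S = S o\<^sub>L T}"

definition von_neumann_algebra :: "'a op set \<Rightarrow> bool" where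
  "von_neumann_algebra M \<longleftrightarrow>
     M \<subseteq> bounded_ops \<and> (\<forall>T\<in>M. adj T \<in> M) \<and> commutant (commutant M) = M"

text \<open>The von Neumann algebra generated by the self-adjoint set of elementary tensors.\<close>

definition vn_tensor :: "'a op set \<Rightarrow> 'b op set \<Rightarrow> ('a \<times> 'b) op set" (infixr \<open>\<otimes>\<^sub>v\<^sub>N\<close> 70) where
  "M \<otimes>\<^sub>v\<^sub>N N = commutant (commutant {S \<otimes>\<^sub>o T | S T. S \<in> M \<and> T \<in> N})"

definition clinear_functional_on :: "'a op set \<Rightarrow> ('a op \<Rightarrow> complex) \<Rightarrow> bool" where
  "clinear_functional_on M \<phi> \<longleftrightarrow>
     (\<forall>S\<in>M. \<forall>T\<in>M. \<phi> (S + T) = \<phi> S + \<phi> T) \<and> (\<forall>c. \<forall>T\<in>M. \<phi> (scaleC_op c T) = c * \<phi> T)"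

definition clinear_map_on :: "'a op set \<Rightarrow> ('a op \<Rightarrow> 'a op) \<Rightarrow> bool" where
  "clinear_map_on M E \<longleftrightarrow>
     (\<forall>S\<in>M. \<forall>T\<in>M. E (S + T) = E S + E T) \<and> (\<forall>c. \<forall>T\<in>M. E (scaleC_op c T) = scaleC_op c (E T))"

definition normal_functional_on :: "'a op set \<Rightarrow> ('a op \<Rightarrow> complex) \<Rightarrow> bool" where
  "normal_functional_on M \<phi> \<longleftrightarrow>
     clinear_functional_on M \<phi> \<and> continuous_map (subtopology weak_star M) euclidean \<phi>"

definition normal_faithful_tracial_state :: "'a op set \<Rightarrow> ('a op \<Rightarrow> complex) \<Rightarrow> bool" where
  "normal_faithful_tracial_state M \<tau> \<longleftrightarrow>
     normal_functional_on M \<tau> \<and>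
     (\<forall>T\<in>M. positive_op T \<longrightarrow> \<tau> T \<in> \<real>\<^sub>\<ge>\<^sub>0) \<and>
     \<tau> id_blinfun = 1 \<and>
     (\<forall>S\<in>M. \<forall>T\<in>M. \<tau> (S o\<^sub>L T) = \<tau> (T o\<^sub>L S)) \<and>
     (\<forall>T\<in>M. \<tau> (adj T o\<^sub>L T) = 0 \<longrightarrow> T = 0)"

definition finite_von_neumann_algebra :: "'a op set \<Rightarrow> ('a op \<Rightarrow> complex) \<Rightarrow> bool" where
  "finite_von_neumann_algebra M \<tau> \<longleftrightarrow>
     von_neumann_algebra M \<and> normal_faithful_tracial_state M \<tau>"

definition vn_filtration :: "'a op set \<Rightarrow> (nat \<Rightarrow> 'a op set) \<Rightarrow> bool" where
  "vn_filtration M F \<longleftrightarrow>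
     (\<forall>n. von_neumann_algebra (F n) \<and> F n \<subseteq> M \<and> F n \<subseteq> F (Suc n)) \<and>
     M \<subseteq> weak_star closure_of (\<Union>n. F n)"

definition conditional_expectation ::
    "'a op set \<Rightarrow> ('a op \<Rightarrow> complex) \<Rightarrow> 'a op set \<Rightarrow> ('a op \<Rightarrow> 'a op) \<Rightarrow> bool" where
  "conditional_expectation M \<tau> A E \<longleftrightarrow>
     clinear_map_on M E \<and>
     (\<forall>T\<in>M. E T \<in> A) \<and>
     (\<forall>T\<in>A. E T = T) \<and>
     (\<forall>T\<in>M. positive_op T \<longrightarrow> positive_op (E T)) \<and>
     (\<forall>S\<in>A. \<forall>T\<in>M. \<forall>R\<in>A. E (S o\<^sub>L T o\<^sub>L R) = S o\<^sub>L E T o\<^sub>L R) \<and>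
     (\<forall>T\<in>M. \<tau> (E T) = \<tau> T)"

text \<open>
  The tensor product of normal functionals or of normal maps is the unique normal linear extension
  from elementary tensors; uniqueness holds on \<open>M \<otimes>\<^sub>v\<^sub>N N\<close> only, hence predicates.
\<close>

definition tensor_functional ::
    "'a op set \<Rightarrow> ('a op \<Rightarrow> complex) \<Rightarrow> 'b op set \<Rightarrow> ('b op \<Rightarrow> complex) \<Rightarrow> (('a \<times> 'b) op \<Rightarrow> complex) \<Rightarrow> bool" where
  "tensor_functional M \<phi> N \<psi> \<omega> \<longleftrightarrow>
     normal_functional_on (M \<otimes>\<^sub>v\<^sub>N N) \<omega> \<and>
     (\<forall>S\<in>M. \<forall>T\<in>N. \<omega> (S \<otimes>\<^sub>o T) = \<phi> S * \<psi> T)"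

definition tensor_map ::
    "'a op set \<Rightarrow> 'a op set \<Rightarrow> ('a op \<Rightarrow> 'a op) \<Rightarrow> 'b op set \<Rightarrow> 'b op set \<Rightarrow> ('b op \<Rightarrow> 'b op) \<Rightarrow>
      (('a \<times> 'b) op \<Rightarrow> ('a \<times> 'b) op) \<Rightarrow> bool" where
  "tensor_map M A E N B F G \<longleftrightarrow>
     clinear_map_on (M \<otimes>\<^sub>v\<^sub>N N) G \<and>
     (\<forall>R\<in>M \<otimes>\<^sub>v\<^sub>N N. G R \<in> A \<otimes>\<^sub>v\<^sub>N B) \<and>
     continuous_map (subtopology weak_star (M \<otimes>\<^sub>v\<^sub>N N)) weak_star G \<and>
     (\<forall>S\<in>M. \<forall>T\<in>N. G (S \<otimes>\<^sub>o T) = E S \<otimes>\<^sub>o F T)"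


section \<open>Young functions and weak type\<close>

text \<open>Functions on \<open>[0, \<infinity>)\<close> are represented on all of \<^typ>\<open>real\<close>; negative arguments are irrelevant.\<close>

definition young_function :: "(real \<Rightarrow> ennreal) \<Rightarrow> bool" where
  "young_function \<Psi> \<longleftrightarrow>
     mono_on {0..} \<Psi> \<and>
     (\<forall>s\<ge>0. \<forall>t\<ge>0. \<forall>u\<in>{0..1}.
        \<Psi> ((1 - u) * s + u * t) \<le> ennreal (1 - u) * \<Psi> s + ennreal u * \<Psi> t) \<and>
     \<Psi> 0 = 0 \<and> (\<Psi> \<longlongrightarrow> \<infinity>) at_top"

definition locally_finite :: "(real \<Rightarrow> ennreal) \<Rightarrow> bool" where
  "locally_finite \<Psi> \<longleftrightarrow> (\<forall>B\<subseteq>{0..}. bounded B \<longrightarrow> (\<forall>s\<in>B. \<Psi> s < \<infinity>))"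

definition log_plus :: "real \<Rightarrow> real" where
  "log_plus s = max (ln s) 0"

text \<open>
  The trace of \<open>\<Psi>(C|x|/r)\<close> is the integral of \<open>t \<mapsto> \<Psi>(C t/r)\<close> against the trace of the spectral
  measure \<open>P\<close> of \<open>|x|\<close>, which makes sense for \<open>[0, \<infinity>]\<close>-valued \<open>\<Psi>\<close>.
\<close>

definition strong_maximal_weak_type ::
    "'a op set \<Rightarrow> ('a op \<Rightarrow> complex) \<Rightarrow> (nat \<Rightarrow> nat \<Rightarrow> 'a op \<Rightarrow> 'a op) \<Rightarrow> (real \<Rightarrow> ennreal) \<Rightarrow> bool" where
  "strong_maximal_weak_type M \<tau> E \<Psi> \<longleftrightarrow>
     (\<exists>C\<ge>0. \<forall>x\<in>M. positive_op x \<longrightarrow> (\<forall>r>0. \<forall>a P. modulus_op x a \<longrightarrow> spectral_measure a P \<longrightarrow>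
        (\<exists>e\<in>M. projection_op e \<and>
           (\<forall>n m. norm (e o\<^sub>L E n m x o\<^sub>L e) \<le> r) \<and>
           ennreal (Re (\<tau> (id_blinfun - e))) \<le> (\<integral>\<^sup>+t. \<Psi> (C * t / r) \<partial>scalar_measure \<tau> P))))"

end

theory Submission
  imports Defs
begin

text \<open>
  The triangular truncation \<open>V\<close> of a \<open>d \<times> d\<close> orthogonal matrix \<open>W\<close> can have norm
  of order \<open>log d\<close>. With the filtration of the \<open>d \<times> d\<close> matrices by upper left corners (and the diagonal),
  the columns \<open>v\<^sub>n\<close> of \<open>W\<close> satisfy \<open>\<Sum>\<^sub>n v\<^sub>n v\<^sub>n\<^sup>* = 1\<close>, whereas \<open>\<Sum>\<^sub>n E\<^sub>n (v\<^sub>n v\<^sub>n\<^sup>*) \<ge> V V\<^sup>*\<close> has norm of order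
  \<open>(log d)\<^sup>2\<close>; for two parameters this gives \<open>(log d)\<^sup>4\<close> by taking tensor products. On the other hand, the
  weak type inequality for \<open>x = d\<^sup>2 p\<close>, \<open>p\<close> a minimal projection, at the levels \<open>2\<^sup>j\<close> provides projections
  which can be summed over \<open>O(log d)\<close> dyadic levels. Noncommutativity costs one factor \<open>log d\<close> (Cauchy-Schwarz
  over the levels), the sum itself another one, so \<open>\<Psi> \<in> o(s (1 + log\<^sub>+ s)\<^sup>2)\<close> would bound the same
  quantity by \<open>o((log d)\<^sup>4)\<close>. A direct sum of matrix blocks of all sizes \<open>d\<close>, with a block-wise
  constant weight that cancels in the inequality, makes the constant \<open>C\<close> independent of \<open>d\<close>.
\<close>

section \<open>Operators and their matrix coefficients\<close>

text \<open>The operator norm of the truncation never appears: what is estimated from both sides is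
  a sum of squared pairings. Let u_t be the indicator of the corner with sides t = (n, m), and v_t
  the column t of the tensor square of W. Then <u_t, v_t> is a product of two truncated column sums,
  and the sum over t of |<u_t, v_t>|^2 is at least a constant times d^2 (log d)^4. For the upper
  bound, p is the projection onto the constants, so x is the all-ones matrix and E_t(x) dominates
  u_t u_t^*; a bound l on the norm of e E_t(x) e therefore gives |e u_t|^2 <= l. In the upper bound
  the v_t enter only through Bessel's inequality, which leaves traces of 1 - e_j. If Psi(s) <= eps s
  (log s)^2 for large s, each level contributes about eps d^2 (log d)^2. Matrices of one fixed size
  would give no contradiction, since C may depend on the pair of algebras; hence one pair has to
  contain all sizes.\<close>

definition coef :: "'p op \<Rightarrow> 'p \<Rightarrow> 'p \<Rightarrow> complex" where
  "coef T p q = ell2_nth (T (ket q)) p"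

lemma coef_eq_cinner: "coef T p q = cinner (ket p) (T (ket q))"
  by (simp add: coef_def cinner_ket_left)

lemma bounded_opsD: "T \<in> bounded_ops \<Longrightarrow> T (c *\<^sub>C x) = c *\<^sub>C T x"
  by (simp add: bounded_ops_def)

lemma norm_ket [simp]: "norm (ket k) = 1"
  using norm_sum_ket[of "{k}" "\<lambda>_. 1"]
  by (simp add: power2_eq_1_iff ell2_eqI scaleC_ell2.rep_eq norm_scaleC_ell2)
    (metis norm_ge_zero neg_0_le_iff_le not_one_le_zero)

lemma cmod_coef_le: "cmod (coef T p q) \<le> norm T"
proof -
  have "cmod (coef T p q) \<le> norm (T (ket q))"
    unfolding coef_def by (rule norm_nth_ell2_le)
  also have "\<dots> \<le> norm T"
    using norm_blinfun[of T "ket q"] by simp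
  finally show ?thesis .
qed

lemma op_eqI:
  assumes "S \<in> bounded_ops" "T \<in> bounded_ops" "\<And>p q. coef S p q = coef T p q"
  shows "S = T"
proof (rule blinfun_eqI, rule bounded_linear_eq_ket[of "blinfun_apply S" "blinfun_apply T"])
  show "S (c *\<^sub>C ket k) = T (c *\<^sub>C ket k)" for c k
  proof -
    have "S (ket k) = T (ket k)"
      using assms(3)[of _ k] by (intro ell2_eqI) (simp add: coef_def)
    then show ?thesis by (simp add: bounded_opsD assms(1,2))
  qed
qed (rule blinfun.bounded_linear_right)+

lemma op_nth_eqI:
  fixes S T :: "'p op"
  shows "(\<And>x p. ell2_nth (S x) p = ell2_nth (T x) p) \<Longrightarrow> S = T"
  by (rule blinfun_eqI, rule ell2_eqI) blast

lemma bounded_ops_id [simp]: "id_blinfun \<in> bounded_ops"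
  by (simp add: bounded_ops_def)

lemma bounded_ops_compose: "S \<in> bounded_ops \<Longrightarrow> T \<in> bounded_ops \<Longrightarrow> S o\<^sub>L T \<in> bounded_ops"
  by (simp add: bounded_ops_def)

lemma scaleC_op_bounded: "T \<in> bounded_ops \<Longrightarrow> scaleC_op c T \<in> bounded_ops"
  by (simp add: bounded_ops_def scaleC_op_apply scaleC_scaleC mult.commute)

lemma bounded_ops_plus: "S \<in> bounded_ops \<Longrightarrow> T \<in> bounded_ops \<Longrightarrow> S + T \<in> bounded_ops"
  by (simp add: bounded_ops_def blinfun.add_left scaleC_add_right)

lemma scaleC_minus: "c *\<^sub>C (x - y) = c *\<^sub>C x - c *\<^sub>C (y :: 'p ell2)"
  by transfer (simp add: algebra_simps)

lemma bounded_ops_minus: "S \<in> bounded_ops \<Longrightarrow> T \<in> bounded_ops \<Longrightarrow> S - T \<in> bounded_ops"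
  by (simp add: bounded_ops_def blinfun.diff_left scaleC_minus)

lemma bounded_ops_zero [simp]: "0 \<in> bounded_ops"
  by (simp add: bounded_ops_def) (metis scaleR_zero_left scaleC_scaleR)

lemma bounded_ops_scaleR: "T \<in> bounded_ops \<Longrightarrow> r *\<^sub>R T \<in> bounded_ops"
  by (simp add: bounded_ops_def blinfun.scaleR_left scaleC_scaleR)

lemma coef_plus [simp]: "coef (S + T) p q = coef S p q + coef T p q"
  by (simp add: coef_def blinfun.add_left plus_ell2.rep_eq)

lemma coef_minus [simp]: "coef (S - T) p q = coef S p q - coef T p q"
  by (simp add: coef_def blinfun.diff_left minus_ell2.rep_eq)

lemma coef_scaleR [simp]: "coef (r *\<^sub>R T) p q = r * coef T p q"
  by (simp add: coef_def blinfun.scaleR_left scaleR_ell2.rep_eq scaleR_conv_of_real)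

lemma coef_scaleC [simp]: "coef (scaleC_op c T) p q = c * coef T p q"
  by (simp add: coef_def scaleC_op_apply scaleC_ell2.rep_eq)

lemma coef_id [simp]: "coef id_blinfun p q = (if p = q then 1 else 0)"
  by (simp add: coef_def ket.rep_eq)

lemma coef_zero [simp]: "coef 0 p q = 0"
  by (simp add: coef_def zero_ell2.rep_eq)

lemma coef_sum: "coef (\<Sum>a\<in>S. f a) p q = (\<Sum>a\<in>S. coef (f a) p q)"
  by (induction S rule: infinite_finite_induct) auto

lemma bounded_ops_sum: "(\<And>a. a \<in> S \<Longrightarrow> f a \<in> bounded_ops) \<Longrightarrow> (\<Sum>a\<in>S. f a) \<in> bounded_ops"
  by (induction S rule: infinite_finite_induct) (auto intro: bounded_ops_plus)

lemma cinner_sum_right: "cinner x (\<Sum>i\<in>F. f i) = (\<Sum>i\<in>F. cinner x (f i))"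
  by (rule linear_sum[OF bounded_linear.linear[OF bounded_linear_cinner_right]])

lemma cinner_sum_left: "cinner (\<Sum>i\<in>F. f i) x = (\<Sum>i\<in>F. cinner (f i) x)"
  by (subst cinner_commute, subst cinner_sum_right) (simp flip: cinner_commute add: cnj_sum)

lemma cinner_self: "cinner x x = (norm x)\<^sup>2"
proof (rule complex_eqI)
  show "Re (cinner x x) = Re (complex_of_real ((norm x)\<^sup>2))"
    by (simp add: cinner_self_infsum norm_ell2_square del: of_real_power)
  show "Im (cinner x x) = Im (complex_of_real ((norm x)\<^sup>2))"
    using arg_cong[OF cinner_commute[of x x], of Im] by (simp del: of_real_power)
qed

lemma ell2_finite_support:
  assumes "finite F" "\<And>i. i \<notin> F \<Longrightarrow> ell2_nth x i = 0"
  shows "x = (\<Sum>k\<in>F. ell2_nth x k *\<^sub>C ket k)"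
  by (rule ell2_eqI) (use assms in \<open>auto simp: nth_sum_ket\<close>)

lemma coef_compose:
  assumes "S \<in> bounded_ops" "finite F" "\<And>r. r \<notin> F \<Longrightarrow> coef T r q = 0"
  shows "coef (S o\<^sub>L T) p q = (\<Sum>r\<in>F. coef S p r * coef T r q)"
proof -
  have *: "T (ket q) = (\<Sum>r\<in>F. coef T r q *\<^sub>C ket r)"
    unfolding coef_def by (rule ell2_finite_support) (use assms in \<open>auto simp: coef_def\<close>)
  have "coef (S o\<^sub>L T) p q = ell2_nth (S (\<Sum>r\<in>F. coef T r q *\<^sub>C ket r)) p"
    unfolding coef_def[of "S o\<^sub>L T"] * [symmetric] by simp
  then show ?thesis
    by (simp add: blinfun.sum_right bounded_opsD[OF assms(1)] nth_sum_ell2 scaleC_ell2.rep_eq coef_def[of S] mult.commute)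
qed

subsection \<open>Adjoints\<close>

lemma adj_bounded: "T \<in> bounded_ops \<Longrightarrow> adj T \<in> bounded_ops"
  unfolding bounded_ops_def mem_Collect_eq
  by (intro allI cinner_left_eqI)
    (simp add: cinner_adj[unfolded bounded_ops_def mem_Collect_eq] cinner_scaleC_left)

lemma coef_adj: "T \<in> bounded_ops \<Longrightarrow> coef (adj T) p q = cnj (coef T q p)"
  by (simp add: coef_eq_cinner) (metis cinner_adj cinner_commute)

lemma cinner_adj_right: "T \<in> bounded_ops \<Longrightarrow> cinner x (adj T y) = cinner (T x) y"
  by (metis cinner_adj cinner_commute)

lemma adj_eqI:
  fixes S T :: "'p op"
  assumes "T \<in> bounded_ops" "\<And>x y. cinner (S x) y = cinner x (T y)"
  shows "adj T = S"
  by (rule blinfun_eqI, rule cinner_left_eqI) (simp add: assms cinner_adj)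

lemma adj_adj: "T \<in> bounded_ops \<Longrightarrow> adj (adj T) = T"
  by (rule adj_eqI) (auto simp: adj_bounded cinner_adj_right)

lemma adj_compose: "S \<in> bounded_ops \<Longrightarrow> T \<in> bounded_ops \<Longrightarrow> adj (S o\<^sub>L T) = adj T o\<^sub>L adj S"
  by (rule adj_eqI) (auto simp: bounded_ops_compose cinner_adj)

lemma adj_id [simp]: "adj id_blinfun = id_blinfun"
  by (rule adj_eqI) auto

lemma adj_minus: "S \<in> bounded_ops \<Longrightarrow> T \<in> bounded_ops \<Longrightarrow> adj (S - T) = adj S - adj T"
  by (rule op_eqI) (auto simp: bounded_ops_minus adj_bounded coef_adj)

text \<open>Polarisation: realness of the quadratic form at \<open>x + y\<close> and at
  \<open>x + \<i> *\<^sub>C y\<close> makes a + b and i(a - b) real, which together say that a is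
  the conjugate of b. It is what makes a positive operator its own modulus.\<close>

lemma positive_op_adj:
  assumes "positive_op T" shows "adj T = T"
proof (rule adj_eqI)
  show T: "T \<in> bounded_ops" using assms by (simp add: positive_op_def)
  fix x y
  have real: "cinner z (T z) = cnj (cinner z (T z))" for z
    using assms unfolding positive_op_def
    by (metis Reals_cnj_iff nonneg_Reals_subset_Reals subsetD)
  define a where "a = cinner x (T y)"
  define b where "b = cinner y (T x)"
  have "a + b = cnj (a + b)"
    using real[of "x + y"] real[of x] real[of y]
    by (simp add: a_def b_def cinner_add_left cinner_add_right blinfun.add_right algebra_simps)
  moreover have "\<i> * a - \<i> * b = cnj (\<i> * a - \<i> * b)"
    using real[of "x + \<i> *\<^sub>C y"] real[of x] real[of y]
    by (simp add: a_def b_def cinner_add_left cinner_add_right blinfun.add_right bounded_opsD[OF T]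
        cinner_scaleC_left cinner_scaleC_right algebra_simps)
  ultimately have "a = cnj b"
    by (auto simp: complex_eq_iff)
  then show "cinner (T x) y = cinner x (T y)"
    by (simp add: a_def b_def cinner_commute[symmetric])
qed

lemma projection_op_simps:
  assumes "projection_op e"
  shows "e \<in> bounded_ops" "e (e x) = e x" "cinner (e x) y = cinner x (e y)"
proof -
  show "e \<in> bounded_ops" using assms by (simp add: projection_op_def)
  show "e (e x) = e x" using assms by (metis projection_op_def blinfun_apply_blinfun_compose)
  show "cinner (e x) y = cinner x (e y)" using assms by (metis projection_op_def cinner_adj)
qed

lemma projection_op_norm_sq:
  assumes "projection_op e"
  shows "cinner x (e x) = (norm (e x))\<^sup>2"
  by (metis assms cinner_self projection_op_simps(2,3))

lemma projection_op_complement: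
  assumes "projection_op e"
  shows "projection_op (id_blinfun - e)"
  using assms projection_op_simps(2)[OF assms]
  by (auto simp: projection_op_def bounded_ops_minus adj_minus blinfun.diff_left blinfun.diff_right
      intro!: blinfun_eqI)

lemma norm_projection_le:
  assumes "projection_op e"
  shows "norm (e x) \<le> norm x"
proof -
  have "(norm (e x))\<^sup>2 = cmod (cinner x (e x))"
    by (simp add: projection_op_norm_sq[OF assms] norm_power)
  also have "\<dots> \<le> norm x * norm (e x)" by (rule norm_cinner_le)
  finally show ?thesis
    by (cases "norm (e x) = 0") (auto simp: power2_eq_square mult_le_cancel_right)
qed

subsection \<open>Operators given by their coordinates\<close>

definition op_of :: "('p ell2 \<Rightarrow> 'p \<Rightarrow> complex) \<Rightarrow> 'p op" where
  "op_of f = Blinfun (\<lambda>x. Abs_ell2 (f x))"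

lemma op_of:
  assumes "\<And>x y p. f (x + y) p = f x p + f y p" "\<And>c x p. f (c *\<^sub>C x) p = c * f x p"
    and le: "\<And>F x. finite F \<Longrightarrow> (\<Sum>p\<in>F. (cmod (f x p))\<^sup>2) \<le> (K * norm x)\<^sup>2" and "0 \<le> K"
  shows "ell2_nth (op_of f x) p = f x p" "op_of f \<in> bounded_ops"
proof -
  have nth: "ell2_nth (Abs_ell2 (f x)) p = f x p" for x p
    by (subst Abs_ell2_inverse) (auto intro: summable_ell2I[OF le])
  have "bounded_linear (\<lambda>x. Abs_ell2 (f x))"
  proof (rule bounded_linear_intro[where K = K])
    show "Abs_ell2 (f (x + y)) = Abs_ell2 (f x) + Abs_ell2 (f y)" for x y
      by (rule ell2_eqI) (simp add: nth plus_ell2.rep_eq assms)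
    show "Abs_ell2 (f (r *\<^sub>R x)) = r *\<^sub>R Abs_ell2 (f x)" for r x
      by (rule ell2_eqI)
        (simp add: nth scaleR_ell2.rep_eq assms(2) scaleR_conv_of_real scaleC_ell2.rep_eq flip: scaleC_of_real)
    show "norm (Abs_ell2 (f x)) \<le> norm x * K" for x
      by (rule norm_ell2_leI) (auto simp: nth mult.commute[of "norm x"] \<open>0 \<le> K\<close> le)
  qed
  then have app: "op_of f x = Abs_ell2 (f x)" for x
    by (simp add: op_of_def bounded_linear_Blinfun_apply)
  show "ell2_nth (op_of f x) p = f x p" by (simp add: app nth)
  show "op_of f \<in> bounded_ops"
    by (auto simp: bounded_ops_def app nth assms(2) scaleC_ell2.rep_eq intro!: ell2_eqI)
qed

text \<open>A partial isometry as soon as \<open>h\<close> is injective on \<open>A\<close>. Matrix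
  units, shifts between copies and coordinate cuts are all of this form, so boundedness is proved
  once.\<close>

definition pull_op :: "'p set \<Rightarrow> ('p \<Rightarrow> 'p) \<Rightarrow> 'p op" where
  "pull_op A h = op_of (\<lambda>x p. if p \<in> A then ell2_nth x (h p) else 0)"

lemma pull_op:
  assumes "inj_on h A"
  shows "ell2_nth (pull_op A h x) p = (if p \<in> A then ell2_nth x (h p) else 0)"
    and "pull_op A h \<in> bounded_ops"
proof -
  let ?f = "\<lambda>x p. if p \<in> A then ell2_nth x (h p) else 0"
  have *: "(\<Sum>p\<in>F. (cmod (?f x p))\<^sup>2) \<le> (1 * norm x)\<^sup>2" if "finite F" for F x
  proof -
    have "(\<Sum>p\<in>F. (cmod (?f x p))\<^sup>2) = (\<Sum>p\<in>F \<inter> A. (cmod (ell2_nth x (h p)))\<^sup>2)"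
      by (rule sum.mono_neutral_cong_right) (use that in auto)
    also have "\<dots> = (\<Sum>p\<in>h ` (F \<inter> A). (cmod (ell2_nth x p))\<^sup>2)"
      by (subst sum.reindex) (auto intro: inj_on_subset[OF assms])
    also have "\<dots> \<le> (norm x)\<^sup>2" by (rule sum_le_norm_ell2) (use that in auto)
    finally show ?thesis by simp
  qed
  show "ell2_nth (pull_op A h x) p = ?f x p" unfolding pull_op_def
    by (rule op_of[OF _ _ *]) (auto simp: plus_ell2.rep_eq scaleC_ell2.rep_eq)
  show "pull_op A h \<in> bounded_ops" unfolding pull_op_def
    by (rule op_of[OF _ _ *]) (auto simp: plus_ell2.rep_eq scaleC_ell2.rep_eq)
qed

definition cut :: "'p set \<Rightarrow> 'p op" where
  "cut A = pull_op A (\<lambda>p. p)"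

lemma nth_cut [simp]: "ell2_nth (cut A x) p = (if p \<in> A then ell2_nth x p else 0)"
  by (simp add: cut_def pull_op)

lemma cut_bounded [simp]: "cut A \<in> bounded_ops"
  by (simp add: cut_def pull_op)

lemma cut_ket: "cut A (ket q) = (if q \<in> A then ket q else 0)"
  by (rule ell2_eqI) (auto simp: ket.rep_eq zero_ell2.rep_eq)

lemma coef_cut [simp]: "coef (cut A) p q = (if p = q \<and> p \<in> A then 1 else 0)"
  by (simp add: coef_def ket.rep_eq)

lemma has_sum_norm_cut: "((\<lambda>p. (cmod (ell2_nth x p))\<^sup>2) has_sum (norm (cut A x))\<^sup>2) A"
proof -
  have "((\<lambda>p. (cmod (ell2_nth (cut A x) p))\<^sup>2) has_sum (norm (cut A x))\<^sup>2) UNIV"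
    unfolding norm_ell2_square by (rule has_sum_infsum[OF ell2_summable])
  then show ?thesis
    by (rule has_sum_cong_neutral[THEN iffD1, rotated -1]) auto
qed

lemma has_sum_cinner: "((\<lambda>i. cnj (ell2_nth x i) * ell2_nth y i) has_sum cinner x y) UNIV"
  unfolding cinner_def by (rule has_sum_infsum[OF ell2_summable_cinner])

lemma has_sum_cinner_cut: "((\<lambda>i. cnj (ell2_nth x i) * ell2_nth y i) has_sum cinner (cut A x) y) A"
  using has_sum_cinner[of "cut A x" y]
  by (rule has_sum_cong_neutral[THEN iffD1, rotated -1]) auto

subsection \<open>Commutants\<close>

lemma commutant_bounded: "commutant M \<subseteq> bounded_ops"
  by (auto simp: commutant_def)

lemma commutantD:
  assumes "X \<in> commutant M" "S \<in> M"
  shows "X (S y) = S (X y)"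
proof -
  have "X o\<^sub>L S = S o\<^sub>L X"
    using assms by (simp add: commutant_def)
  then show ?thesis
    by (metis blinfun_apply_blinfun_compose)
qed

lemma commutant_antimono: "M \<subseteq> N \<Longrightarrow> commutant N \<subseteq> commutant M"
  by (auto simp: commutant_def)

lemma subset_bicommutant: "M \<subseteq> bounded_ops \<Longrightarrow> M \<subseteq> commutant (commutant M)"
  by (auto simp: commutant_def)

lemma tricommutant: "M \<subseteq> bounded_ops \<Longrightarrow> commutant (commutant (commutant M)) = commutant M"
  by (rule antisym) (simp_all add: commutant_antimono subset_bicommutant commutant_bounded)

lemma adj_commutant:
  assumes M: "M \<subseteq> bounded_ops" "\<And>S. S \<in> M \<Longrightarrow> adj S \<in> M" and T: "T \<in> commutant M"
  shows "adj T \<in> commutant M"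
proof -
  have Tb: "T \<in> bounded_ops" using T by (simp add: commutant_def)
  have "adj T o\<^sub>L S = S o\<^sub>L adj T" if S: "S \<in> M" for S
  proof -
    have "adj (T o\<^sub>L adj S) = adj (adj S o\<^sub>L T)"
      using T M(2)[OF S] by (simp add: commutant_def)
    then show ?thesis using Tb S M
      by (simp add: adj_compose adj_adj adj_bounded subset_iff)
  qed
  then show ?thesis using Tb by (simp add: commutant_def adj_bounded)
qed

lemma von_neumann_bicommutant:
  assumes "M \<subseteq> bounded_ops" "\<And>S. S \<in> M \<Longrightarrow> adj S \<in> M"
  shows "von_neumann_algebra (commutant (commutant M))"
  unfolding von_neumann_algebra_def
  using assms commutant_bounded adj_commutant[of "commutant M"] adj_commutant[of M]
    arg_cong[OF tricommutant[OF assms(1)], of commutant] by blast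

section \<open>Block algebras\<close>

text \<open>
  The basis of the Hilbert space is identified with pairs (index, copy), and \<open>unit_op a b\<close> is the
  matrix unit \<open>E\<^sub>a\<^sub>b \<otimes> 1\<close>. A map \<open>\<rho>\<close> on indices stands for the partition into its fibres; \<open>block_alg \<rho>\<close>
  consists of the operators \<open>T \<otimes> 1\<close> with \<open>T\<close> block diagonal for this partition. The copies give a
  faithful unital action on a basis of any infinite cardinality while the index set is countable.
\<close>

locale grid =
  fixes idx :: "'p \<Rightarrow> 'i::countable" and cpy :: "'p \<Rightarrow> 'c" and pt :: "'i \<Rightarrow> 'c \<Rightarrow> 'p"
  assumes idx_pt [simp]: "idx (pt a c) = a" and cpy_pt [simp]: "cpy (pt a c) = c"
    and pt_idx_cpy [simp]: "pt (idx p) (cpy p) = p"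
begin

lemma pt_eq_iff [simp]: "pt a c = p \<longleftrightarrow> a = idx p \<and> c = cpy p" "p = pt a c \<longleftrightarrow> a = idx p \<and> c = cpy p"
  by auto

definition unit_op :: "'i \<Rightarrow> 'i \<Rightarrow> 'p op" where
  "unit_op a b = pull_op {p. idx p = a} (\<lambda>p. pt b (cpy p))"

text \<open>The matrix unit 1 tensor E_cd on the multiplicity space; it commutes with every
  \<open>unit_op\<close>.\<close>

definition copy_op :: "'c \<Rightarrow> 'c \<Rightarrow> 'p op" where
  "copy_op c d = pull_op {p. cpy p = c} (\<lambda>p. pt (idx p) d)"

definition cls :: "('i \<Rightarrow> 'i) \<Rightarrow> 'i \<Rightarrow> 'p set" where
  "cls \<rho> r = {p. \<rho> (idx p) = r}"

definition units :: "('i \<Rightarrow> 'i) \<Rightarrow> 'p op set" where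
  "units \<rho> = {unit_op a b | a b. \<rho> a = \<rho> b}"

definition block_alg :: "('i \<Rightarrow> 'i) \<Rightarrow> 'p op set" where
  "block_alg \<rho> = {T \<in> bounded_ops.
     (\<forall>p q. coef T p q \<noteq> 0 \<longrightarrow> cpy p = cpy q \<and> \<rho> (idx p) = \<rho> (idx q)) \<and>
     (\<forall>a b c d. coef T (pt a c) (pt b c) = coef T (pt a d) (pt b d))}"

lemma nth_unit_op [simp]: "ell2_nth (unit_op a b x) p = (if idx p = a then ell2_nth x (pt b (cpy p)) else 0)"
  and unit_op_bounded [simp]: "unit_op a b \<in> bounded_ops"
proof -
  have "inj_on (\<lambda>p. pt b (cpy p)) {p. idx p = a}"
    by (rule inj_onI) (simp, metis pt_idx_cpy)
  from pull_op[OF this] show "ell2_nth (unit_op a b x) p = (if idx p = a then ell2_nth x (pt b (cpy p)) else 0)"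
    "unit_op a b \<in> bounded_ops"
    by (simp_all add: unit_op_def)
qed

lemma nth_copy_op [simp]: "ell2_nth (copy_op c d x) p = (if cpy p = c then ell2_nth x (pt (idx p) d) else 0)"
  and copy_op_bounded [simp]: "copy_op c d \<in> bounded_ops"
proof -
  have "inj_on (\<lambda>p. pt (idx p) d) {p. cpy p = c}"
    by (rule inj_onI) (simp, metis pt_idx_cpy)
  from pull_op[OF this] show "ell2_nth (copy_op c d x) p = (if cpy p = c then ell2_nth x (pt (idx p) d) else 0)"
    "copy_op c d \<in> bounded_ops"
    by (simp_all add: copy_op_def)
qed

lemma coef_unit_op [simp]:
  "coef (unit_op a b) p q = (if idx p = a \<and> idx q = b \<and> cpy p = cpy q then 1 else 0)"
  by (auto simp: coef_def ket.rep_eq)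

lemma unit_op_ket: "unit_op a b (ket q) = (if idx q = b then ket (pt a (cpy q)) else 0)"
  by (rule ell2_eqI) (auto simp: ket.rep_eq zero_ell2.rep_eq)

lemma adj_unit_op: "adj (unit_op a b) = unit_op b a"
  by (rule op_eqI) (auto simp: adj_bounded coef_adj)

lemma units_bounded: "units \<rho> \<subseteq> bounded_ops"
  by (auto simp: units_def)

lemma block_algD:
  assumes "T \<in> block_alg \<rho>"
  shows "T \<in> bounded_ops" "coef T p q \<noteq> 0 \<Longrightarrow> cpy p = cpy q" "coef T p q \<noteq> 0 \<Longrightarrow> \<rho> (idx p) = \<rho> (idx q)"
    "coef T (pt a c) (pt b c) = coef T (pt a d) (pt b d)"
  using assms by (auto simp: block_alg_def)

lemma coef_block_alg:
  assumes "T \<in> block_alg \<rho>"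
  shows "coef T p q =
    (if cpy p = cpy q \<and> \<rho> (idx p) = \<rho> (idx q) then coef T (pt (idx p) c) (pt (idx q) c) else 0)"
  using block_algD(2,3)[OF assms, of p q] block_algD(4)[OF assms, of "idx p" c "idx q" "cpy q"]
  by (metis pt_idx_cpy)

lemma block_algI:
  assumes "T \<in> bounded_ops"
    "\<And>p q. coef T p q = (if cpy p = cpy q \<and> \<rho> (idx p) = \<rho> (idx q) then t (idx p) (idx q) else 0)"
  shows "T \<in> block_alg \<rho>"
  using assms(1) by (simp add: block_alg_def assms(2))

lemma units_subset_block_alg: "units \<rho> \<subseteq> block_alg \<rho>"
  by (auto simp: units_def intro!: block_algI[where t = "\<lambda>a' b'. coef (unit_op _ _) (pt a' undefined) (pt b' undefined)"])

lemma block_alg_bounded: "block_alg \<rho> \<subseteq> bounded_ops"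
  by (auto simp: block_alg_def)

lemma block_alg_mono:
  assumes "\<And>a b. \<sigma> a = \<sigma> b \<Longrightarrow> \<rho> a = \<rho> b"
  shows "block_alg \<sigma> \<subseteq> block_alg \<rho>"
  using assms unfolding block_alg_def by blast

lemma block_alg_ket:
  assumes "T \<in> block_alg \<rho>" and fin: "finite {a. \<rho> a = \<rho> (idx q)}"
  shows "T (ket q) = (\<Sum>a | \<rho> a = \<rho> (idx q). coef T (pt a (cpy q)) q *\<^sub>C ket (pt a (cpy q)))"
proof (rule ell2_eqI)
  fix p
  have "ell2_nth (\<Sum>a | \<rho> a = \<rho> (idx q). coef T (pt a (cpy q)) q *\<^sub>C ket (pt a (cpy q))) p =
      (\<Sum>a | \<rho> a = \<rho> (idx q). if a = idx p then (if cpy p = cpy q then coef T (pt (idx p) (cpy q)) q else 0) else 0)"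
    by (auto simp: nth_sum_ell2 scaleC_ell2.rep_eq ket.rep_eq intro!: sum.cong)
  also have "\<dots> = coef T p q"
  proof (cases "cpy p = cpy q")
    case True
    then have "coef T (pt (idx p) (cpy q)) q = coef T p q" by (metis pt_idx_cpy)
    then show ?thesis
      using block_algD(3)[OF assms(1), of p q] fin True by (auto simp: sum.delta)
  qed (use block_algD(2)[OF assms(1), of p q] fin in auto)
  finally show "ell2_nth (T (ket q)) p =
      ell2_nth (\<Sum>a | \<rho> a = \<rho> (idx q). coef T (pt a (cpy q)) q *\<^sub>C ket (pt a (cpy q))) p"
    by (simp add: coef_def)
qed

text \<open>On a single column everything is finite: \<open>T\<close> composed with
  \<open>unit_op b b\<close> is a finite combination of matrix units, because the fibre of
  \<open>b\<close> is finite. Commuting with the units therefore already forces commuting with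
  \<open>T\<close>, without any limit of operators.\<close>

lemma commute_block_alg:
  assumes X: "X \<in> commutant (units \<rho>)" and T: "T \<in> block_alg \<rho>" and fin: "\<And>r. finite {a. \<rho> a = r}"
  shows "X o\<^sub>L T = T o\<^sub>L X"
proof (rule op_eqI)
  have Xb: "X \<in> bounded_ops" and Tb: "T \<in> bounded_ops"
    using X T by (auto simp: commutant_def block_alg_def)
  show "X o\<^sub>L T \<in> bounded_ops" "T o\<^sub>L X \<in> bounded_ops"
    using Xb Tb by (auto intro: bounded_ops_compose)
  have comm: "X (unit_op a b y) = unit_op a b (X y)" if "\<rho> a = \<rho> b" for a b y
    by (rule commutantD[OF X]) (use that in \<open>auto simp: units_def\<close>)
  fix p q
  define A where "A = {a. \<rho> a = \<rho> (idx q)}"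
  have "finite A" unfolding A_def by (rule fin)
  have Tu: "T (unit_op (idx q) (idx q) y) =
      (\<Sum>a\<in>A. coef T (pt a (cpy q)) q *\<^sub>C unit_op a (idx q) y)" (is "?f y = ?g y") for y
  proof (rule bounded_linear_eq_ket[of ?f ?g])
    show "bounded_linear ?f"
      by (intro bounded_linear_compose[OF blinfun.bounded_linear_right] blinfun.bounded_linear_right)
    show "bounded_linear ?g"
      by (intro bounded_linear_sum bounded_linear_compose[OF bounded_linear_scaleC] blinfun.bounded_linear_right)
    fix c k
    have "T (ket (pt (idx q) (cpy k))) = (\<Sum>a\<in>A. coef T (pt a (cpy q)) q *\<^sub>C ket (pt a (cpy k)))"
      if "idx k = idx q"
    proof -
      have kk: "pt (idx q) (cpy k) = k"
        using that by (metis pt_idx_cpy)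
      have "coef T (pt a (cpy q)) q = coef T (pt a (cpy k)) k" for a
        using block_algD(4)[OF T, of a "cpy q" "idx q" "cpy k"] pt_idx_cpy[of q] pt_idx_cpy[of k]
        unfolding that by simp
      then show ?thesis
        using block_alg_ket[OF T, of k] \<open>finite A\<close> unfolding kk by (simp add: A_def that)
    qed
    then show "?f (c *\<^sub>C ket k) = ?g (c *\<^sub>C ket k)"
      by (auto simp: bounded_opsD[OF unit_op_bounded] unit_op_ket bounded_opsD[OF Tb] scaleC_ell2.rep_eq
          nth_sum_ell2 zero_ell2.rep_eq mult.left_commute sum_distrib_left intro!: ell2_eqI)
  qed
  have "X (T (ket q)) = (\<Sum>a\<in>A. coef T (pt a (cpy q)) q *\<^sub>C X (unit_op a (idx q) (ket q)))"
    using block_alg_ket[OF T, of q] \<open>finite A\<close>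
    by (simp add: A_def blinfun.sum_right bounded_opsD[OF Xb] unit_op_ket)
  also have "\<dots> = (\<Sum>a\<in>A. coef T (pt a (cpy q)) q *\<^sub>C unit_op a (idx q) (X (ket q)))"
    by (intro sum.cong) (auto simp: comm A_def)
  also have "\<dots> = T (X (unit_op (idx q) (idx q) (ket q)))"
    by (simp add: Tu comm)
  also have "\<dots> = T (X (ket q))"
    by (simp add: unit_op_ket)
  finally show "coef (X o\<^sub>L T) p q = coef (T o\<^sub>L X) p q"
    by (simp add: coef_def)
qed

text \<open>The commutant of the units contains every \<open>copy_op c d\<close> and every cut to a
  class. Commuting with \<open>copy_op c c\<close> makes an operator diagonal in the copy, commuting
  with \<open>copy_op c d\<close> makes its entries independent of the copy, and commuting with the
  cuts makes it block diagonal. The converse inclusion is \<open>commute_block_alg\<close>.\<close>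

lemma bicommutant_units:
  assumes fin: "\<And>r. finite {a. \<rho> a = r}"
  shows "commutant (commutant (units \<rho>)) = block_alg \<rho>"
proof
  show "block_alg \<rho> \<subseteq> commutant (commutant (units \<rho>))"
    using commute_block_alg[OF _ _ fin] block_alg_bounded by (auto simp: commutant_def)
next
  have 1: "copy_op c d \<in> commutant (units \<rho>)" for c d
    by (auto simp: commutant_def units_def intro!: op_nth_eqI)
  have 2: "cut (cls \<rho> r) \<in> commutant (units \<rho>)" for r
    by (auto simp: commutant_def units_def cls_def intro!: op_nth_eqI)
  show "commutant (commutant (units \<rho>)) \<subseteq> block_alg \<rho>"
  proof
    fix S assume S: "S \<in> commutant (commutant (units \<rho>))"
    then have Sb: "S \<in> bounded_ops" by (simp add: commutant_def)
    have copy: "S (copy_op c d x) = copy_op c d (S x)" for c d x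
      by (rule commutantD[OF S 1])
    have cut: "S (cut (cls \<rho> r) x) = cut (cls \<rho> r) (S x)" for r x
      by (rule commutantD[OF S 2])
    have ket: "copy_op c d (ket (pt b d)) = ket (pt b c)" for b c d
      by (rule ell2_eqI) (auto simp: ket.rep_eq)
    have "coef S p q = 0" if "cpy p \<noteq> cpy q" for p q
      using arg_cong[OF copy[of "cpy q" "cpy q" "ket q"], of "\<lambda>x. ell2_nth x p"] that
        ket[of "cpy q" "cpy q" "idx q"] by (simp add: coef_def)
    moreover have "coef S p q = 0" if "\<rho> (idx p) \<noteq> \<rho> (idx q)" for p q
      using arg_cong[OF cut[of "\<rho> (idx q)" "ket q"], of "\<lambda>x. ell2_nth x p"] that
      by (simp add: coef_def cut_ket cls_def split: if_splits)
    moreover have "coef S (pt a c) (pt b c) = coef S (pt a d) (pt b d)" for a b c d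
      using arg_cong[OF copy[of c d "ket (pt b d)"], of "\<lambda>x. ell2_nth x (pt a c)"]
      by (simp add: coef_def ket)
    ultimately show "S \<in> block_alg \<rho>"
      using Sb unfolding block_alg_def by blast
  qed
qed

lemma von_neumann_block_alg:
  assumes fin: "\<And>r. finite {a. \<rho> a = r}"
  shows "von_neumann_algebra (block_alg \<rho>)"
  unfolding bicommutant_units[OF fin, symmetric]
proof (rule von_neumann_bicommutant)
  show "adj S \<in> units \<rho>" if "S \<in> units \<rho>" for S
    using that by (force simp: units_def adj_unit_op)
qed (rule units_bounded)

lemma block_alg_compose_coef:
  assumes S: "S \<in> block_alg \<rho>" and T: "T \<in> block_alg \<rho>" and fin: "finite {a. \<rho> a = \<rho> b}"
  shows "coef (S o\<^sub>L T) p (pt b c) = (\<Sum>a | \<rho> a = \<rho> b. coef S p (pt a c) * coef T (pt a c) (pt b c))"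
proof -
  have "coef (S o\<^sub>L T) p (pt b c) = (\<Sum>r\<in>(\<lambda>a. pt a c) ` {a. \<rho> a = \<rho> b}. coef S p r * coef T r (pt b c))"
  proof (rule coef_compose)
    show "coef T r (pt b c) = 0" if "r \<notin> (\<lambda>a. pt a c) ` {a. \<rho> a = \<rho> b}" for r
      using block_algD(2,3)[OF T, of r "pt b c"] that pt_idx_cpy[of r]
      by (cases "coef T r (pt b c) = 0") (auto simp: image_iff simp del: pt_idx_cpy)
  qed (use S fin in \<open>auto simp: block_alg_def\<close>)
  then show ?thesis
    by (simp add: sum.reindex inj_on_def)
qed

lemma block_algE:
  assumes "T \<in> block_alg \<rho>"
  obtains t where
    "\<And>p q. coef T p q = (if cpy p = cpy q \<and> \<rho> (idx p) = \<rho> (idx q) then t (idx p) (idx q) else 0)"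
  \<comment> \<open>The entries are the same in all copies, so they may be read at an arbitrary
    one.\<close>
  by (rule that[of "\<lambda>a b. coef T (pt a undefined) (pt b undefined)"]) (rule coef_block_alg[OF assms])

lemma block_alg_id: "id_blinfun \<in> block_alg \<rho>"
proof (rule block_algI[where t = "\<lambda>a b. if a = b then 1 else 0"])
  fix p q
  have "p = q \<longleftrightarrow> idx p = idx q \<and> cpy p = cpy q"
    using pt_eq_iff(1)[of "idx p" "cpy p" q] by simp
  then show "coef id_blinfun p q =
      (if cpy p = cpy q \<and> \<rho> (idx p) = \<rho> (idx q) then if idx p = idx q then 1 else 0 else 0)"
    by auto
qed simp

end

section \<open>Tensor products of block algebras\<close>

lemma tensor_ket: "ket (p, q) = ket p \<otimes>\<^sub>h ket q"
  by (rule ell2_eqI) (auto simp: ket.rep_eq tensor_ell2.rep_eq split: if_splits)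

lemma coef_tensor_op:
  assumes "S \<in> bounded_ops" "T \<in> bounded_ops"
  shows "coef (S \<otimes>\<^sub>o T) p q = coef S (fst p) (fst q) * coef T (snd p) (snd q)"
  using tensor_op(2)[OF assms, of "ket (fst q)" "ket (snd q)"]
  by (simp add: coef_def tensor_ell2.rep_eq case_prod_unfold flip: tensor_ket)

locale grid_product =
  A: grid idx1 cpy1 pt1 + B: grid idx2 cpy2 pt2
  for idx1 :: "'p1 \<Rightarrow> 'i1::countable" and cpy1 :: "'p1 \<Rightarrow> 'c1" and pt1
    and idx2 :: "'p2 \<Rightarrow> 'i2::countable" and cpy2 :: "'p2 \<Rightarrow> 'c2" and pt2
begin

sublocale P: grid "map_prod idx1 idx2" "map_prod cpy1 cpy2" "\<lambda>a c. (pt1 (fst a) (fst c), pt2 (snd a) (snd c))"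
  by standard auto

lemma tensor_unit_op:
  "A.unit_op a b \<otimes>\<^sub>o B.unit_op a' b' = P.unit_op (a, a') (b, b')"
  by (rule op_eqI) (auto simp: tensor_op(1) coef_tensor_op)

lemma tensor_block_alg:
  assumes S: "S \<in> A.block_alg \<rho>1" and T: "T \<in> B.block_alg \<rho>2"
  shows "S \<otimes>\<^sub>o T \<in> P.block_alg (map_prod \<rho>1 \<rho>2)"
proof -
  note b = A.block_algD(1)[OF S] B.block_algD(1)[OF T]
  obtain s where s: "\<And>p q. coef S p q = (if cpy1 p = cpy1 q \<and> \<rho>1 (idx1 p) = \<rho>1 (idx1 q) then s (idx1 p) (idx1 q) else 0)"
    by (rule A.block_algE[OF S]) blast
  obtain t where t: "\<And>p q. coef T p q = (if cpy2 p = cpy2 q \<and> \<rho>2 (idx2 p) = \<rho>2 (idx2 q) then t (idx2 p) (idx2 q) else 0)"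
    by (rule B.block_algE[OF T]) blast
  show ?thesis
  proof (rule P.block_algI[where t = "\<lambda>a b. s (fst a) (fst b) * t (snd a) (snd b)"])
    show "S \<otimes>\<^sub>o T \<in> bounded_ops" by (intro tensor_op b)
  qed (simp add: coef_tensor_op b s t map_prod_def case_prod_unfold)
qed

text \<open>The set of elementary tensors lies between the matrix units of the product grid and the
  block algebra of the product partition, and these two sets have the same bicommutant.\<close>

lemma vn_tensor_block_alg:
  assumes fin: "\<And>r. finite {a. \<rho>1 a = r}" "\<And>r. finite {a. \<rho>2 a = r}"
  shows "A.block_alg \<rho>1 \<otimes>\<^sub>v\<^sub>N B.block_alg \<rho>2 = P.block_alg (map_prod \<rho>1 \<rho>2)"
proof
  have "finite {a. map_prod \<rho>1 \<rho>2 a = r}" for r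
    by (rule finite_subset[OF _ finite_cartesian_product[OF fin(1)[of "fst r"] fin(2)[of "snd r"]]]) auto
  note bi = P.bicommutant_units[OF this]
  let ?G = "{S \<otimes>\<^sub>o T | S T. S \<in> A.block_alg \<rho>1 \<and> T \<in> B.block_alg \<rho>2}"
  have "P.units (map_prod \<rho>1 \<rho>2) \<subseteq> ?G"
  proof
    fix R assume "R \<in> P.units (map_prod \<rho>1 \<rho>2)"
    then obtain a a' b b' where "R = P.unit_op (a, a') (b, b')" "\<rho>1 a = \<rho>1 b" "\<rho>2 a' = \<rho>2 b'"
      by (auto simp: P.units_def)
    then have "R = A.unit_op a b \<otimes>\<^sub>o B.unit_op a' b'" "A.unit_op a b \<in> A.block_alg \<rho>1"
      "B.unit_op a' b' \<in> B.block_alg \<rho>2"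
      using A.units_subset_block_alg[of \<rho>1] B.units_subset_block_alg[of \<rho>2]
      by (auto simp: tensor_unit_op A.units_def B.units_def)
    then show "R \<in> ?G" by blast
  qed
  then show "P.block_alg (map_prod \<rho>1 \<rho>2) \<subseteq> A.block_alg \<rho>1 \<otimes>\<^sub>v\<^sub>N B.block_alg \<rho>2"
    unfolding vn_tensor_def bi[symmetric] by (intro commutant_antimono)
  have "?G \<subseteq> P.block_alg (map_prod \<rho>1 \<rho>2)"
    using tensor_block_alg by blast
  then have "commutant (commutant ?G) \<subseteq> commutant (commutant (P.block_alg (map_prod \<rho>1 \<rho>2)))"
    by (intro commutant_antimono)
  also have "\<dots> = P.block_alg (map_prod \<rho>1 \<rho>2)"
    by (simp flip: bi add: tricommutant commutant_bounded)
  finally show "A.block_alg \<rho>1 \<otimes>\<^sub>v\<^sub>N B.block_alg \<rho>2 \<subseteq> P.block_alg (map_prod \<rho>1 \<rho>2)"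
    unfolding vn_tensor_def .
qed

end

section \<open>Normal functionals\<close>

lemma cinner_scaleR_right: "cinner x (r *\<^sub>R y) = complex_of_real r * cinner x y"
  using cinner_scaleC_right[of x "complex_of_real r" y] by (simp add: scaleC_of_real)

lemma cinner_scaleR_left: "cinner (r *\<^sub>R x) y = complex_of_real r * cinner x y"
  using cinner_scaleC_left[of "complex_of_real r" x y] by (simp add: scaleC_of_real)

lemma summable_bilinear:
  assumes "(\<lambda>j. (norm (x j))\<^sup>2) summable_on J" "(\<lambda>j. (norm (y j))\<^sup>2) summable_on J"
  shows "(\<lambda>j. norm (x j) * norm (y j)) summable_on J"
proof (rule summable_on_comparison_test)
  show "(\<lambda>j. (norm (x j))\<^sup>2 + (norm (y j))\<^sup>2) summable_on J"
    by (intro summable_on_add assms)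
  show "norm (x j) * norm (y j) \<le> (norm (x j))\<^sup>2 + (norm (y j))\<^sup>2" for j
    using zero_le_power2[of "norm (x j) - norm (y j)"]
      mult_nonneg_nonneg[OF norm_ge_zero[of "x j"] norm_ge_zero[of "y j"]]
    by (simp add: power2_diff del: mult_nonneg_nonneg)
qed auto

lemma cmod_cinner_op_le:
  fixes T :: "'p op"
  shows "cmod (cinner x (T y)) \<le> norm T * (norm x * norm y)"
proof -
  have "cmod (cinner x (T y)) \<le> norm x * norm (T y)" by (rule norm_cinner_le)
  also have "\<dots> \<le> norm x * (norm T * norm y)"
    by (intro mult_left_mono norm_blinfun) auto
  finally show ?thesis by (simp add: mult_ac)
qed

lemma abs_summable_functional:
  fixes T :: "'p op"
  assumes "(\<lambda>j. (norm (x j))\<^sup>2) summable_on J" "(\<lambda>j. (norm (y j))\<^sup>2) summable_on J"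
  shows "(\<lambda>j. norm (cinner (x j) (T (y j)))) summable_on J"
  by (rule summable_on_comparison_test[OF summable_on_cmult_right[OF summable_bilinear[OF assms]]])
    (auto intro: cmod_cinner_op_le)

text \<open>Weak-* functionals are defined by sequences of vectors, whereas traces and pinchings
  lead to families over indices or over pairs (vector, class). Absolute summability makes the value
  independent of the enumeration of such a family.\<close>

lemma weak_star_functionalI:
  fixes x y :: "'j::countable \<Rightarrow> 'p ell2" and \<phi> :: "'p op \<Rightarrow> complex"
  assumes "infinite (UNIV :: 'j set)"
    and "(\<lambda>j. (norm (x j))\<^sup>2) summable_on UNIV" "(\<lambda>j. (norm (y j))\<^sup>2) summable_on UNIV"
    and "\<And>T :: 'p op. \<phi> T = (\<Sum>\<^sub>\<infinity>j. cinner (x j) (T (y j)))"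
  shows "weak_star_functional \<phi>"
proof -
  define e where "e = from_nat_into (UNIV :: 'j set)"
  have e: "bij_betw e UNIV UNIV"
    unfolding e_def by (rule bij_betw_from_nat_into) (use assms(1) in auto)
  have sum: "(\<lambda>n. (norm (x (e n)))\<^sup>2) summable_on UNIV" "(\<lambda>n. (norm (y (e n)))\<^sup>2) summable_on UNIV"
    using summable_on_reindex_bij_betw[OF e, of "\<lambda>j. (norm (x j))\<^sup>2"]
      summable_on_reindex_bij_betw[OF e, of "\<lambda>j. (norm (y j))\<^sup>2"] assms(2,3) by blast+
  have "\<phi> T = (\<Sum>n. cinner (x (e n)) (T (y (e n))))" for T :: "'p op"
  proof -
    have "\<phi> T = (\<Sum>\<^sub>\<infinity>n. cinner (x (e n)) (T (y (e n))))"
      unfolding assms(4) using infsum_reindex_bij_betw[OF e, of "\<lambda>j. cinner (x j) (T (y j))"] by (rule sym)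
    moreover have "(\<lambda>n. cinner (x (e n)) (T (y (e n)))) summable_on UNIV"
      by (rule abs_summable_summable[OF abs_summable_functional[OF sum]])
    ultimately show ?thesis
      by (simp add: sums_unique[OF has_sum_imp_sums[OF has_sum_infsum]])
  qed
  then show ?thesis
    unfolding weak_star_functional_def
    by (intro exI[of _ "x \<circ> e"] exI[of _ "y \<circ> e"])
      (simp add: fun_eq_iff summable_on_imp_summable[OF sum(1)] summable_on_imp_summable[OF sum(2)])
qed

lemma topspace_weak_star: "topspace weak_star = bounded_ops"
proof -
  have "weak_star_functional (\<lambda>_. 0 :: complex)"
    unfolding weak_star_functional_def
    by (intro exI[of _ "\<lambda>_. 0"] exI[of _ "\<lambda>_. 0"]) (auto simp: cinner_def zero_ell2.rep_eq)
  then have "bounded_ops = {T \<in> bounded_ops. (0::complex) \<in> UNIV} \<and> weak_star_functional (\<lambda>_ :: 'a op. 0 :: complex) \<and> open (UNIV :: complex set)"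
    by auto
  then show ?thesis
    unfolding weak_star_def topology_generated_by_topspace by blast
qed

lemma openin_weak_star: "weak_star_functional \<phi> \<Longrightarrow> open U \<Longrightarrow> openin weak_star {T \<in> bounded_ops. \<phi> T \<in> U}"
  unfolding weak_star_def openin_topology_generated_by_iff
  by (rule generate_topology_on.Basis) blast

lemma continuous_weak_star_functional:
  assumes "weak_star_functional \<phi>" "M \<subseteq> bounded_ops"
  shows "continuous_map (subtopology weak_star M) euclidean \<phi>"
  unfolding continuous_map
proof (intro conjI allI impI)
  fix U :: "complex set" assume "openin euclidean U"
  then have "openin weak_star {T \<in> bounded_ops. \<phi> T \<in> U}"
    by (intro openin_weak_star assms) simp
  moreover have "{T \<in> topspace (subtopology weak_star M). \<phi> T \<in> U} = {T \<in> bounded_ops. \<phi> T \<in> U} \<inter> M"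
    by (auto simp: topspace_weak_star)
  ultimately show "openin (subtopology weak_star M) {T \<in> topspace (subtopology weak_star M). \<phi> T \<in> U}"
    by (auto simp: openin_subtopology)
qed auto

lemma continuous_weak_star_map:
  fixes G :: "'p op \<Rightarrow> 'p op"
  assumes "M \<subseteq> bounded_ops" "G ` M \<subseteq> bounded_ops"
    and "\<And>\<phi>. weak_star_functional \<phi> \<Longrightarrow> \<exists>\<psi>. weak_star_functional \<psi> \<and> (\<forall>T\<in>M. \<phi> (G T) = \<psi> T)"
  shows "continuous_map (subtopology weak_star M) weak_star G"
proof -
  let ?S = "{{T \<in> bounded_ops. \<phi> T \<in> U} | (\<phi> :: 'p op \<Rightarrow> complex) U. weak_star_functional \<phi> \<and> open U}"
  have top: "topspace (subtopology weak_star M) = M"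
    using assms(1) by (auto simp: topspace_weak_star)
  have "continuous_map (subtopology weak_star M) (topology_generated_by ?S) G"
  proof (rule continuous_on_generated_topo)
    have "\<Union>?S = bounded_ops"
      using topspace_weak_star by (simp only: weak_star_def topology_generated_by_topspace)
    then show "G ` topspace (subtopology weak_star M) \<subseteq> \<Union>?S"
      using assms(2) by (simp only: top)
    fix V assume "V \<in> ?S"
    then obtain \<phi> U where V: "V = {T \<in> bounded_ops. \<phi> T \<in> U}" "weak_star_functional \<phi>" "open U" by blast
    then obtain \<psi> where \<psi>: "weak_star_functional \<psi>" "\<forall>T\<in>M. \<phi> (G T) = \<psi> T"
      using assms(3) by blast
    have "G -` V \<inter> M = {T \<in> bounded_ops. \<psi> T \<in> U} \<inter> M"
      using \<psi>(2) assms(1,2) by (auto simp: V)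
    then show "openin (subtopology weak_star M) (G -` V \<inter> topspace (subtopology weak_star M))"
      unfolding top openin_subtopology using openin_weak_star[OF \<psi>(1) V(3)] by blast
  qed
  then show ?thesis by (simp only: weak_star_def)
qed

text \<open>Convergence against a functional means eventual membership in its subbasic
  neighbourhoods. Induction on the generation of open sets carries eventual membership through
  finite intersections and arbitrary unions.\<close>

lemma in_closure_weak_star:
  assumes T: "T \<in> bounded_ops" and X: "\<And>n. X n \<in> bounded_ops \<and> X n \<in> A"
    and lim: "\<And>\<phi>. weak_star_functional \<phi> \<Longrightarrow> (\<lambda>n. \<phi> (X n)) \<longlonglongrightarrow> \<phi> T"
  shows "T \<in> weak_star closure_of A"
  unfolding in_closure_of
proof (intro conjI allI impI)
  show "T \<in> topspace weak_star" by (simp add: topspace_weak_star T)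
  fix V assume V: "T \<in> V \<and> openin weak_star V"
  have "\<forall>\<^sub>F n in sequentially. X n \<in> V"
    if "generate_topology_on {{T \<in> bounded_ops. \<phi> T \<in> U} | \<phi> U. weak_star_functional \<phi> \<and> open U} V" "T \<in> V" for V
    using that
  proof (induction rule: generate_topology_on.induct)
    case (Int a b)
    then show ?case by (auto intro: eventually_elim2)
  next
    case (UN K)
    then obtain k where "k \<in> K" "T \<in> k" by blast
    then show ?case using UN.IH[of k] by (auto elim: eventually_mono)
  next
    case (Basis s)
    then obtain \<phi> U where s: "s = {T \<in> bounded_ops. \<phi> T \<in> U}" "weak_star_functional \<phi>" "open U" by blast
    have "\<forall>\<^sub>F n in sequentially. \<phi> (X n) \<in> U"
      by (rule topological_tendstoD[OF lim[OF s(2)] s(3)]) (use Basis s in auto)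
    then show ?case by (rule eventually_mono) (use X s in auto)
  qed auto
  then have "\<forall>\<^sub>F n in sequentially. X n \<in> V"
    using V by (simp add: weak_star_def openin_topology_generated_by_iff)
  then show "\<exists>y. y \<in> A \<and> y \<in> V"
    using X by (auto simp: eventually_sequentially)
qed

section \<open>Traces on block algebras\<close>

locale weighted_grid = grid idx cpy pt
  for idx :: "'p \<Rightarrow> 'i::countable" and cpy :: "'p \<Rightarrow> 'c" and pt +
  fixes w :: "'i \<Rightarrow> real" and c0 :: 'c
  assumes w_pos: "\<And>a. w a > 0" and w_sum: "(w has_sum 1) UNIV" and inf: "infinite (UNIV :: 'i set)"
begin

text \<open>In a block algebra all copies carry the same entries, so the diagonal is read at the
  single copy \<open>c0\<close>; summing over copies would count the same entries
  repeatedly.\<close>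

definition tr :: "'p op \<Rightarrow> complex" where
  "tr T = (\<Sum>\<^sub>\<infinity>a. w a * coef T (pt a c0) (pt a c0))"

lemma tr_weak_star: "weak_star_functional tr"
proof -
  let ?x = "\<lambda>a. sqrt (w a) *\<^sub>R ket (pt a c0)"
  have sum: "(\<lambda>a. (norm (?x a))\<^sup>2) summable_on UNIV"
    using has_sum_imp_summable[OF w_sum] less_imp_le[OF w_pos] by (simp_all add: power_mult_distrib)
  have "cinner (?x a) (T (?x a)) = complex_of_real (w a) * coef T (pt a c0) (pt a c0)" for T :: "'p op" and a
    using less_imp_le[OF w_pos[of a]]
    by (simp add: coef_eq_cinner blinfun.scaleR_right cinner_scaleR_left cinner_scaleR_right
        flip: of_real_mult mult.assoc)
  then have tr: "tr T = (\<Sum>\<^sub>\<infinity>a. cinner (?x a) (T (?x a)))" for T :: "'p op"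
    by (simp add: tr_def)
  show ?thesis
    by (rule weak_star_functionalI[OF inf sum sum tr])
qed

lemma tr_has_sum: "((\<lambda>a. w a * coef T (pt a c0) (pt a c0)) has_sum tr T) UNIV"
proof -
  have "(\<lambda>a. norm (w a * coef T (pt a c0) (pt a c0))) summable_on UNIV"
  proof (rule summable_on_comparison_test)
    show "(\<lambda>a. w a * norm T) summable_on UNIV"
      by (intro summable_on_cmult_left has_sum_imp_summable[OF w_sum])
    show "norm (w a * coef T (pt a c0) (pt a c0)) \<le> w a * norm T" for a
      using less_imp_le[OF w_pos[of a]] by (auto simp: norm_mult intro: mult_left_mono cmod_coef_le)
  qed auto
  then show ?thesis
    unfolding tr_def by (rule has_sum_infsum[OF abs_summable_summable])
qed

lemma tr_eqI: "((\<lambda>a. w a * coef T (pt a c0) (pt a c0)) has_sum s) UNIV \<Longrightarrow> tr T = s"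
  by (rule has_sum_unique[OF tr_has_sum])

lemma tr_plus: "tr (S + T) = tr S + tr T"
  using has_sum_add[OF tr_has_sum[of S] tr_has_sum[of T]] by (intro tr_eqI) (simp add: algebra_simps)

lemma tr_scaleC: "tr (scaleC_op c T) = c * tr T"
  using has_sum_cmult_right[OF tr_has_sum[of T], of c] by (intro tr_eqI) (simp add: algebra_simps)

lemma tr_id: "tr id_blinfun = 1"
  using has_sum_of_real[OF w_sum, where 'a = complex] by (intro tr_eqI) simp

lemma tr_normal: "M \<subseteq> bounded_ops \<Longrightarrow> normal_functional_on M tr"
  by (simp add: normal_functional_on_def clinear_functional_on_def tr_plus tr_scaleC
      continuous_weak_star_functional tr_weak_star)

lemma Re_tr_has_sum: "((\<lambda>a. w a * Re (coef T (pt a c0) (pt a c0))) has_sum Re (tr T)) UNIV"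
  using has_sum_Re[OF tr_has_sum[of T]] by simp

lemma positive_coef:
  assumes "positive_op T"
  shows "coef T p p = of_real (Re (coef T p p))" "Re (coef T p p) \<ge> 0"
  using assms by (auto simp: positive_op_def coef_eq_cinner complex_nonneg_Reals_iff complex_eq_iff)

lemma tr_positive:
  assumes "positive_op T"
  shows "tr T = of_real (Re (tr T))" "Re (tr T) \<ge> 0"
proof -
  have "((\<lambda>a. w a * Im (coef T (pt a c0) (pt a c0))) has_sum Im (tr T)) UNIV"
    using has_sum_Im[OF tr_has_sum[of T]] by simp
  moreover have "Im (coef T p p) = 0" for p
    using positive_coef(1)[OF assms, of p] by (metis Im_complex_of_real)
  ultimately have "Im (tr T) = 0"
    by (metis (no_types, lifting) has_sum_0 has_sum_unique mult_zero_right)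
  then show "tr T = of_real (Re (tr T))" by (simp add: complex_eq_iff)
  show "Re (tr T) \<ge> 0"
    by (rule has_sum_nonneg[OF Re_tr_has_sum]) (use positive_coef(2)[OF assms] less_imp_le[OF w_pos] in auto)
qed

text \<open>Both traces are the double sum of \<open>w a * (s a b * t b a)\<close> over pairs in a
  common class, because \<open>w\<close> is constant on classes. The interchange of summations is
  justified by |s t| <= |s|^2 + |t|^2: rows of \<open>S\<close> (columns of its adjoint) and columns
  of \<open>T\<close> are square summable with bounds independent of the index, and \<open>w\<close>
  is summable.\<close>

lemma tr_commute:
  assumes S: "S \<in> block_alg \<rho>" and T: "T \<in> block_alg \<rho>" and fin: "\<And>r. finite {a. \<rho> a = r}"
    and w: "\<And>a b. \<rho> a = \<rho> b \<Longrightarrow> w a = w b"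
  shows "tr (S o\<^sub>L T) = tr (T o\<^sub>L S)"
proof -
  define s where "s a b = coef S (pt a c0) (pt b c0)" for a b
  define t where "t a b = coef T (pt a c0) (pt b c0)" for a b
  define f where "f a b = (if \<rho> a = \<rho> b then w a * (s a b * t b a) else 0)" for a b
  note Sb = block_algD(1)[OF S] and Tb = block_algD(1)[OF T]
  have col: "(\<Sum>b\<in>B. (cmod (coef R (pt b c0) (pt a c0)))\<^sup>2) \<le> (norm R)\<^sup>2"
    if "finite B" for a B and R :: "'p op"
  proof -
    have "(\<Sum>b\<in>B. (cmod (coef R (pt b c0) (pt a c0)))\<^sup>2) =
        (\<Sum>p\<in>(\<lambda>b. pt b c0) ` B. (cmod (ell2_nth (R (ket (pt a c0))) p))\<^sup>2)"
      by (subst sum.reindex) (auto simp: inj_on_def coef_def)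
    also have "\<dots> \<le> (norm (R (ket (pt a c0))))\<^sup>2"
      by (rule sum_le_norm_ell2) (use that in simp)
    also have "\<dots> \<le> (norm R)\<^sup>2"
      using norm_blinfun[of R "ket (pt a c0)"] by (intro power_mono) auto
    finally show ?thesis .
  qed
  have fsum: "((\<lambda>b. f a b) has_sum (\<Sum>b | \<rho> b = \<rho> a. f a b)) UNIV" for a
    by (rule has_sum_finite_neutralI[OF fin[of "\<rho> a"]]) (auto simp: f_def)
  have fsum': "((\<lambda>a. f a b) has_sum (\<Sum>a | \<rho> a = \<rho> b. f a b)) UNIV" for b
    by (rule has_sum_finite_neutralI[OF fin[of "\<rho> b"]]) (auto simp: f_def)
  have "(\<lambda>p. norm (f (fst p) (snd p))) summable_on (UNIV \<times> UNIV)"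
  proof (rule summable_on_SigmaI)
    show "((\<lambda>b. norm (f (fst (a, b)) (snd (a, b)))) has_sum (\<Sum>b | \<rho> b = \<rho> a. norm (f a b))) UNIV" for a
      by (rule has_sum_finite_neutralI[OF fin[of "\<rho> a"]]) (auto simp: f_def)
    show "(\<lambda>a. \<Sum>b | \<rho> b = \<rho> a. norm (f a b)) summable_on UNIV"
    proof (rule summable_on_comparison_test)
      show "(\<lambda>a. w a * ((norm (adj S))\<^sup>2 + (norm T)\<^sup>2)) summable_on UNIV"
        by (intro summable_on_cmult_left has_sum_imp_summable[OF w_sum])
      fix a
      have "(\<Sum>b | \<rho> b = \<rho> a. norm (f a b)) \<le>
          (\<Sum>b | \<rho> b = \<rho> a. w a * ((cmod (coef (adj S) (pt b c0) (pt a c0)))\<^sup>2 + (cmod (t b a))\<^sup>2))"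
      proof (rule sum_mono)
        fix b
        have "cmod (s a b) * cmod (t b a) \<le> (cmod (s a b))\<^sup>2 + (cmod (t b a))\<^sup>2"
          using zero_le_power2[of "cmod (s a b) - cmod (t b a)"]
            mult_nonneg_nonneg[OF norm_ge_zero[of "s a b"] norm_ge_zero[of "t b a"]]
          by (simp add: power2_diff del: mult_nonneg_nonneg)
        then show "norm (f a b) \<le> w a * ((cmod (coef (adj S) (pt b c0) (pt a c0)))\<^sup>2 + (cmod (t b a))\<^sup>2)"
          using less_imp_le[OF w_pos[of a]]
          by (auto simp: f_def norm_mult coef_adj[OF Sb] s_def intro!: mult_left_mono)
      qed
      also have "\<dots> \<le> w a * ((norm (adj S))\<^sup>2 + (norm T)\<^sup>2)"
        unfolding sum_distrib_left[symmetric] sum.distrib t_def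
        by (intro mult_left_mono add_mono col fin less_imp_le[OF w_pos])
      finally show "(\<Sum>b | \<rho> b = \<rho> a. norm (f a b)) \<le> w a * ((norm (adj S))\<^sup>2 + (norm T)\<^sup>2)" .
    qed (auto intro: sum_nonneg)
  qed auto
  then have "(\<lambda>(a, b). f a b) summable_on (UNIV \<times> UNIV)"
    by (simp add: case_prod_unfold abs_summable_summable)
  from infsum_swap_banach[OF this]
  have "(\<Sum>\<^sub>\<infinity>a. \<Sum>b | \<rho> b = \<rho> a. f a b) = (\<Sum>\<^sub>\<infinity>b. \<Sum>a | \<rho> a = \<rho> b. f a b)"
    by (simp add: infsumI[OF fsum] infsumI[OF fsum'])
  moreover have "w a * coef (S o\<^sub>L T) (pt a c0) (pt a c0) = (\<Sum>b | \<rho> b = \<rho> a. f a b)" for a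
    by (subst block_alg_compose_coef[OF S T fin]) (auto simp: f_def sum_distrib_left s_def t_def intro!: sum.cong)
  moreover have "w b * coef (T o\<^sub>L S) (pt b c0) (pt b c0) = (\<Sum>a | \<rho> a = \<rho> b. f a b)" for b
    by (subst block_alg_compose_coef[OF T S fin])
      (auto simp: f_def sum_distrib_left s_def t_def mult_ac dest: w intro!: sum.cong)
  ultimately show ?thesis
    by (simp add: tr_def)
qed

text \<open>The diagonal of \<open>adj T o\<^sub>L T\<close> consists of the squared norms of the
  columns of \<open>T\<close>. A vanishing trace kills the columns at copy \<open>c0\<close>, and
  copy independence carries this to all other columns.\<close>

lemma tr_faithful:
  assumes T: "T \<in> block_alg \<rho>" and "tr (adj T o\<^sub>L T) = 0"
  shows "T = 0"
proof (rule op_eqI)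
  note Tb = block_algD(1)[OF T]
  show "T \<in> bounded_ops" "0 \<in> bounded_ops" using Tb by auto
  have diag: "coef (adj T o\<^sub>L T) p p = (norm (T (ket p)))\<^sup>2" for p
    by (simp add: coef_eq_cinner cinner_adj_right[OF Tb] cinner_self)
  have "w a * (norm (T (ket (pt a c0))))\<^sup>2 = 0" for a
  proof (rule nonneg_infsum_le_0D[of _ UNIV a])
    have "((\<lambda>a. w a * (norm (T (ket (pt a c0))))\<^sup>2) has_sum 0) UNIV"
      using Re_tr_has_sum[of "adj T o\<^sub>L T"] assms(2) unfolding diag by simp
    then show "(\<Sum>\<^sub>\<infinity>a. w a * (norm (T (ket (pt a c0))))\<^sup>2) \<le> 0"
      "(\<lambda>a. w a * (norm (T (ket (pt a c0))))\<^sup>2) summable_on UNIV"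
      by (auto dest: infsumI has_sum_imp_summable)
  qed (use less_imp_le[OF w_pos] in auto)
  then have "T (ket (pt a c0)) = 0" for a
    using w_pos[of a] by (metis less_irrefl mult_eq_0_iff norm_eq_zero power_eq_0_iff)
  then have zero: "coef T p (pt a c0) = 0" for a p
    by (simp add: coef_def zero_ell2.rep_eq)
  show "coef T p q = coef 0 p q" for p q
    by (subst coef_block_alg[OF T, of _ _ c0]) (simp add: zero)
qed

lemma finite_vn_block_alg:
  assumes fin: "\<And>r. finite {a. \<rho> a = r}" and w: "\<And>a b. \<rho> a = \<rho> b \<Longrightarrow> w a = w b"
  shows "finite_von_neumann_algebra (block_alg \<rho>) tr"
  unfolding finite_von_neumann_algebra_def normal_faithful_tracial_state_def
proof (intro conjI ballI impI)
  show "tr T \<in> \<real>\<^sub>\<ge>\<^sub>0" if "positive_op T" for T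
    using tr_positive[OF that] by (metis nonneg_Reals_of_real_iff)
  show "tr (S o\<^sub>L T) = tr (T o\<^sub>L S)" if "S \<in> block_alg \<rho>" "T \<in> block_alg \<rho>" for S T
    by (rule tr_commute[OF that fin w])
  show "T = 0" if "T \<in> block_alg \<rho>" "tr (adj T o\<^sub>L T) = 0" for T
    by (rule tr_faithful[OF that])
qed (rule von_neumann_block_alg[OF fin] tr_normal[OF block_alg_bounded] tr_id)+

end

section \<open>Product weights and product traces\<close>

lemma has_sum_product_abs:
  fixes f :: "'x \<Rightarrow> 'b::{real_normed_field,banach}"
    and g :: "'y \<Rightarrow> 'b"
  assumes f: "(f has_sum s) UNIV" "(\<lambda>a. norm (f a)) summable_on UNIV" and g: "(g has_sum t) UNIV" "(\<lambda>a. norm (g a)) summable_on UNIV"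
  shows "((\<lambda>a. f (fst a) * g (snd a)) has_sum (s * t)) (UNIV :: ('x \<times> 'y) set)"
proof -
  have "(\<lambda>a. norm (f (fst a) * g (snd a))) summable_on (UNIV \<times> (UNIV :: 'y set))"
  proof (rule summable_on_SigmaI)
    show "((\<lambda>b. norm (f (fst (a, b)) * g (snd (a, b)))) has_sum (norm (f a) * (\<Sum>\<^sub>\<infinity>b. norm (g b)))) UNIV" for a
      using has_sum_cmult_right[OF has_sum_infsum[OF g(2)], of "norm (f a)"] by (simp add: norm_mult)
    show "(\<lambda>a. norm (f a) * (\<Sum>\<^sub>\<infinity>b. norm (g b))) summable_on UNIV"
      by (intro summable_on_cmult_left f)
  qed auto
  from abs_summable_summable[OF this]
  have "((\<lambda>a. f (fst a) * g (snd a)) has_sum (s * t)) (UNIV \<times> (UNIV :: 'y set))"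
    by (rule has_sum_SigmaI[where g = "\<lambda>a. f a * t", rotated -1])
      (auto intro: has_sum_cmult_right has_sum_cmult_left f g)
  then show ?thesis by simp
qed

locale weighted_grid_product =
  A: weighted_grid idx1 cpy1 pt1 w1 c1 + B: weighted_grid idx2 cpy2 pt2 w2 c2
  for idx1 :: "'p1 \<Rightarrow> 'i1::countable" and cpy1 :: "'p1 \<Rightarrow> 'c1" and pt1 w1 c1
    and idx2 :: "'p2 \<Rightarrow> 'i2::countable" and cpy2 :: "'p2 \<Rightarrow> 'c2" and pt2 w2 c2
begin

sublocale grid_product idx1 cpy1 pt1 idx2 cpy2 pt2 ..

sublocale P: weighted_grid "map_prod idx1 idx2" "map_prod cpy1 cpy2"
    "\<lambda>a c. (pt1 (fst a) (fst c), pt2 (snd a) (snd c))" "\<lambda>a. w1 (fst a) * w2 (snd a)" "(c1, c2)"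
proof
  show "w1 (fst a) * w2 (snd a) > 0" for a
    by (simp add: A.w_pos B.w_pos)
  show "((\<lambda>a. w1 (fst a) * w2 (snd a)) has_sum 1) UNIV"
    using has_sum_product_abs[OF A.w_sum _ B.w_sum]
      has_sum_imp_summable[OF A.w_sum] has_sum_imp_summable[OF B.w_sum]
    by (simp add: less_imp_le A.w_pos B.w_pos)
  show "infinite (UNIV :: ('i1 \<times> 'i2) set)"
    using A.inf by (simp add: finite_prod)
qed

lemma tensor_functional_tr:
  assumes fin: "\<And>r. finite {a. \<rho>1 a = r}" "\<And>r. finite {a. \<rho>2 a = r}"
  shows "tensor_functional (A.block_alg \<rho>1) A.tr (B.block_alg \<rho>2) B.tr P.tr"
  unfolding tensor_functional_def vn_tensor_block_alg[OF fin]
proof (intro conjI ballI)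
  show "normal_functional_on (P.block_alg (map_prod \<rho>1 \<rho>2)) P.tr"
    by (rule P.tr_normal[OF P.block_alg_bounded])
  fix S T assume "S \<in> A.block_alg \<rho>1" "T \<in> B.block_alg \<rho>2"
  note b = A.block_algD(1)[OF this(1)] B.block_algD(1)[OF this(2)]
  have "(\<lambda>a. norm (w1 a * coef S (pt1 a c1) (pt1 a c1))) summable_on UNIV"
    "(\<lambda>a. norm (w2 a * coef T (pt2 a c2) (pt2 a c2))) summable_on UNIV"
    by (rule summable_on_iff_abs_summable_on_complex[THEN iffD1],
        rule has_sum_imp_summable, rule A.tr_has_sum B.tr_has_sum)+
  from has_sum_product_abs[OF A.tr_has_sum this(1) B.tr_has_sum this(2)]
  show "P.tr (S \<otimes>\<^sub>o T) = A.tr S * B.tr T"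
    by (intro P.tr_eqI) (simp add: coef_tensor_op[OF b] mult_ac)
qed

end

section \<open>Pinchings\<close>

context grid
begin

text \<open>This is the sum of Q_r T Q_r over all classes r, with Q_r the cut to the class. A
  coordinate p belongs to one class only, so the coordinatewise formula has a single summand and
  avoids convergence of operators.\<close>

definition pinch :: "('i \<Rightarrow> 'i) \<Rightarrow> 'p op \<Rightarrow> 'p op" where
  "pinch \<sigma> T = op_of (\<lambda>x p. ell2_nth (T (cut (cls \<sigma> (\<sigma> (idx p))) x)) p)"

lemma has_sum_classes:
  fixes f :: "'p \<Rightarrow> 'b::{topological_comm_monoid_add,t3_space}"
  assumes "(f has_sum s) UNIV" "\<And>r. (f has_sum g r) (cls \<sigma> r)"
  shows "(g has_sum s) UNIV"
proof (rule has_sum_SigmaD)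
  let ?h = "\<lambda>p. (\<sigma> (idx p), p)"
  have "?h ` UNIV = Sigma UNIV (cls \<sigma>)" by (auto simp: cls_def)
  moreover have "(((\<lambda>x. f (snd x)) \<circ> ?h) has_sum s) UNIV"
    using assms(1) by (simp add: o_def)
  ultimately show "((\<lambda>x. f (snd x)) has_sum s) (Sigma UNIV (cls \<sigma>))"
    using has_sum_reindex[of ?h UNIV "\<lambda>x. f (snd x)" s] by (simp add: inj_on_def)
qed (use assms(2) in simp)

lemma has_sum_norm_classes: "((\<lambda>r. (norm (cut (cls \<sigma> r) x))\<^sup>2) has_sum (norm x)\<^sup>2) UNIV"
proof (rule has_sum_classes)
  show "((\<lambda>p. (cmod (ell2_nth x p))\<^sup>2) has_sum (norm x)\<^sup>2) UNIV"
    unfolding norm_ell2_square by (rule has_sum_infsum[OF ell2_summable])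
qed (rule has_sum_norm_cut)

lemma sum_norm_classes_le: "finite R \<Longrightarrow> (\<Sum>r\<in>R. (norm (cut (cls \<sigma> r) x))\<^sup>2) \<le> (norm x)\<^sup>2"
  by (metis (mono_tags, lifting) finite_sum_le_infsum has_sum_imp_summable has_sum_norm_classes infsumI
      subset_UNIV zero_le_power2)

lemma pinch_le:
  fixes T :: "'p op"
  assumes F: "finite F"
  shows "(\<Sum>p\<in>F. (cmod (ell2_nth (T (cut (cls \<sigma> (\<sigma> (idx p))) x)) p))\<^sup>2) \<le> (norm T * norm x)\<^sup>2"
proof -
  let ?R = "(\<lambda>p. \<sigma> (idx p)) ` F"
  have "(\<Sum>p\<in>F. (cmod (ell2_nth (T (cut (cls \<sigma> (\<sigma> (idx p))) x)) p))\<^sup>2) =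
      (\<Sum>r\<in>?R. \<Sum>p | p \<in> F \<and> \<sigma> (idx p) = r. (cmod (ell2_nth (T (cut (cls \<sigma> (\<sigma> (idx p))) x)) p))\<^sup>2)"
    by (rule sum.image_gen[OF F])
  also have "\<dots> = (\<Sum>r\<in>?R. \<Sum>p | p \<in> F \<and> \<sigma> (idx p) = r. (cmod (ell2_nth (T (cut (cls \<sigma> r) x)) p))\<^sup>2)"
    by (intro sum.cong) auto
  also have "\<dots> \<le> (\<Sum>r\<in>?R. (norm (T (cut (cls \<sigma> r) x)))\<^sup>2)"
    by (intro sum_mono sum_le_norm_ell2) (use F in auto)
  also have "\<dots> \<le> (\<Sum>r\<in>?R. (norm T)\<^sup>2 * (norm (cut (cls \<sigma> r) x))\<^sup>2)"
    unfolding power_mult_distrib[symmetric] by (intro sum_mono power_mono norm_blinfun) auto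
  also have "\<dots> \<le> (norm T)\<^sup>2 * (norm x)\<^sup>2"
    unfolding sum_distrib_left[symmetric] using F by (intro mult_left_mono sum_norm_classes_le) auto
  finally show ?thesis by (simp add: power_mult_distrib)
qed

lemma
  assumes T: "T \<in> bounded_ops"
  shows nth_pinch: "ell2_nth (pinch \<sigma> T x) p = ell2_nth (T (cut (cls \<sigma> (\<sigma> (idx p))) x)) p"
    and pinch_bounded: "pinch \<sigma> T \<in> bounded_ops"
proof -
  let ?f = "\<lambda>x p. ell2_nth (T (cut (cls \<sigma> (\<sigma> (idx p))) x)) p"
  have *: "?f (x + y) p = ?f x p + ?f y p" "?f (c *\<^sub>C x) p = c * ?f x p" for x y c p
    by (simp_all add: blinfun.add_right plus_ell2.rep_eq bounded_opsD[OF T] bounded_opsD[OF cut_bounded]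
        scaleC_ell2.rep_eq)
  show "ell2_nth (pinch \<sigma> T x) p = ?f x p" unfolding pinch_def
    by (rule op_of(1)[where f = ?f, OF * pinch_le]) auto
  show "pinch \<sigma> T \<in> bounded_ops" unfolding pinch_def
    by (rule op_of(2)[where f = ?f, OF * pinch_le]) auto
qed

lemma norm_pinch_le: "T \<in> bounded_ops \<Longrightarrow> norm (pinch \<sigma> T x) \<le> norm T * norm x"
  by (rule norm_ell2_leI) (auto simp: nth_pinch intro: pinch_le)

lemma coef_pinch:
  "T \<in> bounded_ops \<Longrightarrow> coef (pinch \<sigma> T) p q = (if \<sigma> (idx p) = \<sigma> (idx q) then coef T p q else 0)"
  by (simp add: coef_def nth_pinch cut_ket cls_def zero_ell2.rep_eq)

lemma has_sum_cinner_pinch: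
  assumes "T \<in> bounded_ops"
  shows "((\<lambda>r. cinner (cut (cls \<sigma> r) x) (T (cut (cls \<sigma> r) y))) has_sum cinner x (pinch \<sigma> T y)) UNIV"
proof (rule has_sum_classes[OF has_sum_cinner])
  show "((\<lambda>p. cnj (ell2_nth x p) * ell2_nth (pinch \<sigma> T y) p) has_sum
      cinner (cut (cls \<sigma> r) x) (T (cut (cls \<sigma> r) y))) (cls \<sigma> r)" for r
    using has_sum_cinner_cut[of x "T (cut (cls \<sigma> r) y)" "cls \<sigma> r"]
    by (rule has_sum_cong[THEN iffD1, rotated]) (simp add: nth_pinch[OF assms] cls_def)
qed

lemma positive_pinch:
  assumes "positive_op T"
  shows "positive_op (pinch \<sigma> T)"
  unfolding positive_op_def
proof (intro conjI allI)
  have T: "T \<in> bounded_ops" using assms by (simp add: positive_op_def)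
  then show "pinch \<sigma> T \<in> bounded_ops" by (rule pinch_bounded)
  fix x
  note s = has_sum_cinner_pinch[OF T, of \<sigma> x x]
  have pos: "Re (cinner z (T z)) \<ge> 0" "Im (cinner z (T z)) = 0" for z
    using assms by (auto simp: positive_op_def complex_nonneg_Reals_iff)
  have "Re (cinner x (pinch \<sigma> T x)) \<ge> 0"
    by (rule has_sum_nonneg[OF has_sum_Re[OF s]]) (rule pos)
  moreover have "Im (cinner x (pinch \<sigma> T x)) = 0"
    by (rule has_sum_unique[OF has_sum_Im[OF s]]) (simp add: pos has_sum_0)
  ultimately show "cinner x (pinch \<sigma> T x) \<in> \<real>\<^sub>\<ge>\<^sub>0"
    by (simp add: complex_nonneg_Reals_iff)
qed

text \<open>The pre-adjoint of a pinching splits every vector of the functional into its class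
  components. By Pythagoras the new family, indexed by pairs (n, r), has the same sum of
  squares.\<close>

lemma weak_star_pinch:
  fixes \<phi> :: "'p op \<Rightarrow> complex"
  assumes "weak_star_functional \<phi>"
  shows "\<exists>\<psi>. weak_star_functional \<psi> \<and> (\<forall>T\<in>bounded_ops. \<phi> (pinch \<sigma> T) = \<psi> T)"
proof -
  obtain x y :: "nat \<Rightarrow> 'p ell2" where xy: "summable (\<lambda>n. (norm (x n))\<^sup>2)" "summable (\<lambda>n. (norm (y n))\<^sup>2)"
    and \<phi>: "\<phi> = (\<lambda>T. \<Sum>n. cinner (x n) (T (y n)))"
    using assms unfolding weak_star_functional_def by blast
  define c where "c z a = cut (cls \<sigma> (snd a)) (z (fst a))" for z :: "nat \<Rightarrow> 'p ell2" and a :: "nat \<times> 'i"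
  have sum: "(\<lambda>a. (norm (c z a))\<^sup>2) summable_on UNIV" if "summable (\<lambda>n. (norm (z n))\<^sup>2)" for z
  proof -
    have "(\<lambda>a. (norm (c z a))\<^sup>2) summable_on (UNIV \<times> UNIV)"
    proof (rule summable_on_SigmaI)
      show "((\<lambda>r. (norm (c z (n, r)))\<^sup>2) has_sum (norm (z n))\<^sup>2) UNIV" for n
        unfolding c_def using has_sum_norm_classes[of \<sigma> "z n"] by simp
      show "(\<lambda>n. (norm (z n))\<^sup>2) summable_on UNIV"
        using that by (subst summable_on_UNIV_nonneg_real_iff) auto
    qed auto
    then show ?thesis by simp
  qed
  define \<psi> where "\<psi> T = (\<Sum>\<^sub>\<infinity>a. cinner (c x a) (T (c y a)))" for T :: "'p op"
  have "weak_star_functional \<psi>"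
    by (rule weak_star_functionalI[OF _ sum[OF xy(1)] sum[OF xy(2)] \<psi>_def]) (simp add: finite_prod)
  moreover have "\<phi> (pinch \<sigma> T) = \<psi> T" if T: "T \<in> bounded_ops" for T
  proof -
    have "((\<lambda>a. cinner (c x a) (T (c y a))) has_sum \<psi> T) (UNIV \<times> UNIV)"
      unfolding \<psi>_def UNIV_Times_UNIV
      by (rule has_sum_infsum[OF abs_summable_summable[OF abs_summable_functional[OF sum[OF xy(1)] sum[OF xy(2)]]]])
    from has_sum_SigmaD[OF this, of "\<lambda>n. cinner (x n) (pinch \<sigma> T (y n))"]
    have "((\<lambda>n. cinner (x n) (pinch \<sigma> T (y n))) has_sum \<psi> T) UNIV"
      using has_sum_cinner_pinch[OF T] by (simp add: c_def)
    from has_sum_imp_sums[OF this] show ?thesis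
      by (simp add: \<phi> sums_iff)
  qed
  ultimately show ?thesis by blast
qed

lemma pinch_block_alg:
  assumes T: "T \<in> block_alg \<rho>" and ref: "\<And>a b. \<sigma> a = \<sigma> b \<Longrightarrow> \<rho> a = \<rho> b"
  shows "pinch \<sigma> T \<in> block_alg \<sigma>"
proof -
  obtain t where t: "\<And>p q. coef T p q = (if cpy p = cpy q \<and> \<rho> (idx p) = \<rho> (idx q) then t (idx p) (idx q) else 0)"
    by (rule block_algE[OF T]) blast
  show ?thesis
    by (rule block_algI[where t = t, OF pinch_bounded[OF block_algD(1)[OF T]]])
      (auto simp: coef_pinch[OF block_algD(1)[OF T]] t dest: ref)
qed

lemma pinch_id:
  assumes T: "T \<in> block_alg \<sigma>"
  shows "pinch \<sigma> T = T"
  using block_algD(1,3)[OF T] by (intro op_eqI) (auto simp: coef_pinch pinch_bounded)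

lemma cut_commute:
  assumes T: "T \<in> block_alg \<sigma>"
  shows "T (cut (cls \<sigma> r) x) = cut (cls \<sigma> r) (T x)"
proof -
  have "T o\<^sub>L cut (cls \<sigma> r) = cut (cls \<sigma> r) o\<^sub>L T"
  proof (rule op_eqI)
    fix p q
    show "coef (T o\<^sub>L cut (cls \<sigma> r)) p q = coef (cut (cls \<sigma> r) o\<^sub>L T) p q"
      by (cases "coef T p q = 0")
        (use block_algD(3)[OF T, of p q] in \<open>auto simp: coef_def cut_ket cls_def zero_ell2.rep_eq\<close>)
  qed (use block_algD(1)[OF T] in \<open>auto intro: bounded_ops_compose\<close>)
  then show ?thesis by (metis blinfun_apply_blinfun_compose)
qed

text \<open>\<open>S\<close> and \<open>R\<close> commute with every cut to a class, so they can be
  moved out of each summand of the pinching.\<close>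

lemma pinch_bimodule:
  assumes S: "S \<in> block_alg \<sigma>" and T: "T \<in> bounded_ops" and R: "R \<in> block_alg \<sigma>"
  shows "pinch \<sigma> (S o\<^sub>L T o\<^sub>L R) = S o\<^sub>L pinch \<sigma> T o\<^sub>L R"
proof (rule op_nth_eqI)
  fix x p
  let ?Q = "cut (cls \<sigma> (\<sigma> (idx p)))"
  have p: "ell2_nth y p = ell2_nth (?Q y) p" for y
    by (simp add: cls_def)
  have Q: "?Q (pinch \<sigma> T y) = ?Q (T (?Q y))" for y
    by (rule ell2_eqI) (auto simp: nth_pinch[OF T] cls_def)
  have "S o\<^sub>L T o\<^sub>L R \<in> bounded_ops"
    using block_algD(1)[OF S] block_algD(1)[OF R] T by (intro bounded_ops_compose)
  from nth_pinch[OF this, of \<sigma> x p]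
  have "ell2_nth (pinch \<sigma> (S o\<^sub>L T o\<^sub>L R) x) p = ell2_nth (?Q (S (T (?Q (R x))))) p"
    by (subst p[symmetric]) (simp add: cut_commute[OF R])
  also have "\<dots> = ell2_nth (S (pinch \<sigma> T (R x))) p"
    by (subst (2) p) (simp flip: cut_commute[OF S] add: Q)
  finally show "ell2_nth (pinch \<sigma> (S o\<^sub>L T o\<^sub>L R) x) p = ell2_nth ((S o\<^sub>L pinch \<sigma> T o\<^sub>L R) x) p"
    by simp
qed

lemma pinch_plus: "S \<in> bounded_ops \<Longrightarrow> T \<in> bounded_ops \<Longrightarrow> pinch \<sigma> (S + T) = pinch \<sigma> S + pinch \<sigma> T"
  by (rule op_eqI) (auto simp: coef_pinch pinch_bounded bounded_ops_plus)

lemma pinch_scaleC: "T \<in> bounded_ops \<Longrightarrow> pinch \<sigma> (scaleC_op c T) = scaleC_op c (pinch \<sigma> T)"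
  by (rule op_eqI) (auto simp: coef_pinch pinch_bounded scaleC_op_bounded)

lemma clinear_pinch: "clinear_map_on (block_alg \<rho>) (pinch \<sigma>)"
  by (simp add: clinear_map_on_def pinch_plus pinch_scaleC block_algD(1))

text \<open>On a basis vector the pinching is eventually exact, since \<open>\<sigma> n\<close> then
  no longer separates its \<open>\<rho>\<close>-class. Finitely supported vectors are dense, and all
  pinchings of \<open>T\<close> are bounded by \<open>norm T\<close>.\<close>

lemma tendsto_pinch:
  assumes T: "T \<in> block_alg \<rho>"
    and ev: "\<And>a. \<forall>\<^sub>F n in sequentially. \<forall>b. \<rho> b = \<rho> a \<longrightarrow> \<sigma> n b = \<sigma> n a"
  shows "(\<lambda>n. pinch (\<sigma> n) T x) \<longlonglongrightarrow> T x"
proof (rule tendstoI)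
  note Tb = block_algD(1)[OF T]
  fix e :: real assume "e > 0"
  \<comment> \<open>The two tails cost at most \<open>2 * norm T * d\<close>; the summand 1 keeps
    this strictly below \<open>e\<close>, and the denominator positive when
    \<open>T = 0\<close>.\<close>
  define d where "d = e / (2 * norm T + 1)"
  have pos: "2 * norm T + 1 > 0"
    using norm_ge_zero[of T] by linarith
  then have d0: "d > 0"
    unfolding d_def using \<open>e > 0\<close> by (rule divide_pos_pos[rotated])
  have "d * (2 * norm T + 1) = e"
    unfolding d_def using pos by (intro nonzero_eq_divide_eq[THEN iffD1]) auto
  then have "2 * norm T * d = e - d"
    by (simp add: algebra_simps)
  with d0 have d: "d > 0" "2 * norm T * d < e"
    by linarith+
  obtain F where F: "finite F" "norm (x - (\<Sum>k\<in>F. ell2_nth x k *\<^sub>C ket k)) < d"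
  proof -
    have "\<forall>\<^sub>F F in finite_subsets_at_top UNIV. dist (\<Sum>k\<in>F. ell2_nth x k *\<^sub>C ket k) x < d"
      using ell2_has_sum[of x] d(1) unfolding has_sum_def tendsto_iff by blast
    then obtain F where "finite F" "dist (\<Sum>k\<in>F. ell2_nth x k *\<^sub>C ket k) x < d"
      unfolding eventually_finite_subsets_at_top by blast
    then show ?thesis
      by (intro that[of F]) (simp_all add: dist_norm norm_minus_commute)
  qed
  let ?y = "\<Sum>k\<in>F. ell2_nth x k *\<^sub>C ket k"
  have "\<forall>\<^sub>F n in sequentially. \<forall>k\<in>F. \<forall>b. \<rho> b = \<rho> (idx k) \<longrightarrow> \<sigma> n b = \<sigma> n (idx k)"
    by (rule eventually_ball_finite[OF F(1)]) (use ev in blast)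
  then show "\<forall>\<^sub>F n in sequentially. dist (pinch (\<sigma> n) T x) (T x) < e"
  proof (rule eventually_mono)
    fix n assume n: "\<forall>k\<in>F. \<forall>b. \<rho> b = \<rho> (idx k) \<longrightarrow> \<sigma> n b = \<sigma> n (idx k)"
    have "pinch (\<sigma> n) T (ket k) = T (ket k)" if "k \<in> F" for k
    proof (rule ell2_eqI)
      fix p
      have "coef T p k = 0 \<or> \<sigma> n (idx p) = \<sigma> n (idx k)"
        using n that block_algD(3)[OF T, of p k] by blast
      then show "ell2_nth (pinch (\<sigma> n) T (ket k)) p = ell2_nth (T (ket k)) p"
        using coef_pinch[OF Tb, of "\<sigma> n" p k] by (auto simp: coef_def)
    qed
    then have "pinch (\<sigma> n) T ?y = T ?y"
      by (simp add: blinfun.sum_right bounded_opsD[OF Tb] bounded_opsD[OF pinch_bounded[OF Tb]])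
    then have "pinch (\<sigma> n) T x - T x = pinch (\<sigma> n) T (x - ?y) - T (x - ?y)"
      by (simp add: blinfun.diff_right)
    then have "dist (pinch (\<sigma> n) T x) (T x) \<le> norm (pinch (\<sigma> n) T (x - ?y)) + norm (T (x - ?y))"
      by (simp add: dist_norm norm_triangle_ineq4)
    also have "\<dots> \<le> norm T * norm (x - ?y) + norm T * norm (x - ?y)"
      by (intro add_mono norm_pinch_le[OF Tb] norm_blinfun)
    also have "\<dots> \<le> 2 * norm T * d"
      using mult_left_mono[OF less_imp_le[OF F(2)] norm_ge_zero[of T]] by simp
    finally show "dist (pinch (\<sigma> n) T x) (T x) < e" using d(2) by simp
  qed
qed

text \<open>For weak-* density, \<open>T\<close> is approximated by its own pinchings. They converge
  strongly, and Tannery's theorem passes to the series of a weak-* functional with majorant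
  \<open>norm T * (norm (x k) * norm (y k))\<close>.\<close>

lemma vn_filtration_block_alg:
  assumes fin: "\<And>n r. finite {a. \<sigma> n a = r}"
    and suc: "\<And>n a b. \<sigma> n a = \<sigma> n b \<Longrightarrow> \<sigma> (Suc n) a = \<sigma> (Suc n) b"
    and ref: "\<And>n a b. \<sigma> n a = \<sigma> n b \<Longrightarrow> \<rho> a = \<rho> b"
    and ev: "\<And>a. \<forall>\<^sub>F n in sequentially. \<forall>b. \<rho> b = \<rho> a \<longrightarrow> \<sigma> n b = \<sigma> n a"
  shows "vn_filtration (block_alg \<rho>) (\<lambda>n. block_alg (\<sigma> n))"
  unfolding vn_filtration_def
proof (intro conjI allI subsetI)
  show "von_neumann_algebra (block_alg (\<sigma> n))" for n by (rule von_neumann_block_alg[OF fin])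
  show "T \<in> block_alg \<rho>" if "T \<in> block_alg (\<sigma> n)" for T n
    by (rule subsetD[OF block_alg_mono that]) (rule ref)
  show "T \<in> block_alg (\<sigma> (Suc n))" if "T \<in> block_alg (\<sigma> n)" for T n
    by (rule subsetD[OF block_alg_mono that]) (rule suc)
next
  fix T assume T: "T \<in> block_alg \<rho>"
  note Tb = block_algD(1)[OF T]
  show "T \<in> weak_star closure_of (\<Union>n. block_alg (\<sigma> n))"
  proof (rule in_closure_weak_star[OF Tb])
    show "pinch (\<sigma> n) T \<in> bounded_ops \<and> pinch (\<sigma> n) T \<in> (\<Union>n. block_alg (\<sigma> n))" for n
    proof (intro conjI UN_I[of n])
      show "pinch (\<sigma> n) T \<in> block_alg (\<sigma> n)" by (rule pinch_block_alg[OF T]) (rule ref)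
    qed (simp_all add: pinch_bounded[OF Tb])
    fix \<phi> :: "'p op \<Rightarrow> complex" assume "weak_star_functional \<phi>"
    then obtain x y :: "nat \<Rightarrow> 'p ell2" where xy: "summable (\<lambda>n. (norm (x n))\<^sup>2)" "summable (\<lambda>n. (norm (y n))\<^sup>2)"
      and \<phi>: "\<phi> = (\<lambda>T. \<Sum>n. cinner (x n) (T (y n)))"
      unfolding weak_star_functional_def by blast
    show "(\<lambda>n. \<phi> (pinch (\<sigma> n) T)) \<longlonglongrightarrow> \<phi> T"
      unfolding \<phi>
    proof (rule tannerys_theorem[where a = "\<lambda>k n. cinner (x k) (pinch (\<sigma> n) T (y k))" and b = "\<lambda>k. cinner (x k) (T (y k))"
          and M = "\<lambda>k. norm T * (norm (x k) * norm (y k))", THEN conjunct2, THEN conjunct2])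
      show "((\<lambda>n. cinner (x k) (pinch (\<sigma> n) T (y k))) \<longlongrightarrow> cinner (x k) (T (y k))) sequentially" for k
        by (rule bounded_linear.tendsto[OF bounded_linear_cinner_right tendsto_pinch[OF T ev]])
      show "\<forall>\<^sub>F (k, n) in at_top \<times>\<^sub>F sequentially. norm (cinner (x k) (pinch (\<sigma> n) T (y k))) \<le>
          norm T * (norm (x k) * norm (y k))"
      proof (rule always_eventually, safe)
        fix k n
        have "norm (cinner (x k) (pinch (\<sigma> n) T (y k))) \<le> norm (x k) * norm (pinch (\<sigma> n) T (y k))"
          by (rule norm_cinner_le)
        also have "\<dots> \<le> norm (x k) * (norm T * norm (y k))"
          by (intro mult_left_mono norm_pinch_le[OF Tb]) auto
        finally show "norm (cinner (x k) (pinch (\<sigma> n) T (y k))) \<le> norm T * (norm (x k) * norm (y k))"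
          by (simp add: mult_ac)
      qed
      have "(\<lambda>k. (norm (x k))\<^sup>2) summable_on UNIV" "(\<lambda>k. (norm (y k))\<^sup>2) summable_on UNIV"
        using xy by (simp_all add: summable_on_UNIV_nonneg_real_iff)
      from summable_on_imp_summable[OF summable_bilinear[OF this]]
      have "summable (\<lambda>k. norm (x k) * norm (y k))" .
      from summable_mult[OF this, of "norm T"]
      show "summable (\<lambda>k. norm T * (norm (x k) * norm (y k)))" .
    qed auto
  qed
qed

end

section \<open>Pinchings as trace-preserving conditional expectations, and their tensor
  products\<close>

context weighted_grid
begin

lemma conditional_expectation_pinch:
  assumes ref: "\<And>a b. \<sigma> a = \<sigma> b \<Longrightarrow> \<rho> a = \<rho> b"
  shows "conditional_expectation (block_alg \<rho>) tr (block_alg \<sigma>) (pinch \<sigma>)"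
  unfolding conditional_expectation_def
proof (intro conjI ballI impI)
  show "clinear_map_on (block_alg \<rho>) (pinch \<sigma>)" by (rule clinear_pinch)
  show "pinch \<sigma> T \<in> block_alg \<sigma>" if "T \<in> block_alg \<rho>" for T
    by (rule pinch_block_alg[OF that ref])
  show "pinch \<sigma> (S o\<^sub>L T o\<^sub>L R) = S o\<^sub>L pinch \<sigma> T o\<^sub>L R"
    if "S \<in> block_alg \<sigma>" "T \<in> block_alg \<rho>" "R \<in> block_alg \<sigma>" for S T R
    by (rule pinch_bimodule[OF that(1) block_algD(1)[OF that(2)] that(3)])
  show "tr (pinch \<sigma> T) = tr T" if "T \<in> block_alg \<rho>" for T
    by (simp add: tr_def coef_pinch[OF block_algD(1)[OF that]])
qed (simp_all add: pinch_id positive_pinch)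

end

context weighted_grid_product
begin

lemma tensor_map_pinch:
  assumes fin: "\<And>r. finite {a. \<rho>1 a = r}" "\<And>r. finite {a. \<rho>2 a = r}"
    "\<And>r. finite {a. \<sigma>1 a = r}" "\<And>r. finite {a. \<sigma>2 a = r}"
    and ref: "\<And>a b. \<sigma>1 a = \<sigma>1 b \<Longrightarrow> \<rho>1 a = \<rho>1 b" "\<And>a b. \<sigma>2 a = \<sigma>2 b \<Longrightarrow> \<rho>2 a = \<rho>2 b"
  shows "tensor_map (A.block_alg \<rho>1) (A.block_alg \<sigma>1) (A.pinch \<sigma>1)
    (B.block_alg \<rho>2) (B.block_alg \<sigma>2) (B.pinch \<sigma>2) (P.pinch (map_prod \<sigma>1 \<sigma>2))"
  unfolding tensor_map_def vn_tensor_block_alg[OF fin(1,2)] vn_tensor_block_alg[OF fin(3,4)]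
proof (intro conjI ballI)
  let ?\<rho> = "map_prod \<rho>1 \<rho>2" and ?\<sigma> = "map_prod \<sigma>1 \<sigma>2"
  show "clinear_map_on (P.block_alg ?\<rho>) (P.pinch ?\<sigma>)" by (rule P.clinear_pinch)
  have "?\<rho> a = ?\<rho> b" if "?\<sigma> a = ?\<sigma> b" for a b
    using that by (cases a; cases b) (auto intro: ref)
  then show "P.pinch ?\<sigma> T \<in> P.block_alg ?\<sigma>" if "T \<in> P.block_alg ?\<rho>" for T
    by (rule P.pinch_block_alg[OF that])
  show "continuous_map (subtopology weak_star (P.block_alg ?\<rho>)) weak_star (P.pinch ?\<sigma>)"
  proof (rule continuous_weak_star_map)
    show "P.block_alg ?\<rho> \<subseteq> bounded_ops" by (rule P.block_alg_bounded)
    then show "P.pinch ?\<sigma> ` P.block_alg ?\<rho> \<subseteq> bounded_ops"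
      using P.pinch_bounded by blast
    show "\<exists>\<psi>. weak_star_functional \<psi> \<and> (\<forall>T\<in>P.block_alg ?\<rho>. \<phi> (P.pinch ?\<sigma> T) = \<psi> T)"
      if "weak_star_functional \<phi>" for \<phi>
      using P.weak_star_pinch[OF that, of ?\<sigma>] P.block_alg_bounded[of ?\<rho>] by blast
  qed
  fix S T assume "S \<in> A.block_alg \<rho>1" "T \<in> B.block_alg \<rho>2"
  note b = A.block_algD(1)[OF this(1)] B.block_algD(1)[OF this(2)]
  show "P.pinch ?\<sigma> (S \<otimes>\<^sub>o T) = A.pinch \<sigma>1 S \<otimes>\<^sub>o B.pinch \<sigma>2 T"
    by (rule op_eqI) (auto simp: P.pinch_bounded A.pinch_bounded B.pinch_bounded tensor_op(1) b
        P.coef_pinch A.coef_pinch B.coef_pinch coef_tensor_op)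
qed

end

section \<open>The spectral measure of a multiple of a projection\<close>

definition two_point :: "real \<Rightarrow> 'p op \<Rightarrow> real set \<Rightarrow> 'p op" where
  "two_point s p B = (if s \<in> B then p else 0) + (if 0 \<in> B then id_blinfun - p else 0)"

text \<open>The functional is kept abstract because two kinds are needed: those given by vectors,
  which define spectral measures, and the trace in the weak type inequality.\<close>

context
  fixes \<phi> :: "'p op \<Rightarrow> complex" and p :: "'p op" and s a b :: real and P :: "real set \<Rightarrow> 'p op"
  assumes s: "s \<noteq> 0" and ab: "a \<ge> 0" "b \<ge> 0"
    and P: "\<And>B. Re (\<phi> (P B)) = (if s \<in> B then a else 0) + (if 0 \<in> B then b else 0)"
begin

lemma two_point_scalar_measure:
  shows "sets (scalar_measure \<phi> P) = sets borel"
    and "B \<in> sets borel \<Longrightarrow> emeasure (scalar_measure \<phi> P) B =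
      (if s \<in> B then ennreal a else 0) + (if 0 \<in> B then ennreal b else 0)"
proof -
  \<comment> \<open>\<open>measure_of\<close> returns its set function only if that is countably
    additive on the sigma-algebra; identifying it with a concrete two-point measure supplies the
    additivity.\<close>
  define M where "M = distr (point_measure {0, s} (\<lambda>t. if t = s then ennreal a else ennreal b)) borel (\<lambda>t. t)"
  have M: "emeasure M B = (if s \<in> B then ennreal a else 0) + (if 0 \<in> B then ennreal b else 0)"
    if "B \<in> sets borel" for B
  proof -
    have "emeasure M B = (\<Sum>t\<in>{0, s} \<inter> B. if t = s then ennreal a else ennreal b)"
      unfolding M_def using that
      by (subst emeasure_distr) (auto simp: space_point_measure Int_commute emeasure_point_measure_finite)
    also have "\<dots> = (if s \<in> B then ennreal a else 0) + (if 0 \<in> B then ennreal b else 0)"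
      using s by (auto simp: Int_insert_left)
    finally show ?thesis .
  qed
  have "scalar_measure \<phi> P = measure_of (space M) (sets M) (emeasure M)"
    unfolding scalar_measure_def
  proof (subst measure_of_eq[where \<mu>' = "emeasure M"])
    show "ennreal (Re (\<phi> (P B))) = emeasure M B" if "B \<in> sigma_sets UNIV (sets borel)" for B
    proof -
      have "B \<in> sets borel" using that sets.sigma_sets_eq[of "borel :: real measure"] by simp
      then show ?thesis by (simp add: M P ab)
    qed
  qed (auto simp: M_def)
  then have eq: "scalar_measure \<phi> P = M" by (simp add: measure_of_of_measure)
  show "sets (scalar_measure \<phi> P) = sets borel" by (simp add: eq M_def)
  show "B \<in> sets borel \<Longrightarrow> emeasure (scalar_measure \<phi> P) B =
      (if s \<in> B then ennreal a else 0) + (if 0 \<in> B then ennreal b else 0)"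
    by (simp add: eq M)
qed

lemma two_point_AE: "AE t in scalar_measure \<phi> P. t = s \<or> t = 0"
proof (rule AE_I[where N = "- {0, s}"])
  show "emeasure (scalar_measure \<phi> P) (- {0, s}) = 0"
    by (subst two_point_scalar_measure(2)) auto
  show "- {0, s} \<in> sets (scalar_measure \<phi> P)"
    by (auto simp: two_point_scalar_measure(1))
qed auto

text \<open>No measurability of \<open>f\<close> is needed because the measure has finite support.\<close>

lemma two_point_nn_integral: "(\<integral>\<^sup>+t. f t \<partial>scalar_measure \<phi> P) = f s * ennreal a + f 0 * ennreal b"
proof -
  note [measurable_cong] = two_point_scalar_measure(1)
  have "(\<integral>\<^sup>+t. f t \<partial>scalar_measure \<phi> P) =
      (\<integral>\<^sup>+t. f s * indicator {s} t + f 0 * indicator {0} t \<partial>scalar_measure \<phi> P)"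
    by (rule nn_integral_cong_AE[OF AE_mp[OF two_point_AE]]) (use s in auto)
  also have "\<dots> = f s * ennreal a + f 0 * ennreal b"
    using s by (subst nn_integral_add)
      (auto simp: nn_integral_cmult_indicator two_point_scalar_measure)
  finally show ?thesis .
qed

lemma two_point_integral:
  shows "integrable (scalar_measure \<phi> P) (\<lambda>t. t)" "(\<integral>t. t \<partial>scalar_measure \<phi> P) = s * a"
proof -
  note [measurable_cong] = two_point_scalar_measure(1)
  have fin: "integrable (scalar_measure \<phi> P) (\<lambda>t. s * indicator {s} t :: real)"
    using two_point_scalar_measure(2)[of "{s}"]
    by (intro integrable_mult_right integrable_real_indicator)
      (auto simp: two_point_scalar_measure(1) ennreal_less_top less_top)
  have AE: "AE t in scalar_measure \<phi> P. t = s * indicator {s} t"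
    by (rule AE_mp[OF two_point_AE]) (use s in auto)
  show "integrable (scalar_measure \<phi> P) (\<lambda>t. t)"
    using fin by (subst integrable_cong_AE[OF _ _ AE]) auto
  have "(\<integral>t. t \<partial>scalar_measure \<phi> P) = (\<integral>t. s * indicator {s} t \<partial>scalar_measure \<phi> P)"
    by (rule integral_cong_AE[OF _ _ AE]) auto
  also have "\<dots> = s * measure (scalar_measure \<phi> P) {s}"
    by (simp add: sets_eq_imp_space_eq[OF two_point_scalar_measure(1)])
  also have "measure (scalar_measure \<phi> P) {s} = a"
    using s ab by (simp add: measure_def two_point_scalar_measure)
  finally show "(\<integral>t. t \<partial>scalar_measure \<phi> P) = s * a" .
qed

end

lemma projection_op_zero: "projection_op 0"
  unfolding projection_op_def by (auto intro!: adj_eqI simp: cinner_def zero_ell2.rep_eq)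

lemma projection_op_id: "projection_op id_blinfun"
  unfolding projection_op_def by (auto intro!: blinfun_eqI)

lemma spectral_measure_two_point:
  fixes p :: "'p op"
  assumes p: "projection_op p" and s: "s \<noteq> 0"
  shows "spectral_measure (s *\<^sub>R p) (two_point s p)"
  unfolding spectral_measure_def
proof (intro conjI ballI allI impI)
  note p' = projection_op_complement[OF p]
  have pp: "p (p x) = p x" for x by (rule projection_op_simps(2)[OF p])
  show "projection_op (two_point s p B)" for B
    using p p' by (simp add: two_point_def projection_op_zero projection_op_id)
  show "two_point s p UNIV = id_blinfun" by (simp add: two_point_def)
  show "two_point s p (B \<inter> C) = two_point s p B o\<^sub>L two_point s p C" for B C
    by (rule blinfun_eqI)
      (simp add: two_point_def pp blinfun.diff_left blinfun.diff_right blinfun.add_left blinfun.add_right)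
  show "(\<lambda>n. two_point s p (B n) x) sums two_point s p (\<Union>n. B n) x"
    if "disjoint_family B" for B :: "nat \<Rightarrow> real set" and x
  proof -
    have ind: "(\<lambda>n. (if t \<in> B n then y else 0)) sums (if t \<in> (\<Union>n. B n) then y else 0)" for t and y :: "'p ell2"
    proof (cases "\<exists>n. t \<in> B n")
      case True
      then obtain n where n: "t \<in> B n" by blast
      have "t \<in> B k \<longleftrightarrow> k = n" for k
        using that n unfolding disjoint_family_on_def by blast
      then show ?thesis using sums_single[of n "\<lambda>_. y"] n by auto
    qed auto
    have "two_point s p A x = (if s \<in> A then p x else 0) + (if 0 \<in> A then x - p x else 0)" for A
      by (simp add: two_point_def blinfun.add_left blinfun.diff_left)
    then show ?thesis
      using sums_add[OF ind[of s "p x"] ind[of 0 "x - p x"]] by simp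
  qed
  fix x
  let ?\<phi> = "\<lambda>T :: 'p op. cinner x (T x)"
  have *: "Re (?\<phi> (two_point s p B)) = (if s \<in> B then (norm (p x))\<^sup>2 else 0) +
      (if 0 \<in> B then (norm ((id_blinfun - p) x))\<^sup>2 else 0)" for B
    using projection_op_norm_sq[OF p, of x] projection_op_norm_sq[OF p', of x]
    by (simp add: two_point_def blinfun.add_left cinner_add_right)
      (simp add: cinner_def zero_ell2.rep_eq)
  note I = two_point_integral[OF s _ _ *, OF zero_le_power2 zero_le_power2]
  show "integrable (scalar_measure ?\<phi> (two_point s p)) (\<lambda>t. t)" by (rule I(1))
  show "cinner x ((s *\<^sub>R p) x) = of_real (\<integral>t. t \<partial>scalar_measure ?\<phi> (two_point s p))"
    unfolding I(2) by (simp add: blinfun.scaleR_left cinner_scaleR_right projection_op_norm_sq[OF p])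
qed

lemma positive_scaleR_projection:
  assumes p: "projection_op p" and s: "s \<ge> 0"
  shows "positive_op (s *\<^sub>R p)"
  unfolding positive_op_def
proof (intro conjI allI)
  show "s *\<^sub>R p \<in> bounded_ops" using projection_op_simps(1)[OF p] by (rule bounded_ops_scaleR)
  show "cinner x ((s *\<^sub>R p) x) \<in> \<real>\<^sub>\<ge>\<^sub>0" for x
    using s by (simp add: blinfun.scaleR_left cinner_scaleR_right projection_op_norm_sq[OF p]
        flip: of_real_power of_real_mult)
qed

lemma modulus_positive: "positive_op x \<Longrightarrow> modulus_op x x"
  by (simp add: modulus_op_def positive_op_adj)

section \<open>An orthogonal matrix with large triangular truncation\<close>

lemma one_minus_cis: "1 - cis \<theta> = - 2 * \<i> * complex_of_real (sin (\<theta> / 2)) * cis (\<theta> / 2)"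
  using sin_squared_eq[of "\<theta> / 2"] cos_double_sin[of "\<theta> / 2"] sin_double[of "\<theta> / 2"]
  by (simp add: complex_eq_iff power2_eq_square)

lemma sum_roots_of_unity:
  fixes k :: int
  assumes d: "d > 0" and k: "\<bar>k\<bar> < int d"
  shows "(\<Sum>n<d. cis (2 * pi * k * real n / d)) = (if k = 0 then of_nat d else 0)"
proof (cases "k = 0")
  case False
  let ?z = "cis (2 * pi * k / d)"
  have "sin (pi * k / d) \<noteq> 0"
  proof
    assume "sin (pi * k / d) = 0"
    then obtain m :: int where "pi * k / d = m * pi"
      using sin_zero_iff_int2 by blast
    then have "real_of_int k = m * real d"
      using d by (simp add: field_simps)
    then have "k = m * int d"
      by (metis of_int_eq_iff of_int_mult of_int_of_nat_eq)
    with k False show False by (auto simp: abs_mult)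
  qed
  then have "?z \<noteq> 1"
    using one_minus_cis[of "2 * pi * k / d"] by auto
  moreover have "?z ^ d = 1"
    using d by (simp add: Complex.DeMoivre)
  moreover have "(\<Sum>n<d. cis (2 * pi * k * real n / d)) = (\<Sum>n<d. ?z ^ n)"
    by (simp add: Complex.DeMoivre mult_ac)
  ultimately show ?thesis
    using False by (simp add: geometric_sum)
qed simp

text \<open>Up to unimodular factors depending on the row or on the column, this is the normalised
  Gram matrix between characters with integer frequencies and characters shifted by 1/2: a discrete
  Hilbert transform. Rows run from 0 and columns from 1, so that column n is truncated to the rows i
  < n of the n-th corner, where the entries are positive.\<close>

definition cosec_matrix :: "nat \<Rightarrow> nat \<Rightarrow> nat \<Rightarrow> real" where
  "cosec_matrix d i n = 1 / (d * sin (pi * (real n - real i - 1/2) / d))"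

text \<open>A geometric sum. The half-integer shift makes the d-th power of the ratio equal to -1,
  so the numerator is -2, and by parity it keeps the sine in the denominator away from 0.\<close>

lemma cosec_matrix_fourier:
  assumes "i < d" "n \<in> {1..d}"
  shows "(\<Sum>l<d. cis (2 * pi * (real n - real i - 1/2) * real l / d)) =
    \<i> * d * cosec_matrix d i n * cis (- pi * (real n - real i - 1/2) / d)"
proof -
  define t where "t = real n - real i - 1/2"
  let ?z = "cis (2 * pi * t / d)"
  have d: "d > 0" using assms by simp
  have sin: "sin (pi * t / d) \<noteq> 0"
  proof
    assume "sin (pi * t / d) = 0"
    then obtain m :: int where "pi * t / d = m * pi"
      using sin_zero_iff_int2 by blast
    then have "pi * (t / d) = pi * m" by (simp add: mult.commute)
    then have "t / d = m" by (simp only: mult_cancel_left pi_neq_zero simp_thms)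
    then have "t = m * d" using d by (simp add: field_simps)
    then have "2 * (real n - real i) - 1 = 2 * m * real d"
      by (simp add: t_def)
    then have "real_of_int (2 * (int n - int i) - 1) = real_of_int (2 * m * int d)"
      by simp
    then have "2 * (int n - int i) - 1 = 2 * (m * int d)"
      by (simp only: of_int_eq_iff mult.assoc)
    then show False by presburger
  qed
  have z: "1 - ?z = - 2 * \<i> * complex_of_real (sin (pi * t / d)) * cis (pi * t / d)"
    using one_minus_cis[of "2 * pi * t / d"] by simp
  then have "?z \<noteq> 1" using sin by auto
  moreover have "?z ^ d = -1"
  proof -
    have "?z ^ d = cis (2 * pi * t)"
      using d by (simp add: Complex.DeMoivre)
    also have "\<dots> = cis (2 * pi * (real n - real i) - pi)"
      by (simp add: t_def algebra_simps)
    also have "\<dots> = cis (2 * pi * (int n - int i)) * cis (- pi)"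
      unfolding cis_mult by simp
    also have "cis (2 * pi * (int n - int i)) = 1"
      by (metis cis_multiple_2pi Ints_of_int)
    finally show ?thesis by (simp add: complex_eq_iff)
  qed
  moreover have "(\<Sum>l<d. cis (2 * pi * t * real l / d)) = (\<Sum>l<d. ?z ^ l)"
    by (simp add: Complex.DeMoivre mult_ac)
  ultimately have "(\<Sum>l<d. cis (2 * pi * t * real l / d)) = (-1 - 1) / (?z - 1)"
    by (simp add: geometric_sum)
  also have "?z - 1 = 2 * \<i> * complex_of_real (sin (pi * t / d)) * cis (pi * t / d)"
    using z by (simp add: algebra_simps)
  also have "(-1 - 1) / \<dots> = \<i> * d * cosec_matrix d i n * cis (- (pi * t / d))"
    using sin d by (simp add: cosec_matrix_def t_def field_simps cis_inverse flip: cis_inverse)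
  finally show ?thesis by (simp add: t_def)
qed

text \<open>The products of entries of V are computed twice. By the preceding lemma they are those
  of W up to a factor that no longer depends on n. As exponential sums, summation over n leaves only
  l = k, and the remaining sum over l leaves only i = j.\<close>

lemma cosec_matrix_orthogonal:
  assumes i: "i < d" and j: "j < d"
  shows "(\<Sum>n\<in>{1..d}. cosec_matrix d i n * cosec_matrix d j n) = (if i = j then 1 else 0)"
proof -
  have d: "d > 0" using i by simp
  define V where "V i n = (\<Sum>l<d. cis (2 * pi * (real n - real i - 1/2) * real l / d))" for i n
  let ?W = "cosec_matrix d"
  have VV: "V i n * cnj (V j n) = (real d)\<^sup>2 * ?W i n * ?W j n * cis (pi * (real i - real j) / d)"
    if "n \<in> {1..d}" for n
  proof -
    have V: "V i n = \<i> * d * cosec_matrix d i n * cis (- pi * (real n - real i - 1/2) / d)" if "i < d" for i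
      unfolding V_def by (rule cosec_matrix_fourier[OF that \<open>n \<in> {1..d}\<close>])
    have "V i n * cnj (V j n) = (real d)\<^sup>2 * ?W i n * ?W j n *
        (cis (- pi * (real n - real i - 1/2) / d) * cis (pi * (real n - real j - 1/2) / d))"
      by (simp add: V i j cis_cnj power2_eq_square mult_ac)
    also have "cis (- pi * (real n - real i - 1/2) / d) * cis (pi * (real n - real j - 1/2) / d) =
        cis (pi * (real i - real j) / d)"
      unfolding cis_mult
      by (rule arg_cong[where f = cis]) (simp add: add_divide_distrib[symmetric] algebra_simps)
    finally show ?thesis .
  qed
  have "(\<Sum>n\<in>{1..d}. V i n * cnj (V j n)) =
      (\<Sum>n\<in>{1..d}. \<Sum>l<d. \<Sum>k<d. cis (2 * pi * (real n - real i - 1/2) * real l / d) *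
        cis (- (2 * pi * (real n - real j - 1/2) * real k / d)))"
    by (simp add: V_def sum_product cis_cnj)
  also have "\<dots> = (\<Sum>l<d. \<Sum>k<d. \<Sum>n\<in>{1..d}. cis (2 * pi * (real n - real i - 1/2) * real l / d) *
        cis (- (2 * pi * (real n - real j - 1/2) * real k / d)))"
    by (rule trans[OF sum.swap sum.cong[OF refl sum.swap]])
  also have "\<dots> = (\<Sum>l<d. \<Sum>k<d. if k = l then d * cis (2 * pi * (int j - int i) * real l / d) else 0)"
  proof (intro sum.cong refl)
    fix l k assume lk: "l \<in> {..<d}" "k \<in> {..<d}"
    let ?c = "cis (2 * pi * ((1/2 - real i) * l - (1/2 - real j) * k) / d)"
    have "(\<Sum>n\<in>{1..d}. cis (2 * pi * (real n - real i - 1/2) * real l / d) *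
        cis (- (2 * pi * (real n - real j - 1/2) * real k / d))) =
        (\<Sum>n<d. cis (2 * pi * (real (Suc n) - real i - 1/2) * real l / d) *
        cis (- (2 * pi * (real (Suc n) - real j - 1/2) * real k / d)))"
      by (rule sum.reindex_bij_witness[of _ Suc "\<lambda>n. n - 1"]) auto
    also have "\<dots> = (\<Sum>n<d. ?c * cis (2 * pi * (int l - int k) * real n / d))"
    proof (intro sum.cong refl)
      fix n
      show "cis (2 * pi * (real (Suc n) - real i - 1/2) * real l / d) *
        cis (- (2 * pi * (real (Suc n) - real j - 1/2) * real k / d)) = ?c * cis (2 * pi * (int l - int k) * real n / d)"
        unfolding cis_mult using d by (intro arg_cong[where f = cis]) (simp add: field_simps)
    qed
    also have "\<dots> = ?c * (if int l - int k = 0 then of_nat d else 0)"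
      unfolding sum_distrib_left[symmetric] using lk
      by (subst sum_roots_of_unity[OF d]) auto
    also have "\<dots> = (if k = l then d * cis (2 * pi * (int j - int i) * real l / d) else 0)"
      by (auto simp: algebra_simps)
    finally show "(\<Sum>n\<in>{1..d}. cis (2 * pi * (real n - real i - 1/2) * real l / d) *
        cis (- (2 * pi * (real n - real j - 1/2) * real k / d))) =
        (if k = l then d * cis (2 * pi * (int j - int i) * real l / d) else 0)" .
  qed
  also have "\<dots> = d * (\<Sum>l<d. cis (2 * pi * (int j - int i) * real l / d))"
    by (simp add: sum_distrib_left)
  also have "\<dots> = d * (if int j - int i = 0 then of_nat d else 0)"
    using i j by (subst sum_roots_of_unity[OF d]) auto
  finally have "(\<Sum>n\<in>{1..d}. V i n * cnj (V j n)) = (if i = j then (real d)\<^sup>2 else 0)"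
    by (auto simp: power2_eq_square)
  also have "(\<Sum>n\<in>{1..d}. V i n * cnj (V j n)) =
      (real d)\<^sup>2 * cis (pi * (real i - real j) / d) * complex_of_real (\<Sum>n\<in>{1..d}. ?W i n * ?W j n)"
    by (simp add: VV sum_distrib_left mult_ac)
  finally have eq: "(real d)\<^sup>2 * cis (pi * (real i - real j) / d) * complex_of_real (\<Sum>n\<in>{1..d}. ?W i n * ?W j n) =
      (if i = j then (real d)\<^sup>2 else 0)" .
  show ?thesis
  proof (cases "i = j")
    case True
    with eq d have "complex_of_real (\<Sum>n\<in>{1..d}. ?W i n * ?W j n) = 1" by simp
    with True show ?thesis by (simp only: of_real_eq_1_iff simp_thms if_True)
  next
    case False
    with eq d have "complex_of_real (\<Sum>n\<in>{1..d}. ?W i n * ?W j n) = 0" by simp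
    with False show ?thesis by (simp only: of_real_eq_0_iff simp_thms if_False)
  qed
qed

lemma cosec_matrix_ge:
  assumes "i < n" "n \<le> d"
  shows "cosec_matrix d i n \<ge> 1 / (pi * real (n - i))"
proof -
  define \<theta> where "\<theta> = pi * (real n - real i - 1/2) / d"
  have d: "d > 0" using assms by simp
  have n: "real n - real i \<ge> 1" "real n - real i \<le> real d" using assms by linarith+
  have \<theta>: "0 < \<theta>" unfolding \<theta>_def using n d by simp
  have "\<theta> * d = pi * (real n - real i - 1/2)" using d by (simp add: \<theta>_def)
  moreover have "pi * (real n - real i - 1/2) < pi * d"
    using n by (intro mult_strict_left_mono) auto
  ultimately have "\<theta> * d < pi * d" by (simp only:)
  then have "\<theta> < pi" by (rule mult_right_less_imp_less) simp
  with \<theta> have pos: "sin \<theta> > 0" by (rule sin_gt_zero)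
  have "d * sin \<theta> \<le> d * \<theta>"
    using sin_x_le_x[of \<theta>] \<theta> by (intro mult_left_mono) auto
  also have "\<dots> = pi * (real n - real i - 1/2)" using d by (simp add: \<theta>_def)
  also have "\<dots> \<le> pi * real (n - i)" using assms by (intro mult_left_mono) auto
  finally show ?thesis
    unfolding cosec_matrix_def \<theta>_def[symmetric] using pos d assms(1) by (intro divide_left_mono) auto
qed

text \<open>The entries change sign below row n, so a full column has cancellation. Truncation keeps
  only the positive entries, which dominate the terms of a harmonic sum.\<close>

lemma cosec_matrix_column_ge:
  assumes "n \<le> d"
  shows "(\<Sum>i<n. cosec_matrix d i n) \<ge> ln (real n + 1) / pi"
proof -
  have "ln (real n + 1) / pi \<le> harm n / pi"
    using ln_le_harm[of n] by (intro divide_right_mono) auto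
  also have "harm n / pi = (\<Sum>k\<in>{1..n}. 1 / (pi * real k))"
    by (simp add: harm_def sum_divide_distrib field_simps)
  also have "\<dots> = (\<Sum>i<n. 1 / (pi * real (n - i)))"
    by (rule sum.reindex_bij_witness[of _ "\<lambda>i. n - i" "\<lambda>k. n - k"]) auto
  also have "\<dots> \<le> (\<Sum>i<n. cosec_matrix d i n)"
    using assms by (intro sum_mono cosec_matrix_ge) auto
  finally show ?thesis .
qed

text \<open>The columns n > 2^(L-1) suffice. Each of their truncated sums is at least (L-1) ln 2 /
  pi >= L/16, by L - 1 >= L/2, ln 2 >= 2/3 and pi < 4. They make up half of all columns, whence 512
  = 2 * 16^2.\<close>

lemma cosec_matrix_truncation_ge:
  assumes L: "L \<ge> 2"
  shows "(\<Sum>n\<in>{1..2 ^ L}. (\<Sum>i<n. cosec_matrix (2 ^ L) i n)\<^sup>2) \<ge> 2 ^ L * (real L)\<^sup>2 / 512"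
proof -
  let ?d = "2 ^ L :: nat"
  have d: "?d = 2 * 2 ^ (L - 1)" using L by (cases L) auto
  have "2 ^ L * (real L)\<^sup>2 / 512 = (\<Sum>n\<in>{2 ^ (L - 1)<..?d}. (real L / 16)\<^sup>2)"
  proof -
    have "card {2 ^ (L - 1)<..?d} = 2 ^ (L - 1)" using d by simp
    moreover have "(2::real) ^ L = 2 * 2 ^ (L - 1)" using L by (cases L) auto
    ultimately show ?thesis by (simp add: power2_eq_square)
  qed
  also have "\<dots> \<le> (\<Sum>n\<in>{2 ^ (L - 1)<..?d}. (\<Sum>i<n. cosec_matrix ?d i n)\<^sup>2)"
  proof (intro sum_mono power_mono)
    fix n assume n: "n \<in> {2 ^ (L - 1)<..?d}"
    have "real L / 16 \<le> (L - 1) * (2 / 3) / 4"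
      using L by (simp add: field_simps)
    also have "\<dots> \<le> (L - 1) * ln 2 / 4"
      using ln2_ge_two_thirds L by (intro divide_right_mono mult_left_mono) auto
    also have "\<dots> = ln (2 ^ (L - 1)) / 4" by (simp add: ln_realpow)
    also have "\<dots> \<le> ln (real n + 1) / 4"
    proof (intro divide_right_mono)
      have "real (2 ^ (L - 1)) \<le> real n" using n by (subst of_nat_le_iff) auto
      then have "(2::real) ^ (L - 1) \<le> real n + 1" by (simp only: of_nat_power of_nat_numeral)
      then show "ln (2 ^ (L - 1)) \<le> ln (real n + 1)" by (subst ln_le_cancel_iff) (simp_all add: add_pos_pos)
    qed auto
    also have "\<dots> \<le> ln (real n + 1) / pi"
      using pi_less_4 by (intro divide_left_mono) auto
    also have "\<dots> \<le> (\<Sum>i<n. cosec_matrix ?d i n)"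
      using n by (intro cosec_matrix_column_ge) auto
    finally show "real L / 16 \<le> (\<Sum>i<n. cosec_matrix ?d i n)" .
  qed auto
  also have "\<dots> \<le> (\<Sum>n\<in>{1..?d}. (\<Sum>i<n. cosec_matrix ?d i n)\<^sup>2)"
    by (intro sum_mono2) auto
  finally show ?thesis .
qed

section \<open>Combining the projections of different levels\<close>

text \<open>
  \<open>resid e j\<close> is \<open>(1 - e\<^sub>j\<^sub>-\<^sub>1) \<cdots> (1 - e\<^sub>0)\<close> and \<open>resid_adj e j\<close> is its adjoint. The
  decomposition \<open>1 = \<Sum>\<^sub>j e\<^sub>j resid e j\<close> replaces the spectral layers of a commutative maximal function
  without passing to intersections of projections.
\<close>

primrec resid :: "(nat \<Rightarrow> 'p op) \<Rightarrow> nat \<Rightarrow> 'p ell2 \<Rightarrow> 'p ell2" where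
  "resid e 0 x = x"
| "resid e (Suc j) x = resid e j x - e j (resid e j x)"

primrec resid_adj :: "(nat \<Rightarrow> 'p op) \<Rightarrow> nat \<Rightarrow> 'p ell2 \<Rightarrow> 'p ell2" where
  "resid_adj e 0 x = x"
| "resid_adj e (Suc j) x = resid_adj e j (x - e j x)"

lemma resid_adjoint:
  assumes "\<And>j. projection_op (e j)"
  shows "cinner (resid e j x) y = cinner x (resid_adj e j y)"
proof (induction j arbitrary: y)
  case (Suc j)
  have "cinner (z - e j z) y = cinner z (y - e j y)" for z
    using projection_op_simps(3)[OF projection_op_complement[OF assms[of j]], of z y]
    by (simp add: blinfun.diff_left)
  then show ?case by (simp add: Suc.IH)
qed simp

lemma norm_resid_adj_le:
  assumes "\<And>j. projection_op (e j)"
  shows "norm (resid_adj e j y) \<le> norm y"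
proof (induction j arbitrary: y)
  case (Suc j)
  have "norm (y - e j y) \<le> norm y"
    using norm_projection_le[OF projection_op_complement[OF assms[of j]], of y]
    by (simp add: blinfun.diff_left)
  then show ?case using Suc.IH[of "y - e j y"] by simp
qed simp

lemma resid_sum: "x = (\<Sum>j<k. e j (resid e j x)) + resid e k x"
  by (induction k) (auto simp: algebra_simps)

lemma cmod_sum_sq_le: "(cmod (\<Sum>j<k. f j))\<^sup>2 \<le> real k * (\<Sum>j<k. (cmod (f j))\<^sup>2)"
proof -
  have "(cmod (\<Sum>j<k. f j))\<^sup>2 \<le> (\<Sum>j<k. 1 * cmod (f j))\<^sup>2"
    by (intro power_mono) (auto intro: norm_sum)
  also have "\<dots> \<le> (\<Sum>j<k. 1\<^sup>2) * (\<Sum>j<k. (cmod (f j))\<^sup>2)"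
    by (rule Cauchy_Schwarz_ineq_sum)
  finally show ?thesis by simp
qed

section \<open>Vectors supported on one block, and the estimate of their pairings\<close>

context grid
begin

definition supported :: "'i set \<Rightarrow> 'c \<Rightarrow> 'p ell2 \<Rightarrow> bool" where
  "supported S c x \<longleftrightarrow> (\<forall>p. ell2_nth x p \<noteq> 0 \<longrightarrow> idx p \<in> S \<and> cpy p = c)"

definition vec :: "'i set \<Rightarrow> 'c \<Rightarrow> ('i \<Rightarrow> complex) \<Rightarrow> 'p ell2" where
  "vec S c f = (\<Sum>a\<in>S. f a *\<^sub>C ket (pt a c))"

lemma nth_vec: "finite S \<Longrightarrow> ell2_nth (vec S c f) p = (if idx p \<in> S \<and> cpy p = c then f (idx p) else 0)"
proof -
  assume S: "finite S"
  have "ell2_nth (vec S c f) p = (\<Sum>a\<in>S. if a = idx p then (if cpy p = c then f (idx p) else 0) else 0)"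
    by (auto simp: vec_def nth_sum_ell2 scaleC_ell2.rep_eq ket.rep_eq intro!: sum.cong)
  then show ?thesis using S by (simp add: sum.delta)
qed

lemma supported_vec: "finite S \<Longrightarrow> supported S c (vec S c f)"
  by (simp add: supported_def nth_vec)

lemma supported_eq_vec: "finite S \<Longrightarrow> supported S c x \<Longrightarrow> x = vec S c (\<lambda>a. ell2_nth x (pt a c))"
proof (rule ell2_eqI)
  fix p assume "finite S" "supported S c x"
  moreover have "c = cpy p \<Longrightarrow> pt (idx p) c = p" by simp
  ultimately show "ell2_nth x p = ell2_nth (vec S c (\<lambda>a. ell2_nth x (pt a c))) p"
    unfolding supported_def by (metis nth_vec)
qed

lemma norm_vec: "finite S \<Longrightarrow> (norm (vec S c f))\<^sup>2 = (\<Sum>a\<in>S. (cmod (f a))\<^sup>2)"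
proof -
  assume S: "finite S"
  have "vec S c f = (\<Sum>p\<in>(\<lambda>a. pt a c) ` S. f (idx p) *\<^sub>C ket p)"
    by (subst sum.reindex) (auto simp: vec_def inj_on_def)
  then have "(norm (vec S c f))\<^sup>2 = (\<Sum>p\<in>(\<lambda>a. pt a c) ` S. (cmod (f (idx p)))\<^sup>2)"
    using norm_sum_ket[of "(\<lambda>a. pt a c) ` S" "\<lambda>p. f (idx p)"] S by simp
  also have "\<dots> = (\<Sum>a\<in>S. (cmod (f a))\<^sup>2)"
    by (subst sum.reindex) (auto simp: inj_on_def)
  finally show ?thesis .
qed

lemma cinner_vec: "cinner (vec S c f) y = (\<Sum>a\<in>S. cnj (f a) * ell2_nth y (pt a c))"
  by (simp add: vec_def cinner_sum_left cinner_scaleC_left cinner_ket_left)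

lemma sum_norm_nth_le:
  assumes "finite S"
  shows "(\<Sum>a\<in>S. (cmod (ell2_nth x (pt a c)))\<^sup>2) \<le> (norm x)\<^sup>2"
proof -
  have "(\<Sum>a\<in>S. (cmod (ell2_nth x (pt a c)))\<^sup>2) = (\<Sum>p\<in>(\<lambda>a. pt a c) ` S. (cmod (ell2_nth x p))\<^sup>2)"
    by (subst sum.reindex) (auto simp: inj_on_def)
  also have "\<dots> \<le> (norm x)\<^sup>2"
    by (rule sum_le_norm_ell2) (use assms in simp)
  finally show ?thesis .
qed

text \<open>Block algebras preserve the finite-dimensional space of one class in one copy, so norms
  of residuals are finite sums over the block.\<close>

lemma supported_block_alg:
  assumes T: "T \<in> block_alg \<rho>" and S: "finite {a. \<rho> a = r}" and x: "supported {a. \<rho> a = r} c x"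
  shows "supported {a. \<rho> a = r} c (T x)"
  unfolding supported_def
proof (intro allI impI)
  let ?S = "{a. \<rho> a = r}"
  fix p assume nz: "ell2_nth (T x) p \<noteq> 0"
  have "T x = T (vec ?S c (\<lambda>a. ell2_nth x (pt a c)))"
    using supported_eq_vec[OF S x] by simp
  then have "ell2_nth (T x) p = (\<Sum>a\<in>?S. ell2_nth x (pt a c) * coef T p (pt a c))"
    by (simp add: vec_def blinfun.sum_right bounded_opsD[OF block_algD(1)[OF T]] nth_sum_ell2
        scaleC_ell2.rep_eq coef_def)
  with nz obtain a where "a \<in> ?S" "coef T p (pt a c) \<noteq> 0"
    by (metis (no_types, lifting) mult_zero_right sum.neutral)
  then show "idx p \<in> ?S \<and> cpy p = c"
    using block_algD(2,3)[OF T, of p "pt a c"] by simp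
qed

lemma supported_minus: "supported S c x \<Longrightarrow> supported S c y \<Longrightarrow> supported S c (x - y)"
  unfolding supported_def by (metis diff_zero minus_ell2.rep_eq)

lemma supported_resid:
  assumes "\<And>j. e j \<in> block_alg \<rho>" and "finite {a. \<rho> a = r}" and "supported {a. \<rho> a = r} c x"
  shows "supported {a. \<rho> a = r} c (resid e j x)"
  by (induction j) (auto intro: supported_minus supported_block_alg assms)

text \<open>
  Bessel's inequality for the family \<open>v\<^sub>t\<close> bounds the Hilbert-Schmidt norm of \<open>resid e (j + 1)\<close> on the
  block, and hence, passing to the adjoint, by the trace of \<open>1 - e\<^sub>j\<close> on the block.
\<close>

lemma sum_resid_le:
  fixes f :: "'t \<Rightarrow> 'i \<Rightarrow> complex"
  assumes S_def: "S = {a. \<rho> a = r}" and e: "\<And>j. projection_op (e j)" "\<And>j. e j \<in> block_alg \<rho>" and S: "finite S"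
    and bessel: "\<And>z. (\<Sum>t\<in>A. (cmod (\<Sum>a\<in>S. z a * f t a))\<^sup>2) \<le> (\<Sum>a\<in>S. (cmod (z a))\<^sup>2)"
  shows "(\<Sum>t\<in>A. (norm (resid e 0 (vec S c (f t))))\<^sup>2) \<le> card S"
    and "(\<Sum>t\<in>A. (norm (resid e (Suc j) (vec S c (f t))))\<^sup>2) \<le>
      (\<Sum>a\<in>S. 1 - Re (coef (e j) (pt a c) (pt a c)))"
proof -
  have *: "(\<Sum>t\<in>A. (norm (resid e j (vec S c (f t))))\<^sup>2) \<le> (\<Sum>a\<in>S. (norm (resid_adj e j (ket (pt a c))))\<^sup>2)" for j
  proof -
    have "(norm (resid e j (vec S c (f t))))\<^sup>2 =
        (\<Sum>a\<in>S. (cmod (\<Sum>b\<in>S. cnj (ell2_nth (resid_adj e j (ket (pt a c))) (pt b c)) * f t b))\<^sup>2)" for t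
    proof -
      let ?y = "resid e j (vec S c (f t))"
      have "supported S c ?y"
        unfolding S_def by (intro supported_resid e supported_vec) (use S in \<open>simp_all add: S_def\<close>)
      then have "(norm ?y)\<^sup>2 = (\<Sum>a\<in>S. (cmod (ell2_nth ?y (pt a c)))\<^sup>2)"
        using supported_eq_vec[OF S] norm_vec[OF S] by metis
      also have "\<dots> = (\<Sum>a\<in>S. (cmod (cinner (vec S c (f t)) (resid_adj e j (ket (pt a c)))))\<^sup>2)"
      proof (intro sum.cong refl)
        fix a
        have "cinner (vec S c (f t)) (resid_adj e j (ket (pt a c))) = cinner ?y (ket (pt a c))"
          by (rule resid_adjoint[OF e(1), symmetric])
        also have "\<dots> = cnj (ell2_nth ?y (pt a c))"
          by (subst cinner_commute) (simp add: cinner_ket_left)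
        finally show "(cmod (ell2_nth ?y (pt a c)))\<^sup>2 =
            (cmod (cinner (vec S c (f t)) (resid_adj e j (ket (pt a c)))))\<^sup>2" by simp
      qed
      also have "\<dots> = (\<Sum>a\<in>S. (cmod (cnj (cinner (vec S c (f t)) (resid_adj e j (ket (pt a c))))))\<^sup>2)"
        by simp
      also have "\<dots> = (\<Sum>a\<in>S. (cmod (\<Sum>b\<in>S. cnj (ell2_nth (resid_adj e j (ket (pt a c))) (pt b c)) * f t b))\<^sup>2)"
        by (simp only: cinner_vec cnj_sum complex_cnj_mult complex_cnj_cnj mult.commute)
      finally show ?thesis .
    qed
    then have "(\<Sum>t\<in>A. (norm (resid e j (vec S c (f t))))\<^sup>2) =
        (\<Sum>a\<in>S. \<Sum>t\<in>A. (cmod (\<Sum>b\<in>S. cnj (ell2_nth (resid_adj e j (ket (pt a c))) (pt b c)) * f t b))\<^sup>2)"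
      by (simp only: sum.swap[of _ S A])
    also have "\<dots> \<le> (\<Sum>a\<in>S. (norm (resid_adj e j (ket (pt a c))))\<^sup>2)"
    proof (rule sum_mono)
      fix a
      show "(\<Sum>t\<in>A. (cmod (\<Sum>b\<in>S. cnj (ell2_nth (resid_adj e j (ket (pt a c))) (pt b c)) * f t b))\<^sup>2) \<le>
          (norm (resid_adj e j (ket (pt a c))))\<^sup>2"
        using bessel[of "\<lambda>b. cnj (ell2_nth (resid_adj e j (ket (pt a c))) (pt b c))"]
          sum_norm_nth_le[OF S, of "resid_adj e j (ket (pt a c))" c] by simp
    qed
    finally show ?thesis .
  qed
  show "(\<Sum>t\<in>A. (norm (resid e 0 (vec S c (f t))))\<^sup>2) \<le> card S"
    using *[of 0] by simp
  have "(norm (resid_adj e (Suc j) (ket (pt a c))))\<^sup>2 \<le> 1 - Re (coef (e j) (pt a c) (pt a c))" for a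
  proof -
    note p = projection_op_complement[OF e(1)[of j]]
    let ?k = "ket (pt a c)"
    \<comment> \<open>In the adjoint product the factor 1 - e_j acts first; the factors after it are
      contractions.\<close>
    have "(norm (resid_adj e (Suc j) ?k))\<^sup>2 \<le> (norm ((id_blinfun - e j) ?k))\<^sup>2"
      using norm_resid_adj_le[of e j "?k - e j ?k", OF e(1)]
      by (intro power_mono) (auto simp: blinfun.diff_left)
    also have "\<dots> = Re (coef (id_blinfun - e j) (pt a c) (pt a c))"
      by (simp add: coef_eq_cinner projection_op_norm_sq[OF p] del: coef_minus flip: of_real_power)
    finally show ?thesis by simp
  qed
  then show "(\<Sum>t\<in>A. (norm (resid e (Suc j) (vec S c (f t))))\<^sup>2) \<le>
      (\<Sum>a\<in>S. 1 - Re (coef (e j) (pt a c) (pt a c)))"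
    by (intro order_trans[OF *] sum_mono)
qed

text \<open>The decomposition is inserted between \<open>u t\<close> and
  \<open>vec S c (f t)\<close>. The projection \<open>e j\<close> moves to \<open>u t\<close>, where
  it gives \<open>B j\<close>, while the residual at level j is controlled by 1 - e_(j-1); hence
  \<open>B (Suc j)\<close> is paired with the projection \<open>e j\<close>, and the term j = 0 with
  the dimension \<open>card S\<close>. The choice \<open>e k = id_blinfun\<close> makes the residual
  after level k vanish.\<close>

lemma sum_pairing_le:
  fixes f :: "'t \<Rightarrow> 'i \<Rightarrow> complex"
  assumes S_def: "S = {a. \<rho> a = r}" and e: "\<And>j. projection_op (e j)" "\<And>j. e j \<in> block_alg \<rho>" and S: "finite S"
    and bessel: "\<And>z. (\<Sum>t\<in>A. (cmod (\<Sum>a\<in>S. z a * f t a))\<^sup>2) \<le> (\<Sum>a\<in>S. (cmod (z a))\<^sup>2)"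
    and u: "\<And>j t. j \<le> k \<Longrightarrow> t \<in> A \<Longrightarrow> (norm (e j (u t)))\<^sup>2 \<le> B j" and k: "e k = id_blinfun"
    and B: "\<And>j. 0 \<le> B j"
  shows "(\<Sum>t\<in>A. (cmod (cinner (u t) (vec S c (f t))))\<^sup>2) \<le>
    real (Suc k) * (B 0 * card S + (\<Sum>j<k. B (Suc j) * (\<Sum>a\<in>S. 1 - Re (coef (e j) (pt a c) (pt a c)))))"
proof -
  let ?v = "\<lambda>t. vec S c (f t)"
  have "(cmod (cinner (u t) (?v t)))\<^sup>2 \<le> real (Suc k) * (\<Sum>j<Suc k. B j * (norm (resid e j (?v t)))\<^sup>2)"
    if t: "t \<in> A" for t
  proof -
    have "?v t = (\<Sum>j<Suc k. e j (resid e j (?v t)))"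
      using resid_sum[of "?v t" e "Suc k"] by (simp add: k)
    then have "cinner (u t) (?v t) = (\<Sum>j<Suc k. cinner (u t) (e j (resid e j (?v t))))"
      by (metis cinner_sum_right)
    also have "\<dots> = (\<Sum>j<Suc k. cinner (e j (u t)) (resid e j (?v t)))"
      by (simp only: projection_op_simps(3)[OF e(1)])
    \<comment> \<open>The pieces of different levels need not be orthogonal, so Cauchy-Schwarz over
      the \<open>Suc k\<close> levels is used in place of Pythagoras.\<close>
    finally have "(cmod (cinner (u t) (?v t)))\<^sup>2 \<le>
        real (Suc k) * (\<Sum>j<Suc k. (cmod (cinner (e j (u t)) (resid e j (?v t))))\<^sup>2)"
      by (simp only: cmod_sum_sq_le)
    also have "\<dots> \<le> real (Suc k) * (\<Sum>j<Suc k. B j * (norm (resid e j (?v t)))\<^sup>2)"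
    proof (intro mult_left_mono sum_mono)
      fix j assume "j \<in> {..<Suc k}"
      have "(cmod (cinner (e j (u t)) (resid e j (?v t))))\<^sup>2 \<le> (norm (e j (u t)) * norm (resid e j (?v t)))\<^sup>2"
        by (intro power_mono norm_cinner_le) auto
      also have "\<dots> \<le> B j * (norm (resid e j (?v t)))\<^sup>2"
        unfolding power_mult_distrib using \<open>j \<in> {..<Suc k}\<close> t by (intro mult_right_mono u) auto
      finally show "(cmod (cinner (e j (u t)) (resid e j (?v t))))\<^sup>2 \<le> B j * (norm (resid e j (?v t)))\<^sup>2" .
    qed auto
    finally show ?thesis .
  qed
  then have "(\<Sum>t\<in>A. (cmod (cinner (u t) (?v t)))\<^sup>2) \<le>
      (\<Sum>t\<in>A. real (Suc k) * (\<Sum>j<Suc k. B j * (norm (resid e j (?v t)))\<^sup>2))"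
    by (rule sum_mono)
  also have "\<dots> = real (Suc k) * (\<Sum>j<Suc k. B j * (\<Sum>t\<in>A. (norm (resid e j (?v t)))\<^sup>2))"
    by (subst sum_distrib_left[symmetric], subst sum.swap) (simp only: sum_distrib_left)
  also have "\<dots> = real (Suc k) * (B 0 * (\<Sum>t\<in>A. (norm (resid e 0 (?v t)))\<^sup>2) +
      (\<Sum>j<k. B (Suc j) * (\<Sum>t\<in>A. (norm (resid e (Suc j) (?v t)))\<^sup>2)))"
    by (simp only: sum.lessThan_Suc_shift)
  also have "\<dots> \<le> real (Suc k) * (B 0 * card S + (\<Sum>j<k. B (Suc j) * (\<Sum>a\<in>S. 1 - Re (coef (e j) (pt a c) (pt a c)))))"
    by (intro mult_left_mono add_mono sum_mono B
        sum_resid_le[OF S_def e S bessel]) auto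
  finally show ?thesis .
qed

end

section \<open>The weak type inequality on a single block\<close>

context grid
begin

text \<open>The operator u u^* tensor 1, with u the constant vector 1 on \<open>S\<close>: it equals
  \<open>card S\<close> times a minimal projection of the block, and its compression to any subset
  of \<open>S\<close> is again an all-ones matrix.\<close>

definition block_ones :: "'i set \<Rightarrow> 'p op" where
  "block_ones S = (\<Sum>a\<in>S. \<Sum>b\<in>S. unit_op a b)"

lemma block_ones_bounded [simp]: "block_ones S \<in> bounded_ops"
  unfolding block_ones_def by (intro bounded_ops_sum unit_op_bounded)

lemma coef_block_ones:
  assumes "finite S"
  shows "coef (block_ones S) p q = (if idx p \<in> S \<and> idx q \<in> S \<and> cpy p = cpy q then 1 else 0)"
proof (cases "cpy p = cpy q")
  case True
  then have "coef (block_ones S) p q = (\<Sum>a\<in>S. if a = idx p then (\<Sum>b\<in>S. if b = idx q then 1 else 0) else 0)"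
    by (auto simp: block_ones_def coef_sum intro!: sum.cong)
  then show ?thesis using assms True by (simp add: sum.delta)
qed (simp add: block_ones_def coef_sum)

context
  fixes \<rho> :: "'i \<Rightarrow> 'i" and r and S
  assumes S_def: "S = {a. \<rho> a = r}" and S: "finite S" "S \<noteq> {}"
begin

lemma block_ones_block_alg: "block_ones S \<in> block_alg \<rho>"
proof (rule block_algI[where t = "\<lambda>a b. if a \<in> S \<and> b \<in> S then 1 else 0"])
  have "a \<in> S \<longleftrightarrow> \<rho> a = r" for a by (simp add: S_def)
  then show "coef (block_ones S) p q = (if cpy p = cpy q \<and> \<rho> (idx p) = \<rho> (idx q) then
      if idx p \<in> S \<and> idx q \<in> S then 1 else 0 else 0)" for p q
    by (simp add: coef_block_ones[OF S(1)])
qed simp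

lemma block_ones_compose: "block_ones S o\<^sub>L block_ones S = card S *\<^sub>R block_ones S"
proof (rule op_eqI)
  show "block_ones S o\<^sub>L block_ones S \<in> bounded_ops" "card S *\<^sub>R block_ones S \<in> bounded_ops"
    by (intro bounded_ops_compose bounded_ops_scaleR block_ones_bounded)+
  fix p q
  have *: "coef (block_ones S o\<^sub>L block_ones S) p q =
      (\<Sum>s\<in>(\<lambda>a. pt a (cpy q)) ` S. coef (block_ones S) p s * coef (block_ones S) s q)"
  proof (rule coef_compose)
    show "coef (block_ones S) s q = 0" if "s \<notin> (\<lambda>a. pt a (cpy q)) ` S" for s
      using that by (auto simp: coef_block_ones[OF S(1)] image_iff)
  qed (use S in auto)
  show "coef (block_ones S o\<^sub>L block_ones S) p q = coef (card S *\<^sub>R block_ones S) p q"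
    unfolding * by (subst sum.reindex) (auto simp: inj_on_def coef_block_ones[OF S(1)])
qed

lemma projection_block_ones: "projection_op ((1 / card S) *\<^sub>R block_ones S)"
  unfolding projection_op_def
proof (intro conjI)
  let ?p = "(1 / card S) *\<^sub>R block_ones S"
  show b: "?p \<in> bounded_ops" by (intro bounded_ops_scaleR block_ones_bounded)
  show "adj ?p = ?p"
    by (rule op_eqI[OF adj_bounded[OF b] b]) (auto simp: coef_adj[OF b] coef_block_ones[OF S(1)])
  have "?p o\<^sub>L ?p = (1 / card S * (1 / card S)) *\<^sub>R (block_ones S o\<^sub>L block_ones S)"
    by (rule blinfun_eqI) (simp add: blinfun.scaleR_left blinfun.scaleR_right)
  then show "?p o\<^sub>L ?p = ?p"
    using S by (simp add: block_ones_compose)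
qed

lemma block_ones_eq: "block_ones S = real (card S) *\<^sub>R ((1 / card S) *\<^sub>R block_ones S)"
  using S by simp

lemma positive_block_ones: "positive_op (block_ones S)"
  by (subst block_ones_eq) (intro positive_scaleR_projection projection_block_ones, simp)

text \<open>The normalised operator is a projection fixing the constant vector u, so it can be
  inserted in <u, z> before Cauchy-Schwarz. Only an inequality holds, because the right side also
  sees the other copies.\<close>

lemma cinner_ones_le: "(cmod (cinner (vec S c (\<lambda>_. 1)) z))\<^sup>2 \<le> Re (cinner z (block_ones S z))"
proof -
  let ?u = "vec S c (\<lambda>_. 1)" and ?p = "(1 / card S) *\<^sub>R block_ones S"
  note p = projection_block_ones
  have N: "real (card S) > 0" using S by (simp add: card_gt_0_iff)
  have "block_ones S ?u = real (card S) *\<^sub>R ?u"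
  proof (rule ell2_eqI)
    fix q
    have "ell2_nth (block_ones S ?u) q = (\<Sum>a\<in>S. coef (block_ones S) q (pt a c))"
      by (simp add: vec_def blinfun.sum_right bounded_opsD[OF block_ones_bounded] nth_sum_ell2
          scaleC_ell2.rep_eq coef_def)
    then show "ell2_nth (block_ones S ?u) q = ell2_nth (real (card S) *\<^sub>R ?u) q"
      using S by (simp add: coef_block_ones scaleR_ell2.rep_eq nth_vec scaleR_conv_of_real)
  qed
  then have "?p ?u = ?u" using N by (simp add: blinfun.scaleR_left)
  then have "cinner ?u z = cinner ?u (?p z)"
    using projection_op_simps(3)[OF p, of ?u z] by simp
  then have "(cmod (cinner ?u z))\<^sup>2 \<le> (norm ?u * norm (?p z))\<^sup>2"
    using norm_cinner_le[of ?u "?p z"] by (simp add: power_mono)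
  also have "\<dots> = real (card S) * (norm (?p z))\<^sup>2"
    by (simp add: power_mult_distrib norm_vec[OF S(1)])
  also have "\<dots> = real (card S) * Re (cinner z (?p z))"
    unfolding projection_op_norm_sq[OF p] by (simp flip: of_real_power)
  also have "\<dots> = Re (cinner z (block_ones S z))"
    using N by (simp add: blinfun.scaleR_left cinner_scaleR_right)
  finally show ?thesis .
qed

text \<open>All summands Q_r x Q_r of the pinching are positive, so the pinching dominates the one
  with r = s. Pairing with the indicator of \<open>T\<close> is pairing Q_s y with the constant
  vector of \<open>S\<close>.\<close>

lemma cinner_class_le:
  assumes T: "T = {a. \<sigma> a = s}" "T \<subseteq> S"
  shows "(cmod (cinner (vec T c (\<lambda>_. 1)) y))\<^sup>2 \<le> Re (cinner y (pinch \<sigma> (block_ones S) y))"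
proof -
  let ?x = "block_ones S"
  let ?g = "\<lambda>t. Re (cinner (cut (cls \<sigma> t) y) (?x (cut (cls \<sigma> t) y)))"
  have "cinner (vec T c (\<lambda>_. 1)) y = (\<Sum>a\<in>T. ell2_nth y (pt a c))"
    by (simp add: cinner_vec)
  also have "\<dots> = (\<Sum>a\<in>S. ell2_nth (cut (cls \<sigma> s) y) (pt a c))"
    by (rule sum.mono_neutral_cong_left) (use S T in \<open>auto simp: cls_def\<close>)
  also have "\<dots> = cinner (vec S c (\<lambda>_. 1)) (cut (cls \<sigma> s) y)"
    by (simp add: cinner_vec)
  finally have "(cmod (cinner (vec T c (\<lambda>_. 1)) y))\<^sup>2 \<le> ?g s"
    using cinner_ones_le by simp
  also have "\<dots> \<le> Re (cinner y (pinch \<sigma> ?x y))"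
  proof -
    have h: "(?g has_sum Re (cinner y (pinch \<sigma> ?x y))) UNIV"
      by (rule has_sum_Re[OF has_sum_cinner_pinch[OF block_ones_bounded]])
    have "sum ?g {s} \<le> infsum ?g UNIV"
      by (rule finite_sum_le_infsum[OF has_sum_imp_summable[OF h]])
        (use positive_block_ones in \<open>auto simp: positive_op_def complex_nonneg_Reals_iff\<close>)
    then show ?thesis by (simp add: infsumI[OF h])
  qed
  finally show ?thesis .
qed

text \<open>With y = e u one has |y|^4 = |<u, y>|^2 <= <y, E(x) y> = <y, e E(x) e y> <= l |y|^2, and
  |y|^2 is cancelled.\<close>

lemma norm_projection_class_le:
  assumes e: "projection_op e" and T: "T = {a. \<sigma> a = s}" "T \<subseteq> S"
    and le: "norm (e o\<^sub>L pinch \<sigma> (block_ones S) o\<^sub>L e) \<le> l"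
  shows "(norm (e (vec T c (\<lambda>_. 1))))\<^sup>2 \<le> l"
proof -
  let ?u = "vec T c (\<lambda>_. 1)" and ?G = "pinch \<sigma> (block_ones S)"
  let ?n = "norm (e ?u)"
  have "(?n\<^sup>2)\<^sup>2 = (cmod (cinner ?u (e ?u)))\<^sup>2"
    by (simp add: projection_op_norm_sq[OF e] norm_power)
  also have "\<dots> \<le> Re (cinner (e ?u) (?G (e ?u)))"
    by (rule cinner_class_le[OF T])
  also have "\<dots> = Re (cinner (e ?u) ((e o\<^sub>L ?G o\<^sub>L e) (e ?u)))"
    by (simp add: projection_op_simps(2)[OF e] flip: projection_op_simps(3)[OF e])
  also have "\<dots> \<le> norm (e o\<^sub>L ?G o\<^sub>L e) * (?n * ?n)"
    using cmod_cinner_op_le[of "e ?u" "e o\<^sub>L ?G o\<^sub>L e" "e ?u"] complex_Re_le_cmod order_trans by blast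
  also have "\<dots> \<le> l * ?n\<^sup>2"
    using le by (simp add: power2_eq_square mult_right_mono)
  finally have "?n\<^sup>2 * ?n\<^sup>2 \<le> l * ?n\<^sup>2" by (simp add: power2_eq_square)
  moreover have "0 \<le> l" using le norm_ge_zero order_trans by blast
  ultimately show ?thesis
    by (cases "?n = 0") (simp, rule mult_right_le_imp_le[of _ "?n\<^sup>2"], simp_all)
qed

end

end

context weighted_grid
begin

text \<open>The all-ones matrix is its own modulus and has spectral atoms only at 0 and
  \<open>card S\<close>; the former is removed by \<open>\<Psi> 0 = 0\<close>. The constant
  \<open>C\<close> belongs to the whole algebra and is thus the same for every block.\<close>

lemma weak_type_block:
  assumes wt: "\<forall>x\<in>block_alg \<rho>. positive_op x \<longrightarrow> (\<forall>r>0. \<forall>a P. modulus_op x a \<longrightarrow> spectral_measure a P \<longrightarrow>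
        (\<exists>e\<in>block_alg \<rho>. projection_op e \<and>
           (\<forall>n m. norm (e o\<^sub>L pinch (\<sigma> n m) x o\<^sub>L e) \<le> r) \<and>
           ennreal (Re (tr (id_blinfun - e))) \<le> (\<integral>\<^sup>+t. \<Psi> (C * t / r) \<partial>scalar_measure tr P)))"
    and S_def: "S = {a. \<rho> a = r}" and S: "finite S" "S \<noteq> {}"
    and w: "\<And>a. a \<in> S \<Longrightarrow> w a = \<omega>" and \<Psi>: "\<Psi> 0 = 0" and l: "l > 0"
  obtains e where "e \<in> block_alg \<rho>" "projection_op e"
    "\<And>n m s. {a. \<sigma> n m a = s} \<subseteq> S \<Longrightarrow> (norm (e (vec {a. \<sigma> n m a = s} c0 (\<lambda>_. 1))))\<^sup>2 \<le> l"
    "ennreal (\<Sum>a\<in>S. 1 - Re (coef e (pt a c0) (pt a c0))) \<le> \<Psi> (C * card S / l)"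
proof -
  let ?x = "block_ones S" and ?N = "real (card S)"
  let ?p = "(1 / ?N) *\<^sub>R ?x"
  let ?P = "two_point ?N ?p"
  note ones = S_def S
  have N: "?N > 0" using S by (simp add: card_gt_0_iff)
  have \<omega>: "\<omega> > 0" using w w_pos S by blast
  note p = projection_block_ones[OF ones]
  have "spectral_measure ?x ?P"
    using spectral_measure_two_point[OF p, of ?N] N by simp
  from wt[rule_format, OF block_ones_block_alg[OF ones] positive_block_ones[OF ones] l
      modulus_positive[OF positive_block_ones[OF ones]] this]
  obtain e where e: "e \<in> block_alg \<rho>" "projection_op e"
    "\<And>n m. norm (e o\<^sub>L pinch (\<sigma> n m) ?x o\<^sub>L e) \<le> l"
    "ennreal (Re (tr (id_blinfun - e))) \<le> (\<integral>\<^sup>+t. \<Psi> (C * t / l) \<partial>scalar_measure tr ?P)"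
    by blast
  have tr_nonneg: "Re (tr q) \<ge> 0" if "projection_op q" for q
    using tr_positive(2)[OF positive_scaleR_projection[OF that, of 1]] by simp
  \<comment> \<open>A minimal projection has rank one within the block, so its trace is the weight
    of one index, independently of \<open>card S\<close>.\<close>
  have trp: "Re (tr ?p) = \<omega>"
  proof (rule has_sum_unique[OF Re_tr_has_sum])
    have "(\<Sum>a\<in>S. w a * Re (coef ?p (pt a c0) (pt a c0))) = (\<Sum>a\<in>S. \<omega> / ?N)"
      using w by (intro sum.cong) (auto simp: coef_block_ones[OF S(1)] Re_divide_of_nat)
    then have *: "(\<Sum>a\<in>S. w a * Re (coef ?p (pt a c0) (pt a c0))) = \<omega>" using N by simp
    show "((\<lambda>a. w a * Re (coef ?p (pt a c0) (pt a c0))) has_sum \<omega>) UNIV"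
      by (rule has_sum_finite_neutralI[OF S(1) _ _ *[symmetric]]) (auto simp: coef_block_ones[OF S(1)])
  qed
  have tr0: "tr 0 = 0" by (rule tr_eqI) simp
  have trP: "Re (tr (?P B)) = (if ?N \<in> B then \<omega> else 0) + (if 0 \<in> B then Re (tr (id_blinfun - ?p)) else 0)" for B
    by (simp add: two_point_def tr_plus trp tr0)
  have "(\<integral>\<^sup>+t. \<Psi> (C * t / l) \<partial>scalar_measure tr ?P) = \<Psi> (C * ?N / l) * ennreal \<omega>"
    using two_point_nn_integral[OF _ _ _ trP, of "\<lambda>t. \<Psi> (C * t / l)"] N \<omega>
      tr_nonneg[OF projection_op_complement[OF p]] by (simp add: \<Psi>)
  moreover have "\<omega> * (\<Sum>a\<in>S. 1 - Re (coef e (pt a c0) (pt a c0))) \<le> Re (tr (id_blinfun - e))"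
  proof -
    let ?g = "\<lambda>a. w a * Re (coef (id_blinfun - e) (pt a c0) (pt a c0))"
    note q = projection_op_complement[OF e(2)]
    have pos: "Re (coef (id_blinfun - e) (pt a c0) (pt a c0)) \<ge> 0" for a
      using positive_coef(2)[OF positive_scaleR_projection[OF q, of 1]] by simp
    have "\<omega> * (\<Sum>a\<in>S. 1 - Re (coef e (pt a c0) (pt a c0))) = sum ?g S"
      unfolding sum_distrib_left using w by (intro sum.cong) auto
    also have "\<dots> \<le> infsum ?g UNIV"
      by (rule finite_sum_le_infsum[OF has_sum_imp_summable[OF Re_tr_has_sum] S(1)])
        (use pos less_imp_le[OF w_pos] in auto)
    also have "\<dots> = Re (tr (id_blinfun - e))" by (rule infsumI[OF Re_tr_has_sum])
    finally show ?thesis .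
  qed
  ultimately have "ennreal (\<omega> * (\<Sum>a\<in>S. 1 - Re (coef e (pt a c0) (pt a c0)))) \<le> \<Psi> (C * ?N / l) * ennreal \<omega>"
    using order_trans[OF ennreal_leI e(4)] by simp
  then have "ennreal \<omega> * ennreal (\<Sum>a\<in>S. 1 - Re (coef e (pt a c0) (pt a c0))) \<le> ennreal \<omega> * \<Psi> (C * ?N / l)"
    using \<omega> by (simp add: ennreal_mult' mult.commute)
  then have "ennreal (\<Sum>a\<in>S. 1 - Re (coef e (pt a c0) (pt a c0))) \<le> \<Psi> (C * ?N / l)"
    using \<omega> by (subst (asm) ennreal_mult_le_mult_iff) auto
  moreover have "(norm (e (vec {a. \<sigma> n m a = s} c0 (\<lambda>_. 1))))\<^sup>2 \<le> l" if "{a. \<sigma> n m a = s} \<subseteq> S" for n m s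
    by (rule norm_projection_class_le[OF ones e(2) refl that e(3)])
  ultimately show thesis
    by (intro that[OF e(1,2)])
qed

end

section \<open>Asymptotics\<close>

lemma sum_orthonormal:
  fixes W :: "'i \<Rightarrow> 'n \<Rightarrow> real" and z :: "'i \<Rightarrow> complex"
  assumes I: "finite I" and W: "\<And>i j. i \<in> I \<Longrightarrow> j \<in> I \<Longrightarrow> (\<Sum>n\<in>N. W i n * W j n) = (if i = j then 1 else 0)"
  shows "(\<Sum>n\<in>N. (cmod (\<Sum>i\<in>I. z i * W i n))\<^sup>2) = (\<Sum>i\<in>I. (cmod (z i))\<^sup>2)"
proof -
  have "complex_of_real (\<Sum>n\<in>N. (cmod (\<Sum>i\<in>I. z i * W i n))\<^sup>2) =
      (\<Sum>n\<in>N. \<Sum>i\<in>I. \<Sum>j\<in>I. (z i * cnj (z j)) * complex_of_real (W i n * W j n))"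
    by (simp add: complex_norm_square sum_product cnj_sum mult_ac del: of_real_power)
  also have "\<dots> = (\<Sum>i\<in>I. \<Sum>j\<in>I. \<Sum>n\<in>N. (z i * cnj (z j)) * complex_of_real (W i n * W j n))"
    by (rule trans[OF sum.swap sum.cong[OF refl sum.swap]])
  also have "\<dots> = (\<Sum>i\<in>I. \<Sum>j\<in>I. if j = i then z i * cnj (z i) else 0)"
  proof (intro sum.cong refl)
    fix i j assume "i \<in> I" "j \<in> I"
    have "(\<Sum>n\<in>N. (z i * cnj (z j)) * complex_of_real (W i n * W j n)) =
        (z i * cnj (z j)) * complex_of_real (\<Sum>n\<in>N. W i n * W j n)"
      by (simp only: sum_distrib_left of_real_sum)
    then show "(\<Sum>n\<in>N. (z i * cnj (z j)) * complex_of_real (W i n * W j n)) =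
        (if j = i then z i * cnj (z i) else 0)"
      by (simp only: W[OF \<open>i \<in> I\<close> \<open>j \<in> I\<close>]) simp
  qed
  also have "\<dots> = complex_of_real (\<Sum>i\<in>I. (cmod (z i))\<^sup>2)"
    using I by (simp add: sum.delta complex_norm_square del: of_real_power)
  finally show ?thesis by (simp only: of_real_eq_iff)
qed

lemma log_squared_sequence_bound:
  fixes \<delta> :: "nat \<Rightarrow> real"
  assumes \<delta>: "\<And>\<epsilon>. \<epsilon> > 0 \<Longrightarrow> \<exists>m0. \<forall>m\<ge>m0. \<delta> m \<le> \<epsilon> * (real m)\<^sup>2" and c: "c > 0"
  shows "\<exists>L\<ge>2. real (2 * L + 1) * (1 + 2 * (\<Sum>m\<in>{1..2 * L}. \<delta> m)) < c * real L ^ 4"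
proof -
  \<comment> \<open>The leading term is at most 3 L * 2 * 8 eps L^3 = 48 eps L^4, so this choice
    uses exactly half of c L^4.\<close>
  define \<epsilon> where "\<epsilon> = c / 96"
  have \<epsilon>: "\<epsilon> > 0" using c by (simp add: \<epsilon>_def)
  obtain m0 where m0: "\<And>m. m \<ge> m0 \<Longrightarrow> \<delta> m \<le> \<epsilon> * (real m)\<^sup>2" using \<delta>[OF \<epsilon>] by blast
  define A where "A = (\<Sum>m<m0. \<bar>\<delta> m\<bar>)"
  have A: "A \<ge> 0" by (simp add: A_def sum_nonneg)
  have sum: "(\<Sum>m\<in>{1..2 * L}. \<delta> m) \<le> A + 8 * \<epsilon> * real L ^ 3" for L
  proof -
    have "(\<Sum>m\<in>{1..2 * L}. \<delta> m) \<le> (\<Sum>m\<in>{1..2 * L}. (if m < m0 then \<bar>\<delta> m\<bar> else 0) + \<epsilon> * (real (2 * L))\<^sup>2)"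
    proof (rule sum_mono)
      fix m assume m: "m \<in> {1..2 * L}"
      have "\<epsilon> * (real m)\<^sup>2 \<le> \<epsilon> * (real (2 * L))\<^sup>2"
        using m \<epsilon> by (intro mult_left_mono power_mono) auto
      moreover have "0 \<le> \<epsilon> * (real (2 * L))\<^sup>2" using \<epsilon> by simp
      ultimately show "\<delta> m \<le> (if m < m0 then \<bar>\<delta> m\<bar> else 0) + \<epsilon> * (real (2 * L))\<^sup>2"
        using m0[of m] by (cases "m < m0") auto
    qed
    also have "\<dots> = (\<Sum>m\<in>{1..2 * L}. if m < m0 then \<bar>\<delta> m\<bar> else 0) + 8 * \<epsilon> * real L ^ 3"
      by (simp add: sum.distrib power2_eq_square power3_eq_cube)
    also have "(\<Sum>m\<in>{1..2 * L}. if m < m0 then \<bar>\<delta> m\<bar> else 0) = (\<Sum>m\<in>{1..2 * L} \<inter> {..<m0}. \<bar>\<delta> m\<bar>)"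
      by (simp add: sum.inter_restrict)
    also have "\<dots> \<le> A"
      unfolding A_def by (rule sum_mono2) auto
    finally show ?thesis by simp
  qed
  \<comment> \<open>The second bound absorbs the finitely many uncontrolled terms, collected in
    \<open>A\<close>, into the other half of c L^4.\<close>
  obtain L :: nat where L: "real L > max 2 (6 * (1 + 2 * A) / c)"
    using reals_Archimedean2 by blast
  have L2: "L \<ge> 2" and L1: "real L \<ge> 1" and La: "3 * (1 + 2 * A) < c / 2 * real L"
    using L c by (auto simp: field_simps)
  have "real (2 * L + 1) * (1 + 2 * (\<Sum>m\<in>{1..2 * L}. \<delta> m)) \<le> real (2 * L + 1) * (1 + 2 * (A + 8 * \<epsilon> * real L ^ 3))"
    using sum[of L] by (intro mult_left_mono) auto
  also have "\<dots> \<le> (3 * real L) * (1 + 2 * (A + 8 * \<epsilon> * real L ^ 3))"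
    using A \<epsilon> L1 by (intro mult_right_mono) auto
  also have "\<dots> = 3 * (1 + 2 * A) * real L + c / 2 * real L ^ 4"
    by (simp add: \<epsilon>_def algebra_simps power4_eq_xxxx power3_eq_cube)
  also have "\<dots> < c / 2 * real L * real L + c / 2 * real L ^ 4"
    using La L1 by (intro add_strict_right_mono mult_strict_right_mono) auto
  also have "\<dots> \<le> c / 2 * real L ^ 4 + c / 2 * real L ^ 4"
  proof -
    have "(real L) ^ 2 \<le> (real L) ^ 4" using L1 by (intro power_increasing) auto
    then have "c / 2 * real L ^ 2 \<le> c / 2 * real L ^ 4" using c by (intro mult_left_mono) auto
    then show ?thesis by (simp add: power2_eq_square)
  qed
  finally show ?thesis using L2 by (intro exI[of _ L]) (simp add: field_simps)
qed

lemma young_dyadic_bound: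
  fixes \<Psi> :: "real \<Rightarrow> ennreal"
  assumes lim: "((\<lambda>s. \<Psi> s / ennreal (s * (1 + log_plus s)\<^sup>2)) \<longlongrightarrow> 0) at_top" and \<Psi>0: "\<Psi> 0 = 0"
    and C: "C \<ge> 0" and \<epsilon>: "\<epsilon> > 0"
  shows "\<exists>m0. \<forall>m\<ge>m0. enn2real (\<Psi> (C * 2 ^ m)) / 2 ^ m \<le> \<epsilon> * (real m)\<^sup>2"
proof (cases "C = 0")
  case False
  then have C: "C > 0" using C by simp
  \<comment> \<open>For m >= 1 this gives 1 + \<open>log_plus (C * 2 ^ m)\<close> <= 1 + |ln C| + m
    <= K m; the constant \<eta> is then chosen with \<eta> C K^2 = \<epsilon>.\<close>
  define K where "K = 2 + \<bar>ln C\<bar>"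
  have K: "K > 0" by (simp add: K_def)
  define \<eta> where "\<eta> = \<epsilon> / (C * K\<^sup>2)"
  have \<eta>: "\<eta> > 0" using \<epsilon> C K by (simp add: \<eta>_def)
  have "\<forall>\<^sub>F s in at_top. \<Psi> s / ennreal (s * (1 + log_plus s)\<^sup>2) < ennreal \<eta>"
    using \<eta> by (intro order_tendstoD(2)[OF lim]) simp
  then obtain s0 where s0: "\<And>s. s \<ge> s0 \<Longrightarrow> \<Psi> s / ennreal (s * (1 + log_plus s)\<^sup>2) < ennreal \<eta>"
    by (auto simp: eventually_at_top_linorder)
  obtain m0 :: nat where m0: "s0 / C < 2 ^ m0"
    using real_arch_pow[of 2 "s0 / C"] by auto
  show ?thesis
  proof (intro exI allI impI)
    fix m assume m: "m \<ge> max m0 1"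
    define s where "s = C * 2 ^ m"
    define b where "b = s * (1 + log_plus s)\<^sup>2"
    have s: "s > 0" using C by (simp add: s_def)
    have lp: "log_plus s \<ge> 0" by (simp add: log_plus_def)
    have b: "b > 0" using s lp by (simp add: b_def add_pos_nonneg)
    have "(2::real) ^ m0 \<le> 2 ^ m" using m by (intro power_increasing) auto
    with m0 have "s0 / C \<le> 2 ^ m" by linarith
    then have "s0 \<le> s" using C by (simp add: s_def field_simps)
    then have lt: "\<Psi> s / ennreal b < ennreal \<eta>" using s0 by (simp add: b_def)
    have "\<Psi> s = \<Psi> s / ennreal b * ennreal b"
      unfolding ennreal_divide_times using b by (simp add: ennreal_divide_self)
    also have "\<dots> \<le> ennreal \<eta> * ennreal b"
      using lt by (intro mult_right_mono) auto
    also have "\<dots> = ennreal (\<eta> * b)" using \<eta> b by (simp add: ennreal_mult)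
    finally have "\<Psi> s \<le> ennreal (\<eta> * b)" .
    then have "enn2real (\<Psi> s) \<le> enn2real (ennreal (\<eta> * b))"
      by (rule enn2real_mono) simp
    also have "\<dots> = \<eta> * b"
      using \<eta> b by simp
    also have "\<dots> \<le> \<eta> * (s * (K * real m)\<^sup>2)"
    proof -
      have "ln s = ln C + m * ln 2" using C by (simp add: s_def ln_mult ln_realpow)
      moreover have "m * ln 2 \<le> real m * 1" using ln_2_less_1 by (intro mult_left_mono) auto
      ultimately have "log_plus s \<le> \<bar>ln C\<bar> + m" by (auto simp: log_plus_def)
      moreover have "\<bar>ln C\<bar> * 1 \<le> \<bar>ln C\<bar> * m" using m by (intro mult_left_mono) auto
      ultimately have "1 + log_plus s \<le> K * real m"
        using m by (simp add: K_def algebra_simps)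
      then have "(1 + log_plus s)\<^sup>2 \<le> (K * real m)\<^sup>2" using lp by (intro power_mono) auto
      then show ?thesis unfolding b_def using \<eta> s by (intro mult_left_mono) auto
    qed
    also have "\<dots> = \<epsilon> * (real m)\<^sup>2 * 2 ^ m"
      using C K by (simp add: \<eta>_def s_def power_mult_distrib)
    finally show "enn2real (\<Psi> (C * 2 ^ m)) / 2 ^ m \<le> \<epsilon> * (real m)\<^sup>2"
      by (simp add: s_def divide_le_eq)
  qed
qed (use \<epsilon> \<Psi>0 in auto)

section \<open>The counterexample\<close>

text \<open>
  Indices are pairs \<open>(k, i)\<close>, and \<open>i < k\<close> ranges over the \<open>k\<close>-th matrix block; the remaining indices
  are blocks of size one. \<open>corner n\<close> keeps the upper left \<open>n \<times> n\<close> corner of each block and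
  splits the rest of the block into its diagonal.
\<close>

definition blocks :: "nat \<times> nat \<Rightarrow> nat \<times> nat" where
  "blocks a = (if snd a < fst a then (fst a, 0) else a)"

definition corner :: "nat \<Rightarrow> nat \<times> nat \<Rightarrow> nat \<times> nat" where
  "corner n a = (if snd a < min (fst a) n then (fst a, 0) else a)"

lemma finite_blocks: "finite {a. blocks a = r}"
  by (rule finite_subset[of _ "{fst r} \<times> {..max (fst r) (snd r)}"])
    (auto simp: blocks_def less_imp_le split: if_splits)

lemma finite_corner: "finite {a. corner n a = r}"
  by (rule finite_subset[of _ "{fst r} \<times> {..max (fst r) (snd r)}"])
    (auto simp: corner_def less_imp_le split: if_splits)

lemma corner_Suc: "corner n a = corner n b \<Longrightarrow> corner (Suc n) a = corner (Suc n) b"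
  by (auto simp: corner_def split: if_splits)

lemma corner_blocks: "corner n a = corner n b \<Longrightarrow> blocks a = blocks b"
  by (auto simp: corner_def blocks_def split: if_splits)

lemma corner_eventually: "\<forall>\<^sub>F n in sequentially. \<forall>b. blocks b = blocks a \<longrightarrow> corner n b = corner n a"
  by (rule eventually_sequentiallyI[of "fst a"]) (auto simp: corner_def blocks_def split: if_splits)

text \<open>The maximum makes the weight constant for i < k, while it still decays along the
  singletons i >= k; the product of two geometric sequences dominates it.\<close>

definition block_weight :: "nat \<times> nat \<Rightarrow> real" where
  "block_weight a = (1/2) ^ fst a * (1/2) ^ max (fst a) (snd a)"

lemma block_weight_blocks: "blocks a = blocks b \<Longrightarrow> block_weight a = block_weight b"
  by (auto simp: block_weight_def blocks_def max_def split: if_splits)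

lemma block_weight_summable: "block_weight summable_on UNIV"
proof (rule summable_on_comparison_test)
  have h: "((\<lambda>n. (1/2 :: real) ^ n) has_sum 2) UNIV"
  proof -
    have "(\<lambda>n. (1/2 :: real) ^ n) sums 2" using geometric_sums[of "1/2 :: real"] by simp
    then show ?thesis by (intro sums_nonneg_imp_has_sum) auto
  qed
  have "(\<lambda>n. norm ((1/2 :: real) ^ n)) summable_on UNIV"
    using has_sum_imp_summable[OF h] by simp
  from has_sum_product_abs[OF h this h this]
  show "(\<lambda>a. (1/2) ^ fst a * (1/2) ^ snd a :: real) summable_on UNIV"
    by (rule has_sum_imp_summable)
  show "block_weight a \<le> (1/2) ^ fst a * (1/2) ^ snd a" for a
    unfolding block_weight_def by (intro mult_left_mono power_decreasing) auto
qed (simp add: block_weight_def)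

definition normalized_weight :: "nat \<times> nat \<Rightarrow> real" where
  "normalized_weight a = block_weight a / infsum block_weight UNIV"

lemma normalized_weight: "normalized_weight a > 0" "(normalized_weight has_sum 1) UNIV"
proof -
  have pos: "block_weight a > 0" for a by (simp add: block_weight_def)
  have "block_weight (0, 0) \<le> infsum block_weight UNIV"
    using finite_sum_le_infsum[OF block_weight_summable, of "{(0, 0)}"] pos by (auto simp: less_imp_le)
  with pos[of "(0, 0)"] have W: "infsum block_weight UNIV > 0" by linarith
  then show "normalized_weight a > 0" using pos by (simp add: normalized_weight_def)
  show "(normalized_weight has_sum 1) UNIV"
    using has_sum_cmult_left[OF has_sum_infsum[OF block_weight_summable], of "1 / infsum block_weight UNIV"] W
    by (simp add: normalized_weight_def[abs_def])
qed

lemma normalized_weight_blocks: "blocks a = blocks b \<Longrightarrow> normalized_weight a = normalized_weight b"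
  using block_weight_blocks[of a b] by (simp add: normalized_weight_def)

text \<open>An infinite cardinal absorbs a countable factor. The resulting bijection between pairs
  and \<open>'a\<close> lets \<open>'a\<close> itself label the copies.\<close>

lemma grid_exists:
  includes cardinal_syntax
  assumes "infinite (UNIV :: 'a set)"
  obtains idx :: "'a \<Rightarrow> nat \<times> nat" and cpy :: "'a \<Rightarrow> 'a" and pt where "grid idx cpy pt"
proof -
  obtain g :: "nat \<Rightarrow> 'a" where g: "inj g"
    using infinite_countable_subset[OF assms] by blast
  then have "inj (g \<circ> (to_nat :: nat \<times> nat \<Rightarrow> nat))" by (intro inj_compose) auto
  then have "|UNIV :: (nat \<times> nat) set| \<le>o |UNIV :: 'a set|"
    by (subst card_of_ordLeq[symmetric]) auto
  then have "|(UNIV :: 'a set) \<times> (UNIV :: (nat \<times> nat) set)| =o |UNIV :: 'a set|"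
    using card_of_Times_infinite[OF assms, of "UNIV :: (nat \<times> nat) set"] by auto
  then obtain h where h: "bij_betw h ((UNIV :: 'a set) \<times> (UNIV :: (nat \<times> nat) set)) (UNIV :: 'a set)"
    using card_of_ordIso by blast
  then have bij: "bij h" by simp
  show thesis
    by (rule that[of "\<lambda>p. snd (inv h p)" "\<lambda>p. fst (inv h p)" "\<lambda>a c. h (c, a)"], unfold_locales)
      (simp_all add: inv_f_f[OF bij_is_inj[OF bij]] surj_f_inv_f[OF bij_is_surj[OF bij]])
qed

section \<open>The inequality on the block of size \<open>2 ^ L\<close> in each factor, and the
  contradiction\<close>

locale double_block_grid = weighted_grid idx cpy pt w c0
  for idx :: "'p \<Rightarrow> (nat \<times> nat) \<times> (nat \<times> nat)" and cpy :: "'p \<Rightarrow> 'c" and pt w c0 +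
  assumes w_def: "w a = normalized_weight (fst a) * normalized_weight (snd a)"
begin

text \<open>Both sides bound the sum of squared pairings on one block: the left by the triangular
  truncation in each parameter, the right by \<open>sum_pairing_le\<close> at the levels
  \<open>2 ^ j\<close>. Since \<open>C\<close> is fixed before \<open>L\<close>, the size can be
  chosen large afterwards.\<close>

lemma dyadic_inequality:
  fixes \<Psi> :: "real \<Rightarrow> ennreal"
  assumes wt: "strong_maximal_weak_type (block_alg (map_prod blocks blocks)) tr
      (\<lambda>n m. pinch (map_prod (corner n) (corner m))) \<Psi>"
    and \<Psi>: "\<Psi> 0 = 0" "\<And>s. s \<ge> 0 \<Longrightarrow> \<Psi> s < \<infinity>"
  obtains C where "C \<ge> 0" "\<And>L. L \<ge> 2 \<Longrightarrow> (2 ^ L * (real L)\<^sup>2 / 512)\<^sup>2 \<le>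
    real (2 * L + 1) * (4 ^ L + (\<Sum>j<2 * L. 2 ^ Suc j * enn2real (\<Psi> (C * 2 ^ (2 * L - j)))))"
proof -
  obtain C where C: "C \<ge> 0" and
    wt': "\<forall>x\<in>block_alg (map_prod blocks blocks). positive_op x \<longrightarrow> (\<forall>r>0. \<forall>a P. modulus_op x a \<longrightarrow>
      spectral_measure a P \<longrightarrow> (\<exists>e\<in>block_alg (map_prod blocks blocks). projection_op e \<and>
        (\<forall>n m. norm (e o\<^sub>L pinch (map_prod (corner n) (corner m)) x o\<^sub>L e) \<le> r) \<and>
        ennreal (Re (tr (id_blinfun - e))) \<le> (\<integral>\<^sup>+t. \<Psi> (C * t / r) \<partial>scalar_measure tr P)))"
    using wt unfolding strong_maximal_weak_type_def by blast
  show thesis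
  proof (rule that[OF C])
    fix L :: nat assume L: "L \<ge> 2"
    \<comment> \<open>A power of two, so that the block has exactly \<open>2 ^ (2 * L)\<close>
      indices and the dyadic levels end at its size.\<close>
    define d :: nat where "d = 2 ^ L"
    define r where "r = ((d, 0 :: nat), (d, 0 :: nat))"
    define emb where "emb p = ((d, fst p), (d, snd p))" for p :: "nat \<times> nat"
    define S where "S = {a. map_prod blocks blocks a = r}"
    define W where "W = cosec_matrix d"
    define A where "A = {1..d} \<times> {1..d}"
    \<comment> \<open>Column t of the tensor product of W with itself.\<close>
    define f where "f t a = complex_of_real (W (snd (fst a)) (fst t) * W (snd (snd a)) (snd t))"
      for t :: "nat \<times> nat" and a :: "(nat \<times> nat) \<times> (nat \<times> nat)"
    \<comment> \<open>For t in A both sides are at least 1, so the corner contains the index (d, 0)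
      in each factor and its class has the same label \<open>r\<close> as the whole block.\<close>
    define U where "U t = {a. map_prod (corner (fst t)) (corner (snd t)) a = r}" for t
    have d: "d > 0" by (simp add: d_def)
    have inj: "inj emb" by (auto simp: inj_def emb_def)
    have S_emb: "S = emb ` ({..<d} \<times> {..<d})"
      using d by (auto simp: S_def blocks_def r_def emb_def image_iff split: if_splits)
    have U_emb: "U (n, m) = emb ` ({..<n} \<times> {..<m})" if "(n, m) \<in> A" for n m
      using d that by (auto simp: U_def corner_def r_def emb_def image_iff A_def split: if_splits)
    have S: "finite S" "S \<noteq> {}" using d by (auto simp: S_emb)
    have card_S: "card S = d * d"
      unfolding S_emb by (subst card_image) (auto intro: inj_on_subset[OF inj])
    then have card_S': "real (card S) = 2 ^ (2 * L)"
      by (simp add: d_def mult_2 power_add)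
    have US: "U t \<subseteq> S" if "t \<in> A" for t
      using that U_emb[of "fst t" "snd t"] by (auto simp: S_emb A_def)
    have finU: "finite (U t)" if "t \<in> A" for t
      using US[OF that] S(1) finite_subset by blast
    have orth: "(\<Sum>t\<in>A. (W (snd (fst a)) (fst t) * W (snd (snd a)) (snd t)) * (W (snd (fst b)) (fst t) * W (snd (snd b)) (snd t))) =
        (if a = b then 1 else 0)" if S: "a \<in> S" "b \<in> S" for a b
    proof -
      obtain i j i' j' where ab: "a = emb (i, j)" "b = emb (i', j')" "i < d" "j < d" "i' < d" "j' < d"
        using S by (auto simp: S_emb)
      have "(\<Sum>t\<in>A. (W (snd (fst a)) (fst t) * W (snd (snd a)) (snd t)) * (W (snd (fst b)) (fst t) * W (snd (snd b)) (snd t))) =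
          (\<Sum>n\<in>{1..d}. W i n * W i' n) * (\<Sum>m\<in>{1..d}. W j m * W j' m)"
        by (simp add: sum_product A_def sum.cartesian_product ab emb_def mult_ac case_prod_unfold)
      also have "\<dots> = (if i = i' then 1 else 0) * (if j = j' then 1 else 0)"
        unfolding W_def by (simp only: cosec_matrix_orthogonal ab)
      finally show ?thesis by (simp add: ab emb_def)
    qed
    have bessel: "(\<Sum>t\<in>A. (cmod (\<Sum>a\<in>S. z a * f t a))\<^sup>2) \<le> (\<Sum>a\<in>S. (cmod (z a))\<^sup>2)" for z
      unfolding f_def using sum_orthonormal[OF S(1) orth, of z] by simp
    have w: "w a = w r" if S: "a \<in> S" for a
    proof -
      obtain i j where a: "a = emb (i, j)" "i < d" "j < d" using S by (auto simp: S_emb)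
      have nw: "normalized_weight (d, k) = normalized_weight (d, 0)" if "k < d" for k
        by (rule normalized_weight_blocks) (use that in \<open>simp add: blocks_def\<close>)
      show ?thesis using nw[OF a(2)] nw[OF a(3)] by (simp add: a(1) w_def r_def emb_def)
    qed
    define Q where "Q j e \<longleftrightarrow> e \<in> block_alg (map_prod blocks blocks) \<and> projection_op e \<and>
        (\<forall>t\<in>A. (norm (e (vec (U t) c0 (\<lambda>_. 1))))\<^sup>2 \<le> 2 ^ j) \<and>
        ennreal (\<Sum>a\<in>S. 1 - Re (coef e (pt a c0) (pt a c0))) \<le> \<Psi> (C * card S / 2 ^ j)"
      for j :: nat and e :: "'p op"
    have "\<exists>e. Q j e" for j
    proof (rule weak_type_block[OF wt' S_def S w \<Psi>(1), where l = "2 ^ j"])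
      fix e assume e: "e \<in> block_alg (map_prod blocks blocks)" "projection_op e"
        "\<And>n m s. {a. map_prod (corner n) (corner m) a = s} \<subseteq> S \<Longrightarrow>
          (norm (e (vec {a. map_prod (corner n) (corner m) a = s} c0 (\<lambda>_. 1))))\<^sup>2 \<le> 2 ^ j"
        "ennreal (\<Sum>a\<in>S. 1 - Re (coef e (pt a c0) (pt a c0))) \<le> \<Psi> (C * card S / 2 ^ j)"
      have "(norm (e (vec (U t) c0 (\<lambda>_. 1))))\<^sup>2 \<le> 2 ^ j" if "t \<in> A" for t
        using e(3)[OF US[OF that, unfolded U_def]] unfolding U_def .
      with e(1,2,4) show ?thesis unfolding Q_def by blast
    qed (assumption, rule zero_less_power, rule zero_less_numeral)
    then have "\<forall>j. \<exists>e. Q j e" ..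
    from choice[OF this] obtain e0 where "\<forall>j. Q j (e0 j)" ..
    then have e0: "\<And>j. e0 j \<in> block_alg (map_prod blocks blocks)" "\<And>j. projection_op (e0 j)"
        "\<And>j t. t \<in> A \<Longrightarrow> (norm (e0 j (vec (U t) c0 (\<lambda>_. 1))))\<^sup>2 \<le> 2 ^ j"
        "\<And>j. ennreal (\<Sum>a\<in>S. 1 - Re (coef (e0 j) (pt a c0) (pt a c0))) \<le> \<Psi> (C * card S / 2 ^ j)"
      by (simp_all add: Q_def)
    \<comment> \<open>From level \<open>2 * L\<close> on the identity is admissible, because the
      indicator of a corner has squared norm at most \<open>card S\<close>.\<close>
    define e where "e j = (if j < 2 * L then e0 j else id_blinfun)" for j
    have e: "projection_op (e j)" "e j \<in> block_alg (map_prod blocks blocks)" for j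
      by (simp_all add: e_def e0 projection_op_id block_alg_id)
    have u: "(norm (e j (vec (U t) c0 (\<lambda>_. 1))))\<^sup>2 \<le> 2 ^ j" if "j \<le> 2 * L" "t \<in> A" for j t
    proof (cases "j < 2 * L")
      case False
      have "(norm (vec (U t) c0 (\<lambda>_. 1)))\<^sup>2 = real (card (U t))"
        by (simp add: norm_vec[OF finU[OF that(2)]])
      also have "\<dots> \<le> real (card S)"
        using card_mono[OF S(1) US[OF that(2)]] by simp
      finally show ?thesis using False that(1) card_S' by (simp add: e_def)
    qed (simp add: e_def e0 that)
    have "(\<Sum>t\<in>A. (cmod (cinner (vec (U t) c0 (\<lambda>_. 1)) (vec S c0 (f t))))\<^sup>2) \<le> real (Suc (2 * L)) *
        ((2::real) ^ 0 * real (card S) + (\<Sum>j<2 * L. 2 ^ Suc j * (\<Sum>a\<in>S. 1 - Re (coef (e j) (pt a c0) (pt a c0)))))"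
      by (rule sum_pairing_le[OF S_def e S(1) bessel, where B = "\<lambda>j. 2 ^ j" and u = "\<lambda>t. vec (U t) c0 (\<lambda>_. 1)"]) (simp_all add: u, simp add: e_def)
    also have "\<dots> \<le> real (2 * L + 1) * (4 ^ L + (\<Sum>j<2 * L. 2 ^ Suc j * enn2real (\<Psi> (C * 2 ^ (2 * L - j)))))"
    proof -
      have "(\<Sum>a\<in>S. 1 - Re (coef (e j) (pt a c0) (pt a c0))) \<le> enn2real (\<Psi> (C * 2 ^ (2 * L - j)))" if "j < 2 * L" for j
      proof -
        let ?t = "\<Sum>a\<in>S. 1 - Re (coef (e j) (pt a c0) (pt a c0))"
        have "C * card S / 2 ^ j = C * 2 ^ (2 * L - j)"
          using that unfolding card_S' by (simp add: power_diff)
        then have "ennreal ?t \<le> \<Psi> (C * 2 ^ (2 * L - j))"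
          using e0(4)[of j] that by (simp add: e_def)
        \<comment> \<open>\<open>enn2real\<close> sends infinity to 0; it is monotone here because
          local finiteness keeps the right side finite.\<close>
        then have "enn2real (ennreal ?t) \<le> enn2real (\<Psi> (C * 2 ^ (2 * L - j)))"
          using \<Psi>(2)[of "C * 2 ^ (2 * L - j)"] C by (intro enn2real_mono) auto
        then show ?thesis
          by (cases "?t \<ge> 0") (auto intro: order_trans[of _ 0])
      qed
      then have "(\<Sum>j<2 * L. 2 ^ Suc j * (\<Sum>a\<in>S. 1 - Re (coef (e j) (pt a c0) (pt a c0)))) \<le>
          (\<Sum>j<2 * L. 2 ^ Suc j * enn2real (\<Psi> (C * 2 ^ (2 * L - j))))"
        by (intro sum_mono mult_left_mono) simp_all
      moreover have "(2::real) ^ 0 * real (card S) = 4 ^ L" unfolding card_S' by (simp add: power_mult)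
      ultimately show ?thesis
        unfolding Suc_eq_plus1[symmetric] by (simp only: mult_left_mono add_left_mono of_nat_0_le_iff)
    qed
    finally have upper: "(\<Sum>t\<in>A. (cmod (cinner (vec (U t) c0 (\<lambda>_. 1)) (vec S c0 (f t))))\<^sup>2) \<le>
        real (2 * L + 1) * (4 ^ L + (\<Sum>j<2 * L. 2 ^ Suc j * enn2real (\<Psi> (C * 2 ^ (2 * L - j)))))" .
    \<comment> \<open>The corner is a product set and the column is a product, so the pairing
      factors into two truncated column sums.\<close>
    have pair: "cinner (vec (U (n, m)) c0 (\<lambda>_. 1)) (vec S c0 (f (n, m))) =
        complex_of_real ((\<Sum>i<n. W i n) * (\<Sum>j<m. W j m))" if "(n, m) \<in> A" for n m
    proof -
      have "cinner (vec (U (n, m)) c0 (\<lambda>_. 1)) (vec S c0 (f (n, m))) = (\<Sum>a\<in>U (n, m). f (n, m) a)"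
        unfolding cinner_vec using US[OF that] by (intro sum.cong) (auto simp: nth_vec[OF S(1)])
      also have "\<dots> = (\<Sum>p\<in>{..<n} \<times> {..<m}. f (n, m) (emb p))"
        unfolding U_emb[OF that] by (subst sum.reindex) (auto intro: inj_on_subset[OF inj])
      also have "\<dots> = complex_of_real ((\<Sum>i<n. W i n) * (\<Sum>j<m. W j m))"
        by (simp add: f_def emb_def sum_product sum.cartesian_product case_prod_unfold)
      finally show ?thesis .
    qed
    have "(\<Sum>t\<in>A. (cmod (cinner (vec (U t) c0 (\<lambda>_. 1)) (vec S c0 (f t))))\<^sup>2) =
        (\<Sum>t\<in>A. (\<Sum>i<fst t. W i (fst t))\<^sup>2 * (\<Sum>j<snd t. W j (snd t))\<^sup>2)"
    proof (rule sum.cong[OF refl])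
      fix t assume "t \<in> A"
      then show "(cmod (cinner (vec (U t) c0 (\<lambda>_. 1)) (vec S c0 (f t))))\<^sup>2 =
          (\<Sum>i<fst t. W i (fst t))\<^sup>2 * (\<Sum>j<snd t. W j (snd t))\<^sup>2"
        using pair[of "fst t" "snd t"] by (simp only: prod.collapse norm_of_real power2_abs power_mult_distrib)
    qed
    also have "\<dots> = (\<Sum>n\<in>{1..d}. (\<Sum>i<n. W i n)\<^sup>2)\<^sup>2"
    proof -
      have "(\<Sum>t\<in>A. g (fst t) * g (snd t)) = (\<Sum>n\<in>{1..d}. g n)\<^sup>2" for g :: "nat \<Rightarrow> real"
        by (simp add: A_def power2_eq_square sum_product sum.cartesian_product case_prod_unfold)
      then show ?thesis .
    qed
    also have "\<dots> \<ge> (2 ^ L * (real L)\<^sup>2 / 512)\<^sup>2"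
      unfolding W_def d_def by (intro power_mono cosec_matrix_truncation_ge L) simp
    finally show "(2 ^ L * (real L)\<^sup>2 / 512)\<^sup>2 \<le>
        real (2 * L + 1) * (4 ^ L + (\<Sum>j<2 * L. 2 ^ Suc j * enn2real (\<Psi> (C * 2 ^ (2 * L - j)))))"
      using upper by linarith
  qed
qed

lemma not_little_o:
  fixes \<Psi> :: "real \<Rightarrow> ennreal"
  assumes wt: "strong_maximal_weak_type (block_alg (map_prod blocks blocks)) tr
      (\<lambda>n m. pinch (map_prod (corner n) (corner m))) \<Psi>"
    and \<Psi>: "\<Psi> 0 = 0" "\<And>s. s \<ge> 0 \<Longrightarrow> \<Psi> s < \<infinity>"
  shows "\<not> ((\<lambda>s. \<Psi> s / ennreal (s * (1 + log_plus s)\<^sup>2)) \<longlongrightarrow> 0) at_top"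
proof
  assume lim: "((\<lambda>s. \<Psi> s / ennreal (s * (1 + log_plus s)\<^sup>2)) \<longlongrightarrow> 0) at_top"
  obtain C where C: "C \<ge> 0" and ineq: "\<And>L. L \<ge> 2 \<Longrightarrow> (2 ^ L * (real L)\<^sup>2 / 512)\<^sup>2 \<le>
    real (2 * L + 1) * (4 ^ L + (\<Sum>j<2 * L. 2 ^ Suc j * enn2real (\<Psi> (C * 2 ^ (2 * L - j)))))"
    using dyadic_inequality[OF wt \<Psi>] by blast
  \<comment> \<open>With m = 2L - j one has 2^j = 4^L / 2^m, so level j contributes 4^L * 2 \<delta>
    m and the common factor 4^L cancels. The constant \<open>1 / 512\<^sup>2\<close> below is the
    square of the one in the truncation bound.\<close>
  define \<delta> where "\<delta> m = enn2real (\<Psi> (C * 2 ^ m)) / 2 ^ m" for m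
  have "\<exists>L\<ge>2. real (2 * L + 1) * (1 + 2 * (\<Sum>m\<in>{1..2 * L}. \<delta> m)) < 1 / 512\<^sup>2 * real L ^ 4"
    unfolding \<delta>_def by (rule log_squared_sequence_bound[OF young_dyadic_bound[OF lim \<Psi>(1) C]]) simp_all
  then obtain L where L: "L \<ge> 2" and lt: "real (2 * L + 1) * (1 + 2 * (\<Sum>m\<in>{1..2 * L}. \<delta> m)) < 1 / 512\<^sup>2 * real L ^ 4"
    by blast
  have four: "(4::real) ^ L = 2 ^ (2 * L)" by (simp add: power_mult)
  have "(\<Sum>j<2 * L. 2 ^ Suc j * enn2real (\<Psi> (C * 2 ^ (2 * L - j)))) = (\<Sum>m\<in>{1..2 * L}. 4 ^ L * (2 * \<delta> m))"
  proof (rule sum.reindex_bij_witness[of _ "\<lambda>m. 2 * L - m" "\<lambda>j. 2 * L - j"])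
    fix j assume "j \<in> {..<2 * L}"
    then have "(2::real) ^ (2 * L) = 2 ^ j * 2 ^ (2 * L - j)" by (simp flip: power_add)
    then show "4 ^ L * (2 * \<delta> (2 * L - j)) = 2 ^ Suc j * enn2real (\<Psi> (C * 2 ^ (2 * L - j)))"
      by (simp add: \<delta>_def four)
  qed auto
  then have "4 ^ L + (\<Sum>j<2 * L. 2 ^ Suc j * enn2real (\<Psi> (C * 2 ^ (2 * L - j)))) =
      4 ^ L * (1 + 2 * (\<Sum>m\<in>{1..2 * L}. \<delta> m))"
    by (simp add: sum_distrib_left distrib_left)
  with ineq[OF L] have "(2 ^ L * (real L)\<^sup>2 / 512)\<^sup>2 \<le> 4 ^ L * (real (2 * L + 1) * (1 + 2 * (\<Sum>m\<in>{1..2 * L}. \<delta> m)))"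
    by (simp only: mult_ac)
  also have "\<dots> < 4 ^ L * (1 / 512\<^sup>2 * real L ^ 4)"
    using lt by (intro mult_strict_left_mono) auto
  also have "\<dots> = (2 ^ L * (real L)\<^sup>2 / 512)\<^sup>2"
    by (simp add: four power_mult_distrib power_divide power_mult[symmetric] mult.commute)
  finally show False by simp
qed

end

theorem corollary3:
  fixes \<Psi> :: "real \<Rightarrow> ennreal"
  assumes "infinite (UNIV :: 'a set)" "infinite (UNIV :: 'b set)"
    and "young_function \<Psi>" "locally_finite \<Psi>"
    and weak_type: "\<And>(M :: 'a op set) \<tau>M (N :: 'b op set) \<tau>N Ms Ns EM EN \<tau> E.
      finite_von_neumann_algebra M \<tau>M \<Longrightarrow> finite_von_neumann_algebra N \<tau>N \<Longrightarrow>
      vn_filtration M Ms \<Longrightarrow> vn_filtration N Ns \<Longrightarrow>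
      (\<forall>n. conditional_expectation M \<tau>M (Ms n) (EM n)) \<Longrightarrow>
      (\<forall>m. conditional_expectation N \<tau>N (Ns m) (EN m)) \<Longrightarrow>
      tensor_functional M \<tau>M N \<tau>N \<tau> \<Longrightarrow>
      (\<forall>n m. tensor_map M (Ms n) (EM n) N (Ns m) (EN m) (E n m)) \<Longrightarrow>
      strong_maximal_weak_type (M \<otimes>\<^sub>v\<^sub>N N) \<tau> E \<Psi>"
  shows "\<not> ((\<lambda>s. \<Psi> s / ennreal (s * (1 + log_plus s)\<^sup>2)) \<longlongrightarrow> 0) at_top"
proof -
  obtain idx1 :: "'a \<Rightarrow> nat \<times> nat" and cpy1 :: "'a \<Rightarrow> 'a" and pt1 where g1: "grid idx1 cpy1 pt1"
    using grid_exists[OF assms(1)] .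
  obtain idx2 :: "'b \<Rightarrow> nat \<times> nat" and cpy2 :: "'b \<Rightarrow> 'b" and pt2 where g2: "grid idx2 cpy2 pt2"
    using grid_exists[OF assms(2)] .
  have inf: "infinite (UNIV :: (nat \<times> nat) set)" by (simp add: finite_prod)
  interpret A: grid idx1 cpy1 pt1 by (rule g1)
  interpret B: grid idx2 cpy2 pt2 by (rule g2)
  \<comment> \<open>Any copy can serve as the base point of the traces, hence
    \<open>undefined\<close>.\<close>
  interpret W: weighted_grid_product idx1 cpy1 pt1 normalized_weight undefined idx2 cpy2 pt2 normalized_weight undefined
    by unfold_locales (rule normalized_weight inf)+
  interpret D: double_block_grid "map_prod idx1 idx2" "map_prod cpy1 cpy2"
    "\<lambda>a c. (pt1 (fst a) (fst c), pt2 (snd a) (snd c))"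
    "\<lambda>a. normalized_weight (fst a) * normalized_weight (snd a)" "(undefined, undefined)"
    by unfold_locales simp
  have "strong_maximal_weak_type (A.block_alg blocks \<otimes>\<^sub>v\<^sub>N B.block_alg blocks) W.P.tr
      (\<lambda>n m. W.P.pinch (map_prod (corner n) (corner m))) \<Psi>"
  proof (rule weak_type)
    show "finite_von_neumann_algebra (A.block_alg blocks) W.A.tr"
      by (rule W.A.finite_vn_block_alg[OF finite_blocks normalized_weight_blocks])
    show "finite_von_neumann_algebra (B.block_alg blocks) W.B.tr"
      by (rule W.B.finite_vn_block_alg[OF finite_blocks normalized_weight_blocks])
    show "vn_filtration (A.block_alg blocks) (\<lambda>n. A.block_alg (corner n))"
      by (rule A.vn_filtration_block_alg[OF finite_corner corner_Suc corner_blocks corner_eventually])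
    show "vn_filtration (B.block_alg blocks) (\<lambda>n. B.block_alg (corner n))"
      by (rule B.vn_filtration_block_alg[OF finite_corner corner_Suc corner_blocks corner_eventually])
    show "\<forall>n. conditional_expectation (A.block_alg blocks) W.A.tr (A.block_alg (corner n)) (A.pinch (corner n))"
      by (intro allI W.A.conditional_expectation_pinch corner_blocks)
    show "\<forall>n. conditional_expectation (B.block_alg blocks) W.B.tr (B.block_alg (corner n)) (B.pinch (corner n))"
      by (intro allI W.B.conditional_expectation_pinch corner_blocks)
    show "tensor_functional (A.block_alg blocks) W.A.tr (B.block_alg blocks) W.B.tr W.P.tr"
      by (rule W.tensor_functional_tr[OF finite_blocks finite_blocks])
    show "\<forall>n m. tensor_map (A.block_alg blocks) (A.block_alg (corner n)) (A.pinch (corner n))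
        (B.block_alg blocks) (B.block_alg (corner m)) (B.pinch (corner m)) (W.P.pinch (map_prod (corner n) (corner m)))"
      by (intro allI W.tensor_map_pinch finite_blocks finite_corner corner_blocks)
  qed
  then have "strong_maximal_weak_type (W.P.block_alg (map_prod blocks blocks)) W.P.tr
      (\<lambda>n m. W.P.pinch (map_prod (corner n) (corner m))) \<Psi>"
    by (simp only: W.vn_tensor_block_alg[OF finite_blocks finite_blocks])
  then show ?thesis
  proof (rule D.not_little_o)
    show "\<Psi> 0 = 0" using assms(3) by (simp add: young_function_def)
    show "\<Psi> s < \<infinity>" if "s \<ge> 0" for s
      using assms(4) that unfolding locally_finite_def by (elim allE[of _ "{s}"]) auto
  qed
qed

end
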